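(* Let $(n_m)$ be any sequence of positive integers. Then, as $m\to\infty$, $$R_m^{\mathbb R}\to0\ \text{ in }\mu^{\mathbb R}_{m,n_m}\text{-measure}\quad\Longleftrightarrow\quad n_m\to\infty,$$ where the left-hand side means that for every $\varepsilon>0$, $\mu^{\mathbb R}_{m,n_m}\{a: R_m^{\mathbb R}(a)>\varepsilon\}\to0$. Moreover, for every fixed $n\ge1$ and every $\varepsilon>0$ there are constants $0<c_{n,\varepsilon}<C_{n,\varepsilon}<\infty$ such that $$\mu^{\mathbb R}_{m,n}\{a: c_{n,\varepsilon}\le R_m^{\mathbb R}(a)\le C_{n,\varepsilon}\}\ge1-\varepsilon$$ for all sufficiently large $m$.
   Context: $\mathcal M_{m,n}:=\{\alpha\in\mathbb N_0^n:|\alpha|=m\}$ and $q_m:=2m/(m+1)$. For $a=(a_\alpha)_{|\alpha|=m}\in\mathbb R^{\mathcal M_{m,n}}$ let $\|a\|_p:=(\sum_\alpha|a_\alpha|^p)^{1/p}$, $P_a^{\mathbb R}(x):=\sum_{|\alpha|=m}a_\alpha x^\alpha$ for $x\in\mathbb R^n$, $\|P_a^{\mathbb R}\|_{\infty,\mathbb R}:=\sup_{x\in[-1,1]^n}|P_a^{\mathbb R}(x)|$, and $R_m^{\mathbb R}(a):=\|a\|_{q_m}/\|P_a^{\mathbb R}\|_{\infty,\mathbb R}$ for $a\ne0$, $R_m^{\mathbb R}(0):=0$. $\mu^{\mathbb R}_{m,n}$ is normalized (total mass one) Euclidean surface measure on the unit sphere $\{a\in\mathbb R^{\mathcal M_{m,n}}:\|a\|_2=1\}$.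 *)

theory Defs
  imports "HOL-Analysis.Analysis"
begin

definition multi_indices :: "nat \<Rightarrow> nat \<Rightarrow> (nat \<Rightarrow> nat) set" where
  "multi_indices m n = {\<alpha> \<in> {..<n} \<rightarrow>\<^sub>E UNIV. (\<Sum>j<n. \<alpha> j) = m}"

definition lp_norm :: "real \<Rightarrow> 'i set \<Rightarrow> ('i \<Rightarrow> real) \<Rightarrow> real" where
  "lp_norm p I a = (\<Sum>i\<in>I. \<bar>a i\<bar> powr p) powr (1 / p)"

definition hom_poly :: "nat \<Rightarrow> nat \<Rightarrow> ((nat \<Rightarrow> nat) \<Rightarrow> real) \<Rightarrow> (nat \<Rightarrow> real) \<Rightarrow> real" where
  "hom_poly m n a x = (\<Sum>\<alpha>\<in>multi_indices m n. a \<alpha> * (\<Prod>j<n. x j ^ \<alpha> j))"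

definition cube_norm :: "nat \<Rightarrow> nat \<Rightarrow> ((nat \<Rightarrow> nat) \<Rightarrow> real) \<Rightarrow> real" where
  "cube_norm m n a = (SUP x \<in> {..<n} \<rightarrow>\<^sub>E {-1..1}. \<bar>hom_poly m n a x\<bar>)"

definition BH_exponent :: "nat \<Rightarrow> real" where
  "BH_exponent m = 2 * real m / (real m + 1)"

definition BH_ratio :: "nat \<Rightarrow> nat \<Rightarrow> ((nat \<Rightarrow> nat) \<Rightarrow> real) \<Rightarrow> real" where
  "BH_ratio m n a =
     (if \<forall>\<alpha>\<in>multi_indices m n. a \<alpha> = 0 then 0
      else lp_norm (BH_exponent m) (multi_indices m n) a / cube_norm m n a)"

definition unit_sphere :: "'i set \<Rightarrow> ('i \<Rightarrow> real) set" where
  "unit_sphere I = {a \<in> extensional I. lp_norm 2 I a = 1}"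

text \<open>Euclidean surface measure on the unit sphere of the space of real families over a finite
  index set \<open>I\<close>, by the usual polar-coordinate definition: the surface measure of \<open>E\<close> is
  \<open>card I\<close> times the Lebesgue measure of the cone of all \<open>r a\<close> with \<open>0 < r \<le> 1\<close> and \<open>a \<in> E\<close>
  (see \<open>emeasure_sphere_surface\<close> below). The cone is written as the preimage of \<open>E\<close> under
  the radial projection of the punctured unit ball. If \<open>I\<close> is a singleton, this is the counting
  measure on a two-point sphere.\<close>

definition sphere_surface :: "'i set \<Rightarrow> ('i \<Rightarrow> real) measure" where
  "sphere_surface I =
     scale_measure (of_nat (card I))
       (distr (restrict_space (\<Pi>\<^sub>M i\<in>I. lborel) {x. 0 < lp_norm 2 I x \<and> lp_norm 2 I x \<le> 1})
              (restrict_space (\<Pi>\<^sub>M i\<in>I. borel) (unit_sphere I))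
              (\<lambda>x. \<lambda>i\<in>I. x i / lp_norm 2 I x))"

definition sphere_prob :: "'i set \<Rightarrow> ('i \<Rightarrow> real) measure" where
  "sphere_prob I = uniform_measure (sphere_surface I) (unit_sphere I)"

definition coeff_measure :: "nat \<Rightarrow> nat \<Rightarrow> ((nat \<Rightarrow> nat) \<Rightarrow> real) measure" where
  "coeff_measure m n = sphere_prob (multi_indices m n)"

lemma finite_multi_indices: "finite (multi_indices m n)"
proof (rule finite_subset)
  show "multi_indices m n \<subseteq> {..<n} \<rightarrow>\<^sub>E {..m}"
  proof
    fix \<alpha> assume \<alpha>: "\<alpha> \<in> multi_indices m n"
    then have "\<alpha> j \<le> m" if "j < n" for j
      using that member_le_sum[of j "{..<n}" \<alpha>] by (simp add: multi_indices_def)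
    with \<alpha> show "\<alpha> \<in> {..<n} \<rightarrow>\<^sub>E {..m}"
      by (simp add: multi_indices_def PiE_iff)
  qed
qed (auto intro: finite_PiE)

lemma multi_indices_nonempty: "0 < n \<Longrightarrow> multi_indices m n \<noteq> {}"
proof -
  assume n: "0 < n"
  have "(\<lambda>j\<in>{..<n}. if j = 0 then m else 0) \<in> multi_indices m n"
    using n by (simp add: multi_indices_def sum.delta)
  then show ?thesis by blast
qed

lemma lp_norm_2: "lp_norm 2 I a = L2_set a I"
  unfolding lp_norm_def L2_set_def
  by (simp add: powr_half_sqrt sum_nonneg)

lemma space_sphere_surface: "space (sphere_surface I) = unit_sphere I"
  by (auto simp: sphere_surface_def space_scale_measure space_restrict_space space_PiM
      unit_sphere_def PiE_def)

lemma sets_sphere_surface: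
  "sets (sphere_surface I) = sets (restrict_space (\<Pi>\<^sub>M i\<in>I. borel) (unit_sphere I))"
  by (simp add: sphere_surface_def)

lemma L2_set_borel [measurable]:
  "(\<lambda>x. L2_set x I) \<in> borel_measurable (\<Pi>\<^sub>M i\<in>I. (borel :: real measure))"
  unfolding L2_set_def by measurable

lemma sets_PiM_lborel: "sets (\<Pi>\<^sub>M i\<in>I. lborel) = sets (\<Pi>\<^sub>M i\<in>I. (borel :: real measure))"
  by (rule sets_PiM_cong) auto

lemma L2_set_scale: "0 \<le> r \<Longrightarrow> L2_set (\<lambda>i\<in>I. r * a i) I = r * L2_set a I"
  by (simp add: L2_set_right_distrib cong: L2_set_cong)

lemma radial_measurable:
  "(\<lambda>x. \<lambda>i\<in>I. x i / L2_set x I)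
     \<in> restrict_space (\<Pi>\<^sub>M i\<in>I. lborel) {x. 0 < L2_set x I \<and> L2_set x I \<le> 1}
       \<rightarrow>\<^sub>M restrict_space (\<Pi>\<^sub>M i\<in>I. borel) (unit_sphere I)"
proof (rule measurable_restrict_space2)
  show "(\<lambda>x. \<lambda>i\<in>I. x i / L2_set x I)
     \<in> space (restrict_space (\<Pi>\<^sub>M i\<in>I. lborel) {x. 0 < L2_set x I \<and> L2_set x I \<le> 1}) \<rightarrow> unit_sphere I"
  proof
    fix x assume "x \<in> space (restrict_space (\<Pi>\<^sub>M i\<in>I. lborel) {x. 0 < L2_set x I \<and> L2_set x I \<le> 1})"
    then have "0 < L2_set x I" by (simp add: space_restrict_space)
    then show "(\<lambda>i\<in>I. x i / L2_set x I) \<in> unit_sphere I"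
      using L2_set_scale[where r = "1 / L2_set x I" and I = I and a = x]
      by (simp add: unit_sphere_def lp_norm_2 field_simps)
  qed
  have "(\<lambda>x. \<lambda>i\<in>I. x i / L2_set x I) \<in> (\<Pi>\<^sub>M i\<in>I. borel) \<rightarrow>\<^sub>M (\<Pi>\<^sub>M i\<in>I. (borel::real measure))"
    by measurable
  also have "\<dots> = (\<Pi>\<^sub>M i\<in>I. lborel) \<rightarrow>\<^sub>M (\<Pi>\<^sub>M i\<in>I. borel)"
    by (rule measurable_cong_sets) (simp_all add: sets_PiM_lborel)
  finally show "(\<lambda>x. \<lambda>i\<in>I. x i / L2_set x I)
     \<in> restrict_space (\<Pi>\<^sub>M i\<in>I. lborel) {x. 0 < L2_set x I \<and> L2_set x I \<le> 1} \<rightarrow>\<^sub>M (\<Pi>\<^sub>M i\<in>I. borel)"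
    by (rule measurable_restrict_space1)
qed

lemma radial_preimage:
  assumes E: "E \<subseteq> unit_sphere I"
  shows "{x \<in> extensional I. 0 < L2_set x I \<and> L2_set x I \<le> 1 \<and> (\<lambda>i\<in>I. x i / L2_set x I) \<in> E}
         = {(\<lambda>i\<in>I. r * a i) | r a. 0 < r \<and> r \<le> 1 \<and> a \<in> E}"
proof (intro equalityI subsetI)
  fix x assume x: "x \<in> {x \<in> extensional I. 0 < L2_set x I \<and> L2_set x I \<le> 1
                        \<and> (\<lambda>i\<in>I. x i / L2_set x I) \<in> E}"
  then have "x = (\<lambda>i\<in>I. L2_set x I * (\<lambda>i\<in>I. x i / L2_set x I) i)"
    by (auto simp: fun_eq_iff extensional_def restrict_def)
  with x show "x \<in> {(\<lambda>i\<in>I. r * a i) | r a. 0 < r \<and> r \<le> 1 \<and> a \<in> E}" by blast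
next
  fix x assume "x \<in> {(\<lambda>i\<in>I. r * a i) | r a. 0 < r \<and> r \<le> 1 \<and> a \<in> E}"
  then obtain r a where *: "x = (\<lambda>i\<in>I. r * a i)" "0 < r" "r \<le> 1" "a \<in> E" by blast
  with E have a: "a \<in> extensional I" "L2_set a I = 1"
    by (auto simp: unit_sphere_def lp_norm_2)
  have n: "L2_set x I = r" using * a by (simp add: L2_set_scale)
  have "(\<lambda>i\<in>I. x i / r) = a"
    using * a by (auto simp: fun_eq_iff extensional_def restrict_def)
  then show "x \<in> {x \<in> extensional I. 0 < L2_set x I \<and> L2_set x I \<le> 1
                   \<and> (\<lambda>i\<in>I. x i / L2_set x I) \<in> E}"
    using * n by simp
qed

lemma emeasure_sphere_surface:
  assumes E: "E \<in> sets (sphere_surface I)"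
  shows "emeasure (sphere_surface I) E =
    of_nat (card I) *
    emeasure (\<Pi>\<^sub>M i\<in>I. lborel) {(\<lambda>i\<in>I. r * a i) | r a. 0 < r \<and> r \<le> 1 \<and> a \<in> E}"
proof -
  let ?B = "{x. 0 < L2_set x I \<and> L2_set x I \<le> 1}"
  let ?f = "\<lambda>x. \<lambda>i\<in>I. x i / L2_set x I"
  let ?L = "\<Pi>\<^sub>M i\<in>I. (lborel :: real measure)"
  have Esub: "E \<subseteq> unit_sphere I" using sets.sets_into_space[OF E] by (simp add: space_sphere_surface)
  have "?B \<inter> space ?L = {x \<in> space (\<Pi>\<^sub>M i\<in>I. (borel :: real measure)). 0 < L2_set x I \<and> L2_set x I \<le> 1}"
    by (auto simp: space_PiM)
  also have "\<dots> \<in> sets (\<Pi>\<^sub>M i\<in>I. borel)" by measurable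
  finally have B: "?B \<inter> space ?L \<in> sets ?L" by (simp add: sets_PiM_lborel)
  have eq: "?f -` E \<inter> space (restrict_space ?L ?B) = {(\<lambda>i\<in>I. r * a i) | r a. 0 < r \<and> r \<le> 1 \<and> a \<in> E}"
    unfolding radial_preimage[OF Esub, symmetric]
    by (auto simp: space_restrict_space space_PiM PiE_def)
  have "emeasure (sphere_surface I) E =
          of_nat (card I) * emeasure (restrict_space ?L ?B) (?f -` E \<inter> space (restrict_space ?L ?B))"
    using E radial_measurable[of I]
    by (simp add: sphere_surface_def lp_norm_2 emeasure_distr)
  also have "emeasure (restrict_space ?L ?B) (?f -` E \<inter> space (restrict_space ?L ?B))
           = emeasure ?L (?f -` E \<inter> space (restrict_space ?L ?B))"
    using B by (intro emeasure_restrict_space) (auto simp: space_restrict_space Int_commute)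
  finally show ?thesis unfolding eq .
qed

lemma unit_sphere_sets: "unit_sphere I \<in> sets (sphere_surface I)"
  using sets.top[of "sphere_surface I"] by (simp add: space_sphere_surface)

lemma emeasure_sphere_surface_total:
  assumes I: "finite I" "I \<noteq> {}"
  shows "0 < emeasure (sphere_surface I) (unit_sphere I)"
    and "emeasure (sphere_surface I) (unit_sphere I) < \<infinity>"
proof -
  interpret product_sigma_finite "\<lambda>_::'a. (lborel :: real measure)"
    by standard
  let ?L = "\<Pi>\<^sub>M i\<in>I. (lborel :: real measure)"
  define C where "C = {x \<in> extensional I. 0 < L2_set x I \<and> L2_set x I \<le> 1}"
  define N where "N = real (card I)"
  have N: "1 \<le> N" using I by (simp add: N_def Suc_le_eq card_gt_0_iff)
  have "{x \<in> extensional I. 0 < L2_set x I \<and> L2_set x I \<le> 1 \<and> (\<lambda>i\<in>I. x i / L2_set x I) \<in> unit_sphere I} = C"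
  proof -
    have "(\<lambda>i\<in>I. x i / L2_set x I) \<in> unit_sphere I" if "0 < L2_set x I" for x
      using that L2_set_scale[where r = "1 / L2_set x I" and I = I and a = x]
      by (simp add: unit_sphere_def lp_norm_2 field_simps)
    then show ?thesis by (auto simp: C_def)
  qed
  then have tot: "emeasure (sphere_surface I) (unit_sphere I) = of_nat (card I) * emeasure ?L C"
    by (simp add: emeasure_sphere_surface[OF unit_sphere_sets] radial_preimage)
  have "C = {x \<in> space (\<Pi>\<^sub>M i\<in>I. (borel :: real measure)). 0 < L2_set x I \<and> L2_set x I \<le> 1}"
    by (auto simp: C_def space_PiM PiE_def)
  also have "\<dots> \<in> sets (\<Pi>\<^sub>M i\<in>I. borel)" by measurable
  finally have Cm: "C \<in> sets ?L" by (simp add: sets_PiM_lborel)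
  have box: "(\<Pi>\<^sub>E i\<in>I. {l..u}) \<in> sets ?L" for l u :: real
    using I by (intro sets_PiM_I_finite) auto
  have "(\<Pi>\<^sub>E i\<in>I. {1 / (2 * N)..1 / N}) \<subseteq> C"
  proof
    fix x assume x: "x \<in> (\<Pi>\<^sub>E i\<in>I. {1 / (2 * N)..1 / N})"
    have pos: "0 < x i" if "i \<in> I" for i
    proof -
      have "0 < 1 / (2 * N)" using N by simp
      also have "\<dots> \<le> x i" using x that by auto
      finally show ?thesis .
    qed
    obtain i where "i \<in> I" using I by auto
    then have "0 < L2_set x I" using member_le_L2_set[of I i x] pos[of i] I by simp
    moreover have "L2_set x I \<le> (\<Sum>i\<in>I. x i)"
      using pos by (intro L2_set_le_sum) (auto simp: less_imp_le)
    moreover have "(\<Sum>i\<in>I. x i) \<le> (\<Sum>i\<in>I. 1 / N)"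
      using x by (intro sum_mono) auto
    moreover have "(\<Sum>i\<in>I. 1 / N) = 1" using N by (simp add: N_def)
    ultimately show "x \<in> C" using x by (auto simp: C_def PiE_def)
  qed
  then have "emeasure ?L (\<Pi>\<^sub>E i\<in>I. {1 / (2 * N)..1 / N}) \<le> emeasure ?L C"
    using Cm by (rule emeasure_mono)
  moreover have "0 < emeasure ?L (\<Pi>\<^sub>E i\<in>I. {1 / (2 * N)..1 / N})"
    using I N by (subst emeasure_PiM) (auto simp: frac_le field_simps zero_less_iff_neq_zero)
  ultimately have "0 < emeasure ?L C" by order
  then show "0 < emeasure (sphere_surface I) (unit_sphere I)"
    using I by (simp add: tot ennreal_zero_less_mult_iff card_gt_0_iff)
  have "C \<subseteq> (\<Pi>\<^sub>E i\<in>I. {-1..1})"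
  proof
    fix x assume x: "x \<in> C"
    have "x i \<in> {-1..1}" if "i \<in> I" for i
    proof -
      have "\<bar>x i\<bar> \<le> L2_set (\<lambda>i. \<bar>x i\<bar>) I" using I that by (intro member_le_L2_set)
      also have "L2_set (\<lambda>i. \<bar>x i\<bar>) I = L2_set x I" by (simp add: L2_set_def)
      also have "\<dots> \<le> 1" using x by (simp add: C_def)
      finally show ?thesis by auto
    qed
    then show "x \<in> (\<Pi>\<^sub>E i\<in>I. {-1..1})" using x by (auto simp: C_def PiE_def)
  qed
  then have "emeasure ?L C \<le> emeasure ?L (\<Pi>\<^sub>E i\<in>I. {-1..1})"
    using box by (rule emeasure_mono)
  also have "\<dots> < \<infinity>"
    using I by (subst emeasure_PiM) (auto simp: power_less_top_ennreal)
  finally have "emeasure ?L C < \<infinity>" .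
  then show "emeasure (sphere_surface I) (unit_sphere I) < \<infinity>"
    by (simp add: tot ennreal_mult_less_top of_nat_less_top)
qed

lemma emeasure_coeff_measure_space:
  assumes "0 < n"
  shows "emeasure (coeff_measure m n) (space (coeff_measure m n)) = 1"
proof -
  let ?S = "sphere_surface (multi_indices m n)" and ?U = "unit_sphere (multi_indices m n)"
  note t = emeasure_sphere_surface_total[OF finite_multi_indices multi_indices_nonempty[OF assms], of m]
  have "emeasure (uniform_measure ?S ?U) ?U = 1"
    using t by (subst emeasure_uniform_measure) (auto simp: unit_sphere_sets ennreal_divide_self)
  then show ?thesis
    by (simp add: coeff_measure_def sphere_prob_def space_sphere_surface)
qed

end

theory Submission
  imports Defs "HOL-Probability.Probability" "HOL-Real_Asymp.Real_Asymp"
begin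

text \<open>
  The ratio is invariant under positive scaling, so the sphere may be replaced by a standard Gaussian
  vector \<open>g\<close> indexed by the \<open>N\<close> multi-indices. Its \<open>q_m\<close>-norm lies between the Euclidean
  norm and \<open>N^(1/(2m))\<close> times it, which is at most of order \<open>sqrt (N (1 + n/m))\<close>.

  If \<open>m\<close> and \<open>n\<close> both tend to infinity, the sup norm is much larger than this already on
  the points of \<open>{-1,1}^n\<close>: by the second moment method applied to the average of
  \<open>exp (l P_g(x) / sqrt N)\<close> over these points with \<open>l^2 = C (1 + n/m)\<close>, it exceeds
  \<open>l sqrt N / 4\<close> with high probability, provided the average of \<open>exp (l^2 h_m(x) / N)\<close>, with
  \<open>h_m\<close> the complete homogeneous symmetric polynomial, tends to one. For \<open>n \<le> A m\<close> this
  follows from counting parity classes of multi-indices; for larger \<open>n\<close> the generating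
  function of the \<open>h_m\<close> shows that \<open>h_m(x) / N\<close> is tiny unless \<open>\<bar>x_1 + \<dots> + x_n\<bar>\<close> is
  atypically large.

  If \<open>n\<close> is fixed, summation by parts in each variable dominates the sup norm by a maximum of
  signed partial sums of \<open>g\<close>, and Levy's reflection inequality bounds its tail by \<open>4^n\<close> times
  that of \<open>\<bar>P_g(1, \<dots>, 1)\<bar>\<close>, which is also a lower bound for the sup norm.
\<close>

subsection \<open>The sphere measure and Gaussian vectors\<close>

text \<open>The obstacle is that \<open>l\<close> cannot stay bounded when n/m is large, since the
  sup norm must beat a coefficient norm carrying the factor sqrt (1 + n/m). While n/m is bounded,
  exp (l^2 h_m/N) can be linearised, and decay of the mean of |h_m|/N suffices; this follows from a
  second moment. When n/m is large, linearising would cost exp (C n/m), so pointwise decay of h_m/N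
  is needed. It comes from a Cauchy estimate for the generating function, with a radius adapted to
  the size of the sum of the signs. Only h_m at one point appears because the product of two sign
  vectors is a sign vector, so that averages over pairs collapse. For fixed n there is no such
  competition: the sup norm and the Euclidean norm both have order sqrt N, and the coefficient norm
  exceeds the latter by at most a factor depending on n. This also gives the converse half of the
  equivalence: along any value that n_m takes infinitely often, the ratio stays away from zero with
  probability at least 1/2.\<close>

lemma space_PiM_lborel: "space (\<Pi>\<^sub>M i\<in>I. lborel) = (extensional I :: ('i \<Rightarrow> real) set)"
  by (simp add: space_PiM PiE_def)

text \<open>On a box this is the one-dimensional substitution in each coordinate, and boxes
  determine the product measure. It supplies the growth \<open>u ^ N\<close> of truncated cones in
  \<open>gauss_cone\<close>.\<close>

lemma emeasure_PiM_lborel_scale: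
  fixes I :: "'i set"
  assumes I: "finite I" and u: "0 < u" and A: "A \<in> sets (\<Pi>\<^sub>M i\<in>I. (lborel :: real measure))"
  shows "ennreal (u ^ card I) * emeasure (\<Pi>\<^sub>M i\<in>I. lborel) ((\<lambda>x. \<lambda>i\<in>I. u * x i) -` A \<inter> extensional I)
       = emeasure (\<Pi>\<^sub>M i\<in>I. lborel) A"
proof -
  interpret product_sigma_finite "\<lambda>_::'i. (lborel :: real measure)"
    by standard
  let ?L = "\<Pi>\<^sub>M i\<in>I. (lborel :: real measure)"
  let ?T = "\<lambda>x. \<lambda>i\<in>I. u * x i"
  have "scale_measure (ennreal (u ^ card I)) (distr ?L ?L ?T) = ?L"
  proof (rule PiM_eqI)
    fix B :: "'i \<Rightarrow> real set" assume B: "\<And>i. i \<in> I \<Longrightarrow> B i \<in> sets lborel"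
    have eq: "?T -` Pi\<^sub>E I B \<inter> space ?L = (\<Pi>\<^sub>E i\<in>I. (*) u -` B i \<inter> space lborel)"
      by (auto simp: space_PiM PiE_iff)
    have m: "(*) u -` B i \<inter> space lborel \<in> sets lborel" if "i \<in> I" for i
      using B[OF that] by (intro measurable_sets[of _ lborel borel]) auto
    have "emeasure (distr lborel borel ((*) u)) (B i) = emeasure lborel ((*) u -` B i \<inter> space lborel)" if "i \<in> I" for i
      using B[OF that] by (subst emeasure_distr) auto
    moreover have "emeasure (distr lborel borel ((*) u)) (B i) = ennreal (inverse u) * emeasure lborel (B i)" if "i \<in> I" for i
      using B[OF that] u by (subst lborel_distr_mult) (auto simp: emeasure_density nn_integral_cmult_indicator)
    ultimately have *: "emeasure lborel ((*) u -` B i \<inter> space lborel) = ennreal (inverse u) * emeasure lborel (B i)" if "i \<in> I" for i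
      using that by simp
    have "emeasure (scale_measure (ennreal (u ^ card I)) (distr ?L ?L ?T)) (Pi\<^sub>E I B) =
       ennreal (u ^ card I) * (\<Prod>i\<in>I. emeasure lborel ((*) u -` B i \<inter> space lborel))"
      using B I m by (simp add: emeasure_distr eq emeasure_PiM sets_PiM_I_finite)
    also have "\<dots> = ennreal (u ^ card I) * (ennreal (inverse u) ^ card I * (\<Prod>i\<in>I. emeasure lborel (B i)))"
      by (simp only: prod.cong[OF refl *] prod.distrib prod_constant)
    also have "ennreal (u ^ card I) * (ennreal (inverse u) ^ card I * (\<Prod>i\<in>I. emeasure lborel (B i)))
        = ennreal (u ^ card I * inverse u ^ card I) * (\<Prod>i\<in>I. emeasure lborel (B i))"
      using u by (simp add: ennreal_mult ennreal_power mult.assoc)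
    also have "u ^ card I * inverse u ^ card I = 1" using u by (simp add: power_mult_distrib[symmetric])
    finally show "emeasure (scale_measure (ennreal (u ^ card I)) (distr ?L ?L ?T)) (Pi\<^sub>E I B) = (\<Prod>i\<in>I. emeasure lborel (B i))"
      by (simp only: ennreal_1 mult_1_left)
  qed (use I in simp_all)
  then have "emeasure ?L A = emeasure (scale_measure (ennreal (u ^ card I)) (distr ?L ?L ?T)) A"
    by simp
  also have "\<dots> = ennreal (u ^ card I) * emeasure ?L (?T -` A \<inter> space ?L)"
    using A by (simp add: emeasure_distr)
  finally show ?thesis by (simp add: space_PiM_lborel)
qed

section \<open>The standard Gaussian measure and its comparison with the sphere\<close>

definition std_normal :: "real measure" where
  "std_normal = density lborel (\<lambda>x. ennreal (std_normal_density x))"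

definition gauss :: "'i set \<Rightarrow> ('i \<Rightarrow> real) measure" where
  "gauss I = (\<Pi>\<^sub>M i\<in>I. std_normal)"

lemma sets_std_normal [measurable_cong, simp]: "sets std_normal = sets borel"
  by (simp add: std_normal_def)

lemma space_std_normal [simp]: "space std_normal = UNIV"
  by (simp add: std_normal_def)

lemma prob_space_std_normal: "prob_space std_normal"
  unfolding std_normal_def by (rule prob_space_normal_density) simp

lemma prob_space_gauss: "prob_space (gauss I)"
  unfolding gauss_def by (intro prob_space_PiM prob_space_std_normal)

lemma sets_gauss [measurable_cong]: "sets (gauss I) = sets (\<Pi>\<^sub>M i\<in>I. borel)"
  unfolding gauss_def by (rule sets_PiM_cong) auto

lemma space_gauss: "space (gauss I) = extensional I"
  by (simp add: gauss_def space_PiM PiE_def)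

text \<open>Both measures agree on boxes, where the integral of the product density factors. The
  density form is the one suited to polar coordinates.\<close>

lemma gauss_eq_density:
  fixes I :: "'i set"
  assumes I: "finite I"
  shows "gauss I = density (\<Pi>\<^sub>M i\<in>I. lborel) (\<lambda>x. \<Prod>i\<in>I. ennreal (std_normal_density (x i)))"
proof -
  interpret L: product_sigma_finite "\<lambda>_::'i. (lborel :: real measure)"
    by standard
  interpret prob_space std_normal by (rule prob_space_std_normal)
  interpret N: product_sigma_finite "\<lambda>_::'i. std_normal"
    by standard
  have "density (\<Pi>\<^sub>M i\<in>I. lborel) (\<lambda>x. \<Prod>i\<in>I. ennreal (std_normal_density (x i))) = (\<Pi>\<^sub>M i\<in>I. std_normal)"
  proof (rule N.PiM_eqI)
    show "sets (density (\<Pi>\<^sub>M i\<in>I. lborel) (\<lambda>x. \<Prod>i\<in>I. ennreal (std_normal_density (x i)))) = sets (\<Pi>\<^sub>M i\<in>I. std_normal)"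
      by (simp, rule sets_PiM_cong) auto
    fix B :: "'i \<Rightarrow> real set" assume "\<And>i. i \<in> I \<Longrightarrow> B i \<in> sets std_normal"
    then have B: "\<And>i. i \<in> I \<Longrightarrow> B i \<in> sets borel" by simp
    have "emeasure (density (\<Pi>\<^sub>M i\<in>I. lborel) (\<lambda>x. \<Prod>i\<in>I. ennreal (std_normal_density (x i)))) (Pi\<^sub>E I B)
        = (\<integral>\<^sup>+x. (\<Prod>i\<in>I. ennreal (std_normal_density (x i))) * indicator (Pi\<^sub>E I B) x \<partial>(\<Pi>\<^sub>M i\<in>I. lborel))"
      using I B by (intro emeasure_density) (auto intro!: sets_PiM_I_finite)
    also have "\<dots> = (\<integral>\<^sup>+x. (\<Prod>i\<in>I. ennreal (std_normal_density (x i)) * indicator (B i) (x i)) \<partial>(\<Pi>\<^sub>M i\<in>I. lborel))"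
    proof (intro nn_integral_cong)
      fix x assume "x \<in> space (\<Pi>\<^sub>M i\<in>I. (lborel :: real measure))"
      then have "indicator (Pi\<^sub>E I B) x = (\<Prod>i\<in>I. indicator (B i) (x i) :: ennreal)"
        using I by (auto simp: indicator_def space_PiM PiE_iff split: if_splits)
      then show "(\<Prod>i\<in>I. ennreal (std_normal_density (x i))) * indicator (Pi\<^sub>E I B) x
          = (\<Prod>i\<in>I. ennreal (std_normal_density (x i)) * indicator (B i) (x i))"
        by (simp add: prod.distrib)
    qed
    also have "\<dots> = (\<Prod>i\<in>I. \<integral>\<^sup>+y. ennreal (std_normal_density y) * indicator (B i) y \<partial>lborel)"
      using I B by (intro L.product_nn_integral_prod) auto
    also have "\<dots> = (\<Prod>i\<in>I. emeasure std_normal (B i))"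
      using B by (intro prod.cong) (auto simp: std_normal_def emeasure_density)
    finally show "emeasure (density (\<Pi>\<^sub>M i\<in>I. lborel) (\<lambda>x. \<Prod>i\<in>I. ennreal (std_normal_density (x i)))) (Pi\<^sub>E I B)
      = (\<Prod>i\<in>I. emeasure std_normal (B i))" .
  qed (use I in auto)
  then show ?thesis by (simp add: gauss_def)
qed

text \<open>With \<open>v\<close> the norm of a point, this writes the radial factor of the Gaussian
  density as a superposition of indicators of balls of radius \<open>u\<close>.\<close>

lemma nn_integral_tail_gauss:
  assumes "0 \<le> v"
  shows "(\<integral>\<^sup>+u. ennreal (u * exp (- u\<^sup>2 / 2)) * indicator {v..} u \<partial>lborel) = ennreal (exp (- v\<^sup>2 / 2))"
proof -
  have lim: "((\<lambda>u::real. - exp (- u\<^sup>2 / 2)) \<longlongrightarrow> 0) at_top"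
    by real_asymp
  have "(\<integral>\<^sup>+u. ennreal (u * exp (- u\<^sup>2 / 2)) * indicator {v..} u \<partial>lborel) = ennreal (0 - (- exp (- v\<^sup>2 / 2)))"
    using assms by (intro nn_integral_FTC_atLeast lim) (auto intro!: derivative_eq_intros)
  then show ?thesis by simp
qed

text \<open>Polar coordinates in layer-cake form: integrating the Gaussian density over a cone picks up,
  from every radius, the same multiple of the Lebesgue measure of the truncated cone.\<close>

lemma gauss_cone:
  fixes I :: "'i set"
  assumes I: "finite I"
  obtains \<kappa> where "\<And>F. F \<in> sets (\<Pi>\<^sub>M i\<in>I. (lborel :: real measure)) \<Longrightarrow>
     (\<And>x r. x \<in> extensional I \<Longrightarrow> 0 < r \<Longrightarrow> (\<lambda>i\<in>I. r * x i) \<in> F \<longleftrightarrow> x \<in> F) \<Longrightarrow>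
     (\<And>x. x \<in> F \<Longrightarrow> 0 < L2_set x I) \<Longrightarrow>
     emeasure (gauss I) F = \<kappa> * emeasure (\<Pi>\<^sub>M i\<in>I. lborel) {x \<in> F. L2_set x I \<le> 1}"
proof -
  interpret L: product_sigma_finite "\<lambda>_::'i. (lborel :: real measure)"
    by standard
  let ?L = "\<Pi>\<^sub>M i\<in>I. (lborel :: real measure)"
  interpret sigma_finite_measure ?L using I by (rule L.sigma_finite)
  interpret P: pair_sigma_finite ?L "lborel :: real measure" by standard
  define N where "N = card I"
  define c where "c = (1 / sqrt (2 * pi)) ^ N"
  define w where "w u = ennreal (u * exp (- u\<^sup>2 / 2))" for u :: real
  define \<kappa> where "\<kappa> = ennreal c * (\<integral>\<^sup>+u. w u * indicator {0<..} u * ennreal (u ^ N) \<partial>lborel)"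
  have w[measurable]: "w \<in> borel_measurable borel" unfolding w_def by measurable
  have dens: "(\<Prod>i\<in>I. ennreal (std_normal_density (x i))) = ennreal c * ennreal (exp (- (L2_set x I)\<^sup>2 / 2))" for x
  proof -
    have "(\<Prod>i\<in>I. ennreal (std_normal_density (x i))) = ennreal (\<Prod>i\<in>I. std_normal_density (x i))"
      by (rule prod_ennreal) simp
    also have "(\<Prod>i\<in>I. std_normal_density (x i)) = c * exp (- (L2_set x I)\<^sup>2 / 2)"
      using I by (simp add: std_normal_density_def prod.distrib prod_constant c_def N_def exp_sum[symmetric] L2_set_def sum_nonneg
         sum_negf sum_divide_distrib prod_dividef power_divide)
    finally show ?thesis by (simp add: ennreal_mult c_def)
  qed
  have "emeasure (gauss I) F = \<kappa> * emeasure ?L {x \<in> F. L2_set x I \<le> 1}"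
    if F[measurable]: "F \<in> sets ?L"
      and cone: "\<And>x r. x \<in> extensional I \<Longrightarrow> 0 < r \<Longrightarrow> (\<lambda>i\<in>I. r * x i) \<in> F \<longleftrightarrow> x \<in> F"
      and nz: "\<And>x. x \<in> F \<Longrightarrow> 0 < L2_set x I" for F
  proof -
    define V where "V = emeasure ?L {x \<in> F. L2_set x I \<le> 1}"
    have Fsub: "F \<subseteq> extensional I" using sets.sets_into_space[OF F] by (simp add: space_PiM_lborel)
    have Fu: "emeasure ?L {x \<in> F. L2_set x I \<le> u} = ennreal (u ^ N) * V" if u: "0 < u" for u
    proof -
      have *: "{x \<in> F. L2_set x I \<le> u} = {x \<in> space ?L. x \<in> F \<and> L2_set x I \<le> u}"
        using sets.sets_into_space[OF F] by auto
      have m: "{x \<in> F. L2_set x I \<le> u} \<in> sets ?L" unfolding * by measurable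
      have "(\<lambda>x. \<lambda>i\<in>I. u * x i) -` {x \<in> F. L2_set x I \<le> u} \<inter> extensional I = {x \<in> F. L2_set x I \<le> 1}"
        using cone u Fsub by (auto simp: L2_set_scale)
      with emeasure_PiM_lborel_scale[OF I u m] show ?thesis by (simp add: V_def N_def)
    qed
    have "emeasure (gauss I) F = (\<integral>\<^sup>+x. ennreal c * ennreal (exp (- (L2_set x I)\<^sup>2 / 2)) * indicator F x \<partial>?L)"
      by (simp add: gauss_eq_density[OF I] emeasure_density dens)
    also have "\<dots> = (\<integral>\<^sup>+x. ennreal c * (\<integral>\<^sup>+u. w u * indicator {L2_set x I..} u * indicator F x \<partial>lborel) \<partial>?L)"
    proof (intro nn_integral_cong)
      fix x
      have "(\<integral>\<^sup>+u. w u * indicator {L2_set x I..} u * indicator F x \<partial>lborel)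
         = (\<integral>\<^sup>+u. w u * indicator {L2_set x I..} u \<partial>lborel) * indicator F x"
        by (intro nn_integral_multc) measurable
      also have "\<dots> = ennreal (exp (- (L2_set x I)\<^sup>2 / 2)) * indicator F x"
        unfolding w_def by (subst nn_integral_tail_gauss) (auto simp: L2_set_nonneg)
      finally show "ennreal c * ennreal (exp (- (L2_set x I)\<^sup>2 / 2)) * indicator F x
         = ennreal c * (\<integral>\<^sup>+u. w u * indicator {L2_set x I..} u * indicator F x \<partial>lborel)"
        by (simp add: mult.assoc)
    qed
    \<comment> \<open>The indicator with a moving endpoint becomes a comparison, so that
      measurability in \<open>x\<close> and \<open>u\<close> jointly, as the exchange of integrals
      requires, is visible.\<close>
    also have "\<dots> = (\<integral>\<^sup>+x. ennreal c * (\<integral>\<^sup>+u. w u * (if L2_set x I \<le> u then 1 else 0) * indicator F x \<partial>lborel) \<partial>?L)"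
      by (intro nn_integral_cong arg_cong2[where f="(*)"] refl) (auto simp: indicator_def)
    also have "\<dots> = ennreal c * (\<integral>\<^sup>+x. (\<integral>\<^sup>+u. w u * (if L2_set x I \<le> u then 1 else 0) * indicator F x \<partial>lborel) \<partial>?L)"
      by (intro nn_integral_cmult) measurable
    also have "(\<integral>\<^sup>+x. (\<integral>\<^sup>+u. w u * (if L2_set x I \<le> u then 1 else 0) * indicator F x \<partial>lborel) \<partial>?L)
        = (\<integral>\<^sup>+u. (\<integral>\<^sup>+x. w u * (if L2_set x I \<le> u then 1 else 0) * indicator F x \<partial>?L) \<partial>lborel)"
      by (rule P.Fubini'[symmetric]) measurable
    also have "\<dots> = (\<integral>\<^sup>+u. w u * indicator {0<..} u * ennreal (u ^ N) * V \<partial>lborel)"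
    proof (intro nn_integral_cong)
      fix u :: real
      show "(\<integral>\<^sup>+x. w u * (if L2_set x I \<le> u then 1 else 0) * indicator F x \<partial>?L) = w u * indicator {0<..} u * ennreal (u ^ N) * V"
      proof (cases "0 < u")
        case True
        have *: "{x \<in> F. L2_set x I \<le> u} = {x \<in> space ?L. x \<in> F \<and> L2_set x I \<le> u}"
          using sets.sets_into_space[OF F] by auto
        have m[measurable]: "{x \<in> F. L2_set x I \<le> u} \<in> sets ?L" unfolding * by measurable
        have "(\<integral>\<^sup>+x. w u * (if L2_set x I \<le> u then 1 else 0) * indicator F x \<partial>?L)
           = (\<integral>\<^sup>+x. w u * indicator {x \<in> F. L2_set x I \<le> u} x \<partial>?L)"
          by (intro nn_integral_cong) (auto simp: indicator_def)
        also have "\<dots> = w u * emeasure ?L {x \<in> F. L2_set x I \<le> u}"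
          by (rule nn_integral_cmult_indicator) (rule m)
        finally show ?thesis using True by (simp add: Fu mult.assoc)
      next
        \<comment> \<open>Points of \<open>F\<close> have positive norm, so levels u <= 0 contribute
          nothing and the scaling law \<open>Fu\<close> for u > 0 is enough.\<close>
        case False
        then have z: "w u * (if L2_set x I \<le> u then 1 else 0) * indicator F x = 0" for x
          using nz[of x] by (auto simp: indicator_def)
        show ?thesis unfolding z using False by simp
      qed
    qed
    also have "\<dots> = (\<integral>\<^sup>+u. w u * indicator {0<..} u * ennreal (u ^ N) \<partial>lborel) * V"
      by (intro nn_integral_multc) measurable
    finally show ?thesis by (simp add: \<kappa>_def V_def mult.assoc)
  qed
  then show thesis by (rule that)
qed

lemma emeasure_PiM_lborel_zero:
  fixes I :: "'i set"
  assumes "finite I" "I \<noteq> {}"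
  shows "emeasure (\<Pi>\<^sub>M i\<in>I. lborel) {\<lambda>i\<in>I. 0::real} = 0" "{\<lambda>i\<in>I. 0::real} \<in> sets (\<Pi>\<^sub>M i\<in>I. (lborel :: real measure))"
proof -
  interpret product_sigma_finite "\<lambda>_::'i. (lborel :: real measure)"
    by standard
  have eq: "{\<lambda>i\<in>I. 0::real} = (\<Pi>\<^sub>E i\<in>I. {0})"
    by (auto simp: PiE_iff extensional_def fun_eq_iff)
  show "emeasure (\<Pi>\<^sub>M i\<in>I. lborel) {\<lambda>i\<in>I. 0::real} = 0"
    unfolding eq using assms by (subst emeasure_PiM) (auto simp: card_gt_0_iff)
  show "{\<lambda>i\<in>I. 0::real} \<in> sets (\<Pi>\<^sub>M i\<in>I. (lborel :: real measure))"
    unfolding eq using assms by (intro sets_PiM_I_finite) auto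
qed

lemma L2_set_pos_iff:
  assumes "finite I" "x \<in> extensional I"
  shows "0 < L2_set x I \<longleftrightarrow> x \<noteq> (\<lambda>i\<in>I. 0)"
  using assms L2_set_nonneg[of x I] L2_set_eq_0_iff[of I x]
  by (auto simp: fun_eq_iff extensional_def less_le)

text \<open>Surface measure and Gaussian measure of the event are both fixed multiples, by
  \<open>card I\<close> and by \<kappa>, of the volume \<open>C P\<close> of its truncated cone.
  Normalising by the full space cancels the multiples, so \<kappa> is never evaluated.\<close>

lemma sphere_prob_eq_gauss:
  fixes I :: "'i set" and P :: "('i \<Rightarrow> real) \<Rightarrow> bool"
  assumes I: "finite I" "I \<noteq> {}"
    and P: "{x \<in> extensional I. P x} \<in> sets (\<Pi>\<^sub>M i\<in>I. (borel :: real measure))"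
    and scale: "\<And>x r. x \<in> extensional I \<Longrightarrow> 0 < r \<Longrightarrow> P (\<lambda>i\<in>I. r * x i) \<longleftrightarrow> P x"
  shows "measure (sphere_prob I) {x \<in> space (sphere_prob I). P x} = measure (gauss I) {x \<in> space (gauss I). P x}"
proof -
  let ?L = "\<Pi>\<^sub>M i\<in>I. (lborel :: real measure)" and ?z = "\<lambda>i\<in>I. 0::real"
  let ?S = "sphere_surface I" and ?U = "unit_sphere I"
  obtain \<kappa> where \<kappa>: "\<And>F. F \<in> sets ?L \<Longrightarrow>
     (\<And>x r. x \<in> extensional I \<Longrightarrow> 0 < r \<Longrightarrow> (\<lambda>i\<in>I. r * x i) \<in> F \<longleftrightarrow> x \<in> F) \<Longrightarrow>
     (\<And>x. x \<in> F \<Longrightarrow> 0 < L2_set x I) \<Longrightarrow>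
     emeasure (gauss I) F = \<kappa> * emeasure ?L {x \<in> F. L2_set x I \<le> 1}"
    using gauss_cone[OF I(1)] by blast
  define C where "C Q = emeasure ?L {x \<in> extensional I. Q x \<and> 0 < L2_set x I \<and> L2_set x I \<le> 1}" for Q :: "('i \<Rightarrow> real) \<Rightarrow> bool"
  have *: "emeasure (gauss I) {x \<in> space (gauss I). Q x} = \<kappa> * C Q \<and> emeasure ?S {x \<in> ?U. Q x} = of_nat (card I) * C Q \<and> {x \<in> ?U. Q x} \<in> sets ?S"
    if Q: "{x \<in> extensional I. Q x} \<in> sets (\<Pi>\<^sub>M i\<in>I. (borel :: real measure))"
    and sc: "\<And>x r. x \<in> extensional I \<Longrightarrow> 0 < r \<Longrightarrow> Q (\<lambda>i\<in>I. r * x i) \<longleftrightarrow> Q x" for Q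
  proof -
    \<comment> \<open>A scale-invariant event may contain the origin, which lies on no ray; it is
      removed here and shown below to be a null set.\<close>
    define F where "F = {x \<in> extensional I. Q x} - {?z}"
    have Fm: "F \<in> sets ?L" using Q emeasure_PiM_lborel_zero(2)[OF I] by (simp add: F_def sets_PiM_lborel)
    have F: "F = {x \<in> extensional I. Q x \<and> 0 < L2_set x I}"
      using L2_set_pos_iff[OF I(1)] by (auto simp: F_def)
    have "emeasure (gauss I) F = \<kappa> * emeasure ?L {x \<in> F. L2_set x I \<le> 1}"
      using Fm by (rule \<kappa>) (auto simp: F sc L2_set_scale zero_less_mult_iff)
    also have "{x \<in> F. L2_set x I \<le> 1} = {x \<in> extensional I. Q x \<and> 0 < L2_set x I \<and> L2_set x I \<le> 1}"
      by (auto simp: F)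
    finally have 1: "emeasure (gauss I) F = \<kappa> * C Q" by (simp add: C_def)
    have "emeasure (gauss I) {?z} = 0"
    proof -
      have "{?z} \<in> null_sets ?L" using emeasure_PiM_lborel_zero[OF I] by auto
      moreover from AE_not_in[OF this]
      have "AE x\<in>{?z} in ?L. (\<Prod>i\<in>I. ennreal (std_normal_density (x i))) = 0"
        by (rule eventually_mono) auto
      ultimately have "{?z} \<in> null_sets (gauss I)"
        unfolding gauss_eq_density[OF I(1)] by (subst null_sets_density_iff) auto
      then show ?thesis by auto
    qed
    then have "{?z} \<in> null_sets (gauss I)"
      using emeasure_PiM_lborel_zero(2)[OF I] by (auto simp: sets_gauss sets_PiM_lborel null_sets_def)
    then have 2: "emeasure (gauss I) F = emeasure (gauss I) {x \<in> space (gauss I). Q x}"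
      unfolding F_def space_gauss by (rule emeasure_Diff_null_set) (use Q in \<open>simp add: sets_gauss\<close>)
    have sets: "{x \<in> ?U. Q x} \<in> sets ?S"
    proof -
      have "{x \<in> ?U. Q x} = ?U \<inter> {x \<in> extensional I. Q x}" by (auto simp: unit_sphere_def)
      then show ?thesis using Q by (auto simp: sets_sphere_surface sets_restrict_space)
    qed
    have QQ: "Q (\<lambda>i\<in>I. x i / L2_set x I) \<longleftrightarrow> Q x" if "x \<in> extensional I" "0 < L2_set x I" for x
      using sc[of x "1 / L2_set x I"] that by (simp add: divide_inverse mult.commute)
    have UU: "(\<lambda>i\<in>I. x i / L2_set x I) \<in> ?U" if "0 < L2_set x I" for x
      using that L2_set_scale[where r = "1 / L2_set x I" and I = I and a = x]
      by (simp add: unit_sphere_def lp_norm_2 field_simps)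
    have "{x \<in> extensional I. 0 < L2_set x I \<and> L2_set x I \<le> 1 \<and> (\<lambda>i\<in>I. x i / L2_set x I) \<in> {x \<in> ?U. Q x}}
        = {x \<in> extensional I. Q x \<and> 0 < L2_set x I \<and> L2_set x I \<le> 1}"
      using QQ UU by auto
    then have "emeasure ?S {x \<in> ?U. Q x} = of_nat (card I) * C Q"
      unfolding C_def by (subst emeasure_sphere_surface[OF sets], subst radial_preimage[symmetric]) auto
    with 1 2 sets show ?thesis by simp
  qed
  have "extensional I \<in> sets (\<Pi>\<^sub>M i\<in>I. (borel :: real measure))"
    using sets.top[of "\<Pi>\<^sub>M i\<in>I. (borel :: real measure)"] by (simp add: space_PiM PiE_def)
  then have "emeasure (gauss I) (space (gauss I)) = \<kappa> * C (\<lambda>_. True) \<and> emeasure ?S ?U = of_nat (card I) * C (\<lambda>_. True)"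
    using *[of "\<lambda>_. True"] by simp
  then have tot: "\<kappa> * C (\<lambda>_. True) = 1" "emeasure ?S ?U = of_nat (card I) * C (\<lambda>_. True)"
    using prob_space.emeasure_space_1[OF prob_space_gauss, of I] by auto
  note pos = emeasure_sphere_surface_total[OF I]
  have space: "space (sphere_prob I) = ?U" by (simp add: sphere_prob_def space_sphere_surface)
  have "emeasure (sphere_prob I) {x \<in> ?U. P x} = emeasure ?S {x \<in> ?U. P x} / emeasure ?S ?U"
  proof -
    have "?U \<inter> {x \<in> ?U. P x} = {x \<in> ?U. P x}" by auto
    then show ?thesis
      unfolding sphere_prob_def using *[OF P scale]
      by (simp add: emeasure_uniform_measure unit_sphere_sets)
  qed
  also have "\<dots> = (of_nat (card I) * C P) / (of_nat (card I) * C (\<lambda>_. True))"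
    using *[OF P scale] tot by simp
  \<comment> \<open>The inserted factor \<open>\<kappa> * C (\<lambda>_. True)\<close> is 1. It lets
    the quotient cancel in \<open>ennreal\<close>, where the denominator is the total surface, known
    to be positive and finite.\<close>
  also have "of_nat (card I) * C P = (\<kappa> * C (\<lambda>_. True)) * (of_nat (card I) * C P)"
    by (simp add: tot)
  also have "\<dots> = (\<kappa> * C P) * (of_nat (card I) * C (\<lambda>_. True))"
    by (simp only: mult_ac)
  also have "\<dots> / (of_nat (card I) * C (\<lambda>_. True)) = \<kappa> * C P"
    by (intro mult_divide_eq_ennreal; use pos in \<open>unfold tot(2), metis less_irrefl infinity_ennreal_def\<close>)
  also have "\<dots> = emeasure (gauss I) {x \<in> space (gauss I). P x}"
    using *[OF P scale] by simp
  finally show ?thesis by (simp add: measure_def space)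
qed

section \<open>Exponential moments, tails and small balls of Gaussian sums and norms\<close>

lemma measurable_gauss_sum [measurable]:
  "(\<lambda>x. \<Sum>i\<in>I. f i * x i) \<in> borel_measurable (gauss I)" for f :: "'i \<Rightarrow> real"
  by measurable

lemma nn_integral_std_normal_exp:
  "(\<integral>\<^sup>+y. ennreal (exp (c * y)) \<partial>std_normal) = ennreal (exp (c\<^sup>2 / 2))"
proof -
  have "(\<integral>\<^sup>+y. ennreal (exp (c * y)) \<partial>std_normal)
      = (\<integral>\<^sup>+y. ennreal (std_normal_density y) * ennreal (exp (c * y)) \<partial>lborel)"
    unfolding std_normal_def by (rule nn_integral_density) auto
  \<comment> \<open>Completing the square: the tilted density is a constant times the normal density
    with mean \<open>c\<close>.\<close>
  also have "\<dots> = (\<integral>\<^sup>+y. ennreal (exp (c\<^sup>2 / 2)) * ennreal (normal_density c 1 y) \<partial>lborel)"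
    by (intro nn_integral_cong, simp add: ennreal_mult[symmetric] normal_density_def exp_add[symmetric])
       (simp add: field_simps power2_eq_square)
  also have "\<dots> = ennreal (exp (c\<^sup>2 / 2)) * (\<integral>\<^sup>+y. ennreal (normal_density c 1 y) \<partial>lborel)"
    by (rule nn_integral_cmult) auto
  also have "(\<integral>\<^sup>+y. ennreal (normal_density c 1 y) \<partial>lborel) = 1"
    by (subst nn_integral_eq_integral) auto
  finally show ?thesis by simp
qed

lemma gauss_exp:
  fixes I :: "'i set"
  assumes I: "finite I"
  shows "has_bochner_integral (gauss I) (\<lambda>x. exp (\<Sum>i\<in>I. c i * x i)) (exp ((\<Sum>i\<in>I. (c i)\<^sup>2) / 2))"
proof (rule has_bochner_integral_nn_integral)
  interpret prob_space std_normal by (rule prob_space_std_normal)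
  interpret N: product_sigma_finite "\<lambda>_::'i. std_normal"
    by standard
  have "(\<integral>\<^sup>+x. ennreal (exp (\<Sum>i\<in>I. c i * x i)) \<partial>gauss I) = (\<integral>\<^sup>+x. (\<Prod>i\<in>I. ennreal (exp (c i * x i))) \<partial>gauss I)"
    using I by (intro nn_integral_cong) (simp add: exp_sum prod_ennreal)
  also have "\<dots> = (\<Prod>i\<in>I. \<integral>\<^sup>+y. ennreal (exp (c i * y)) \<partial>std_normal)"
    unfolding gauss_def using I
    by (intro N.product_nn_integral_prod[where f = "\<lambda>i y. ennreal (exp (c i * y))"]) measurable
  also have "\<dots> = ennreal (exp ((\<Sum>i\<in>I. (c i)\<^sup>2) / 2))"
    using I by (simp add: nn_integral_std_normal_exp prod_ennreal exp_sum sum_divide_distrib)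
  finally show "(\<integral>\<^sup>+x. ennreal (exp (\<Sum>i\<in>I. c i * x i)) \<partial>gauss I) = ennreal (exp ((\<Sum>i\<in>I. (c i)\<^sup>2) / 2))" .
qed auto

text \<open>Chernoff's bound; the sign \<open>s\<close> lets one argument serve both tails in
  \<open>gauss_sum_tail\<close>. The optimal tilt is c = s t / sqrt N, for which N c^2 =
  t^2.\<close>

lemma gauss_upper_tail:
  fixes I :: "'i set"
  assumes I: "finite I" "I \<noteq> {}" and t: "0 \<le> t" and s: "\<bar>s\<bar> = 1"
  shows "measure (gauss I) {x \<in> space (gauss I). t * sqrt (card I) \<le> s * (\<Sum>i\<in>I. x i)} \<le> exp (- t\<^sup>2 / 2)"
proof -
  interpret prob_space "gauss I" by (rule prob_space_gauss)
  define N where "N = real (card I)"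
  have N: "0 < N" using I by (simp add: N_def card_gt_0_iff)
  define c where "c = s * t / sqrt N"
  have s2: "s * s = 1" using s by (metis abs_mult_self_eq mult_1)
  have c2: "N * c\<^sup>2 = t\<^sup>2"
    using N s2 by (simp add: c_def power2_eq_square power_divide field_simps)
  have "measure (gauss I) {x \<in> space (gauss I). exp (t\<^sup>2) \<le> exp (\<Sum>i\<in>I. c * x i)}
     \<le> (\<integral>x. exp (\<Sum>i\<in>I. c * x i) \<partial>gauss I) / exp (t\<^sup>2)"
    using gauss_exp[OF I(1), of "\<lambda>_. c"]
    by (intro integral_Markov_inequality_measure[where A="{}"]) (auto simp: has_bochner_integral_iff)
  also have "(\<integral>x. exp (\<Sum>i\<in>I. c * x i) \<partial>gauss I) = exp (t\<^sup>2 / 2)"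
    using has_bochner_integral_integral_eq[OF gauss_exp[OF I(1), of "\<lambda>_. c"]] c2 by (simp add: N_def)
  also have "exp (t\<^sup>2 / 2) / exp (t\<^sup>2) = exp (- t\<^sup>2 / 2)" by (simp add: exp_diff[symmetric])
  finally have 1: "measure (gauss I) {x \<in> space (gauss I). exp (t\<^sup>2) \<le> exp (\<Sum>i\<in>I. c * x i)} \<le> exp (- t\<^sup>2 / 2)" .
  have "measure (gauss I) {x \<in> space (gauss I). t * sqrt (card I) \<le> s * (\<Sum>i\<in>I. x i)}
     \<le> measure (gauss I) {x \<in> space (gauss I). exp (t\<^sup>2) \<le> exp (\<Sum>i\<in>I. c * x i)}"
  proof (intro finite_measure_mono subsetI)
    fix x assume "x \<in> {x \<in> space (gauss I). t * sqrt (card I) \<le> s * (\<Sum>i\<in>I. x i)}"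
    then have x: "x \<in> space (gauss I)" "t * sqrt N \<le> s * (\<Sum>i\<in>I. x i)" by (auto simp: N_def)
    have "(t / sqrt N) * (t * sqrt N) \<le> (t / sqrt N) * (s * (\<Sum>i\<in>I. x i))"
      using x(2) t N by (intro mult_left_mono) auto
    also have "(t / sqrt N) * (t * sqrt N) = t\<^sup>2" using N by (simp add: power2_eq_square)
    also have "(t / sqrt N) * (s * (\<Sum>i\<in>I. x i)) = (\<Sum>i\<in>I. c * x i)" by (simp add: c_def sum_distrib_left mult_ac)
    finally show "x \<in> {x \<in> space (gauss I). exp (t\<^sup>2) \<le> exp (\<Sum>i\<in>I. c * x i)}" using x by simp
  qed measurable
  with 1 show ?thesis by simp
qed

lemma gauss_sum_tail:
  assumes I: "finite I" "I \<noteq> {}" and t: "0 \<le> t"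
  shows "measure (gauss I) {x \<in> space (gauss I). t * sqrt (card I) < \<bar>\<Sum>i\<in>I. x i\<bar>} \<le> 2 * exp (- t\<^sup>2 / 2)"
proof -
  interpret prob_space "gauss I" by (rule prob_space_gauss)
  let ?A = "\<lambda>s. {x \<in> space (gauss I). t * sqrt (card I) \<le> s * (\<Sum>i\<in>I. x i)}"
  have "measure (gauss I) {x \<in> space (gauss I). t * sqrt (card I) < \<bar>\<Sum>i\<in>I. x i\<bar>} \<le> measure (gauss I) (?A 1 \<union> ?A (-1))"
    by (intro finite_measure_mono) auto
  also have "\<dots> \<le> measure (gauss I) (?A 1) + measure (gauss I) (?A (-1))"
    by (intro measure_Un_le) auto
  also have "\<dots> \<le> exp (- t\<^sup>2 / 2) + exp (- t\<^sup>2 / 2)"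
    by (intro add_mono gauss_upper_tail I t) auto
  finally show ?thesis by simp
qed

text \<open>The density is at most 1 / (2 \<sigma>), because pi >= 2, and the interval has length 2
  d \<sigma>.\<close>

lemma normal_small_ball:
  assumes d: "0 \<le> d" and \<sigma>: "0 < \<sigma>"
  shows "emeasure (density lborel (\<lambda>x. ennreal (normal_density 0 \<sigma> x))) {x. \<bar>x\<bar> < d * \<sigma>} \<le> ennreal d"
proof -
  have "emeasure (density lborel (\<lambda>x. ennreal (normal_density 0 \<sigma> x))) {x. \<bar>x\<bar> < d * \<sigma>}
     = (\<integral>\<^sup>+x. ennreal (normal_density 0 \<sigma> x) * indicator {x. \<bar>x\<bar> < d * \<sigma>} x \<partial>lborel)"
    by (rule emeasure_density) auto
  also have "\<dots> \<le> (\<integral>\<^sup>+x. ennreal (1 / (2 * \<sigma>)) * indicator {x. \<bar>x\<bar> < d * \<sigma>} x \<partial>lborel)"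
  proof (intro nn_integral_mono mult_right_mono ennreal_leI)
    fix x
    have "2 * \<sigma> \<le> sqrt (2 * pi * \<sigma>\<^sup>2)"
    proof (rule real_le_rsqrt)
      have "4 * \<sigma>\<^sup>2 \<le> (2 * pi) * \<sigma>\<^sup>2" using pi_ge_two by (intro mult_right_mono) auto
      then show "(2 * \<sigma>)\<^sup>2 \<le> 2 * pi * \<sigma>\<^sup>2" by (simp add: power_mult_distrib)
    qed
    then have "1 / sqrt (2 * pi * \<sigma>\<^sup>2) \<le> 1 / (2 * \<sigma>)"
      using \<sigma> by (intro divide_left_mono) (auto intro!: mult_pos_pos)
    then have "1 / sqrt (2 * pi * \<sigma>\<^sup>2) * exp (- (x - 0)\<^sup>2 / (2 * \<sigma>\<^sup>2)) \<le> 1 / (2 * \<sigma>) * 1"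
      using \<sigma> by (intro mult_mono) auto
    then show "normal_density 0 \<sigma> x \<le> 1 / (2 * \<sigma>)" by (simp add: normal_density_def)
  qed auto
  also have "\<dots> = ennreal (1 / (2 * \<sigma>)) * emeasure lborel {x. \<bar>x\<bar> < d * \<sigma>}"
    by (rule nn_integral_cmult_indicator) auto
  also have "emeasure lborel {x. \<bar>x\<bar> < d * \<sigma>} = ennreal (2 * d * \<sigma>)"
  proof -
    have "{x. \<bar>x\<bar> < d * \<sigma>} = {- (d * \<sigma>)<..<d * \<sigma>}" by auto
    then show ?thesis using d \<sigma> by simp
  qed
  also have "ennreal (1 / (2 * \<sigma>)) * ennreal (2 * d * \<sigma>) = ennreal d"
    using d \<sigma> by (simp add: ennreal_mult[symmetric])
  finally show ?thesis .
qed

lemma distr_gauss_component: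
  assumes "i \<in> I"
  shows "distr (gauss I) borel (\<lambda>x. x i) = std_normal"
proof -
  have "distr (gauss I) borel (\<lambda>x. x i) = distr (gauss I) std_normal (\<lambda>x. x i)"
    by (rule distr_cong) auto
  also have "\<dots> = std_normal"
    unfolding gauss_def by (rule distr_PiM_component) (auto simp: assms prob_space_std_normal)
  finally show ?thesis .
qed

lemma gauss_component_small:
  assumes i: "i \<in> I" and d: "0 \<le> d"
  shows "measure (gauss I) {x \<in> space (gauss I). \<bar>x i\<bar> < d} \<le> d"
proof -
  have "(\<lambda>x. x i) -` {y. \<bar>y\<bar> < d} \<inter> space (gauss I) = {x \<in> space (gauss I). \<bar>x i\<bar> < d}" by auto
  then have "measure (gauss I) {x \<in> space (gauss I). \<bar>x i\<bar> < d} = measure (distr (gauss I) borel (\<lambda>x. x i)) {y. \<bar>y\<bar> < d}"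
    using i by (subst measure_distr) auto
  also have "\<dots> = measure std_normal {y. \<bar>y\<bar> < d}"
    by (simp only: distr_gauss_component[OF i])
  also have "\<dots> \<le> d"
    using normal_small_ball[OF d, of 1] d unfolding measure_def std_normal_def
    by (intro enn2real_leI) auto
  finally show ?thesis .
qed

text \<open>The joint law of the coordinates under \<open>gauss I\<close>, its image under the
  identity, is the product of the marginals. Hence they are independent, and a sum of independent
  normals is normal.\<close>

lemma gauss_sum_distributed:
  fixes I :: "'i set"
  assumes I: "finite I" "I \<noteq> {}"
  shows "distributed (gauss I) lborel (\<lambda>x. \<Sum>i\<in>I. x i) (\<lambda>x. ennreal (normal_density 0 (sqrt (card I)) x))"
proof -
  interpret prob_space "gauss I" by (rule prob_space_gauss)
  have id: "distr (gauss I) (\<Pi>\<^sub>M i\<in>I. borel) (\<lambda>x. \<lambda>i\<in>I. x i) = gauss I"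
  proof -
    have "distr (gauss I) (\<Pi>\<^sub>M i\<in>I. borel) (\<lambda>x. \<lambda>i\<in>I. x i) = distr (gauss I) (gauss I) (\<lambda>x. x)"
      by (rule distr_cong) (auto simp: sets_gauss space_gauss extensional_restrict)
    then show ?thesis by (simp add: distr_id)
  qed
  have "indep_vars (\<lambda>_. borel) (\<lambda>i x. x i) I"
  proof (subst indep_vars_iff_distr_eq_PiM')
    show "distr (gauss I) (\<Pi>\<^sub>M i\<in>I. borel) (\<lambda>x. \<lambda>i\<in>I. x i) = (\<Pi>\<^sub>M i\<in>I. distr (gauss I) borel (\<lambda>x. x i))"
      unfolding id by (subst gauss_def, rule PiM_cong) (auto simp: distr_gauss_component)
  qed (use I in auto)
  then have "distributed (gauss I) lborel (\<lambda>x. \<Sum>i\<in>I. x i) (\<lambda>x. ennreal (normal_density (\<Sum>i\<in>I. 0) (sqrt (\<Sum>i\<in>I. 1\<^sup>2)) x))"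
  proof (intro sum_indep_normal I)
    fix i assume i: "i \<in> I"
    have "distr (gauss I) lborel (\<lambda>x. x i) = distr (gauss I) borel (\<lambda>x. x i)" by (rule distr_cong) auto
    then show "distributed (gauss I) lborel (\<lambda>x. x i) (\<lambda>x. ennreal (std_normal_density x))"
      using i by (auto simp: distributed_def distr_gauss_component std_normal_def)
  qed auto
  then show ?thesis by simp
qed

lemma gauss_sum_small:
  assumes I: "finite I" "I \<noteq> {}" and d: "0 \<le> d"
  shows "measure (gauss I) {x \<in> space (gauss I). \<bar>\<Sum>i\<in>I. x i\<bar> < d * sqrt (card I)} \<le> d"
proof -
  note D = gauss_sum_distributed[OF I]
  let ?B = "{y. \<bar>y\<bar> < d * sqrt (card I)}"
  have "{x \<in> space (gauss I). \<bar>\<Sum>i\<in>I. x i\<bar> < d * sqrt (card I)} = (\<lambda>x. \<Sum>i\<in>I. x i) -` ?B \<inter> space (gauss I)" by auto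
  then have "emeasure (gauss I) {x \<in> space (gauss I). \<bar>\<Sum>i\<in>I. x i\<bar> < d * sqrt (card I)}
     = emeasure (distr (gauss I) lborel (\<lambda>x. \<Sum>i\<in>I. x i)) ?B"
    using D by (subst emeasure_distr) (auto simp: distributed_def)
  also have "\<dots> \<le> ennreal d"
    using D d I by (auto simp: distributed_def card_gt_0_iff intro!: normal_small_ball)
  finally show ?thesis
    unfolding measure_def using d by (intro enn2real_leI) auto
qed

text \<open>Markov's inequality, each coordinate having second moment one.\<close>

lemma gauss_norm_upper:
  fixes K :: real
  assumes I: "finite I" "I \<noteq> {}" and K: "0 < K"
  shows "measure (gauss I) {x \<in> space (gauss I). K * card I \<le> (\<Sum>i\<in>I. (x i)\<^sup>2)} \<le> 1 / K"
proof -
  have 1: "has_bochner_integral std_normal (\<lambda>y. y\<^sup>2) 1"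
  proof -
    have "has_bochner_integral lborel (\<lambda>x. std_normal_density x * x ^ (2 * 1)) (fact (2 * 1) / (2 ^ 1 * fact 1))"
      by (rule std_normal_moment_even)
    then show ?thesis
      unfolding std_normal_def by (intro has_bochner_integral_density) (auto simp: fact_2)
  qed
  have "has_bochner_integral (gauss I) (\<lambda>x. (x i)\<^sup>2) 1" if "i \<in> I" for i
  proof -
    have "has_bochner_integral (distr (gauss I) borel (\<lambda>x. x i)) (\<lambda>y. y\<^sup>2) 1"
      using 1 by (simp only: distr_gauss_component[OF that])
    then show ?thesis using that
      by (auto simp: has_bochner_integral_iff integrable_distr_eq integral_distr)
  qed
  then have 2: "has_bochner_integral (gauss I) (\<lambda>x. \<Sum>i\<in>I. (x i)\<^sup>2) (\<Sum>i\<in>I. 1)"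
    by (intro has_bochner_integral_sum)
  have "measure (gauss I) {x \<in> space (gauss I). K * card I \<le> (\<Sum>i\<in>I. (x i)\<^sup>2)}
     \<le> (\<integral>x. (\<Sum>i\<in>I. (x i)\<^sup>2) \<partial>gauss I) / (K * card I)"
    using 2 I K by (intro integral_Markov_inequality_measure[where A="{}"])
       (auto simp: has_bochner_integral_iff sum_nonneg card_gt_0_iff)
  also have "(\<integral>x. (\<Sum>i\<in>I. (x i)\<^sup>2) \<partial>gauss I) = card I"
    using has_bochner_integral_integral_eq[OF 2] by simp
  finally show ?thesis using I K by (simp add: card_gt_0_iff)
qed

text \<open>If the squared norm is below half of \<open>d\<^sup>2 * card I\<close>, at least half of the coordinates are
  smaller than \<open>d\<close> in modulus.\<close>

lemma gauss_norm_lower: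
  fixes d :: real
  assumes I: "finite I" "I \<noteq> {}" and d: "0 < d"
  shows "measure (gauss I) {x \<in> space (gauss I). (\<Sum>i\<in>I. (x i)\<^sup>2) < d\<^sup>2 * card I / 2} \<le> 2 * d"
proof -
  interpret prob_space "gauss I" by (rule prob_space_gauss)
  define N where "N = real (card I)"
  have N: "0 < N" using I by (simp add: N_def card_gt_0_iff)
  define W where "W x = (\<Sum>i\<in>I. indicat_real {x \<in> space (gauss I). \<bar>x i\<bar> < d} x)" for x
  have Wnn: "0 \<le> W x" for x by (simp add: W_def sum_nonneg)
  have int: "integrable (gauss I) W"
    unfolding W_def by (auto intro!: integrable_indicator_iff[THEN iffD2] simp: emeasure_eq_measure)
  have "(\<integral>x. W x \<partial>gauss I) = (\<Sum>i\<in>I. measure (gauss I) {x \<in> space (gauss I). \<bar>x i\<bar> < d})"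
    unfolding W_def by (subst Bochner_Integration.integral_sum) (auto simp: emeasure_eq_measure Int_absorb1)
  also have "\<dots> \<le> (\<Sum>i\<in>I. d)" using d by (intro sum_mono gauss_component_small) auto
  finally have W: "(\<integral>x. W x \<partial>gauss I) \<le> N * d" by (simp add: N_def)
  have "measure (gauss I) {x \<in> space (gauss I). (\<Sum>i\<in>I. (x i)\<^sup>2) < d\<^sup>2 * card I / 2}
     \<le> measure (gauss I) {x \<in> space (gauss I). N / 2 \<le> W x}"
  proof (intro finite_measure_mono subsetI)
    fix x assume "x \<in> {x \<in> space (gauss I). (\<Sum>i\<in>I. (x i)\<^sup>2) < d\<^sup>2 * card I / 2}"
    then have x: "x \<in> space (gauss I)" "(\<Sum>i\<in>I. (x i)\<^sup>2) < d\<^sup>2 * N / 2" by (auto simp: N_def)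
    have "d\<^sup>2 * (N - W x) = (\<Sum>i\<in>I. d\<^sup>2 * (1 - indicat_real {x \<in> space (gauss I). \<bar>x i\<bar> < d} x))"
      by (simp add: N_def W_def sum_subtractf sum_distrib_left[symmetric])
    also have "\<dots> \<le> (\<Sum>i\<in>I. (x i)\<^sup>2)"
      using x(1) d by (intro sum_mono) (auto simp: indicator_def abs_le_square_iff[symmetric])
    also have "\<dots> < d\<^sup>2 * (N / 2)" using x by simp
    finally have "N - W x < N / 2" using d by simp
    then show "x \<in> {x \<in> space (gauss I). N / 2 \<le> W x}" using x by simp
  next
    show "{x \<in> space (gauss I). N / 2 \<le> W x} \<in> events"
      using borel_measurable_integrable[OF int] by measurable
  qed
  also have "\<dots> \<le> (\<integral>x. W x \<partial>gauss I) / (N / 2)"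
    using N int Wnn by (intro integral_Markov_inequality_measure[where A="{}"]) auto
  also have "\<dots> \<le> N * d / (N / 2)" using W N by (intro divide_right_mono) auto
  also have "\<dots> = 2 * d" using N by simp
  finally show ?thesis .
qed

section \<open>Invariance of the Gaussian measure under sign changes\<close>

lemma std_normal_reflect:
  assumes s: "\<bar>s\<bar> = 1" and B: "B \<in> sets borel"
  shows "emeasure std_normal ((*) s -` B) = emeasure std_normal B"
proof -
  have m: "(*) s -` B \<in> sets borel" using B by (rule measurable_sets_borel[rotated]) measurable
  have "emeasure std_normal B = (\<integral>\<^sup>+x. ennreal (std_normal_density x) * indicator B x \<partial>lborel)"
    using B unfolding std_normal_def by (intro emeasure_density) auto
  also have "\<dots> = ennreal \<bar>s\<bar> * (\<integral>\<^sup>+x. ennreal (std_normal_density (0 + s * x)) * indicator B (0 + s * x) \<partial>lborel)"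
    using s B by (intro nn_integral_real_affine) auto
  also have "\<dots> = (\<integral>\<^sup>+x. ennreal (std_normal_density x) * indicator ((*) s -` B) x \<partial>lborel)"
  proof -
    have "s\<^sup>2 = 1" using s by (metis power2_abs power_one)
    then show ?thesis using s
      by (auto intro!: nn_integral_cong simp: std_normal_density_def power_mult_distrib indicator_def)
  qed
  also have "\<dots> = emeasure std_normal ((*) s -` B)"
    using m unfolding std_normal_def by (intro emeasure_density[symmetric]) auto
  finally show ?thesis by simp
qed

lemma distr_gauss_flip:
  fixes I :: "'i set"
  assumes I: "finite I" and s: "\<And>i. i \<in> I \<Longrightarrow> \<bar>s i\<bar> = 1"
  shows "distr (gauss I) (gauss I) (\<lambda>x. \<lambda>i\<in>I. s i * x i) = gauss I"
proof -
  interpret prob_space std_normal by (rule prob_space_std_normal)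
  interpret N: product_sigma_finite "\<lambda>_::'i. std_normal"
    by standard
  let ?T = "\<lambda>x. \<lambda>i\<in>I. s i * x i"
  have T: "?T \<in> (\<Pi>\<^sub>M i\<in>I. std_normal) \<rightarrow>\<^sub>M (\<Pi>\<^sub>M i\<in>I. std_normal)"
    by measurable
  have "distr (\<Pi>\<^sub>M i\<in>I. std_normal) (\<Pi>\<^sub>M i\<in>I. std_normal) ?T = (\<Pi>\<^sub>M i\<in>I. std_normal)"
  proof (rule N.PiM_eqI)
    fix B :: "'i \<Rightarrow> real set" assume "\<And>i. i \<in> I \<Longrightarrow> B i \<in> sets std_normal"
    then have B: "\<And>i. i \<in> I \<Longrightarrow> B i \<in> sets borel" by simp
    have eq: "?T -` Pi\<^sub>E I B \<inter> space (\<Pi>\<^sub>M i\<in>I. std_normal) = (\<Pi>\<^sub>E i\<in>I. (*) (s i) -` B i)"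
      by (auto simp: space_PiM PiE_iff)
    have "emeasure (distr (\<Pi>\<^sub>M i\<in>I. std_normal) (\<Pi>\<^sub>M i\<in>I. std_normal) ?T) (Pi\<^sub>E I B)
        = emeasure (\<Pi>\<^sub>M i\<in>I. std_normal) (\<Pi>\<^sub>E i\<in>I. (*) (s i) -` B i)"
      using T B I by (subst emeasure_distr) (auto simp: eq intro!: sets_PiM_I_finite)
    also have "\<dots> = (\<Prod>i\<in>I. emeasure std_normal ((*) (s i) -` B i))"
      using B I by (intro N.emeasure_PiM) (auto intro!: measurable_sets_borel[of "(*) c" borel for c :: real])
    also have "\<dots> = (\<Prod>i\<in>I. emeasure std_normal (B i))"
      using B s by (intro prod.cong refl std_normal_reflect)
    finally show "emeasure (distr (\<Pi>\<^sub>M i\<in>I. std_normal) (\<Pi>\<^sub>M i\<in>I. std_normal) ?T) (Pi\<^sub>E I B) = (\<Prod>i\<in>I. emeasure std_normal (B i))" .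
  qed (use I in auto)
  then show ?thesis by (simp add: gauss_def)
qed

lemma flip_measurable: "(\<lambda>x. \<lambda>i\<in>I. s i * x i) \<in> gauss I \<rightarrow>\<^sub>M gauss I"
  unfolding gauss_def by measurable

lemma measure_gauss_flip:
  assumes I: "finite I" and s: "\<And>i. i \<in> I \<Longrightarrow> \<bar>s i\<bar> = 1"
    and P: "{x \<in> space (gauss I). P x} \<in> sets (gauss I)"
  shows "{x \<in> space (gauss I). P (\<lambda>i\<in>I. s i * x i)} \<in> sets (gauss I)" (is ?th1)
   and "measure (gauss I) {x \<in> space (gauss I). P (\<lambda>i\<in>I. s i * x i)} = measure (gauss I) {x \<in> space (gauss I). P x}" (is ?th2)
proof -
  let ?T = "\<lambda>x. \<lambda>i\<in>I. s i * x i"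
  have eq: "?T -` {x \<in> space (gauss I). P x} \<inter> space (gauss I) = {x \<in> space (gauss I). P (?T x)}"
    by (auto simp: space_gauss)
  show ?th1 using measurable_sets[OF flip_measurable P, of s] unfolding eq .
  have "measure (distr (gauss I) (gauss I) ?T) {x \<in> space (gauss I). P x} = measure (gauss I) {x \<in> space (gauss I). P (?T x)}"
    using P by (subst measure_distr[OF flip_measurable]) (simp_all only: eq)
  then show ?th2 by (simp add: distr_gauss_flip[OF I s])
qed

subsection \<open>Second moment method\<close>

text \<open>For the average of the exponentials of a Gaussian family, the ratio of
  its second moment to its squared mean is the average of \<open>exp (l\<^sup>2 \<rho>)\<close> over all pairwise
  correlations \<open>\<rho>\<close>.\<close>

lemma gauss_max_lower:
  fixes I :: "'i set" and w :: "'s \<Rightarrow> 'i \<Rightarrow> real"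
  assumes I: "finite I" "I \<noteq> {}" and S: "finite S" "S \<noteq> {}"
    and w: "\<And>x i. x \<in> S \<Longrightarrow> i \<in> I \<Longrightarrow> \<bar>w x i\<bar> = 1"
    and l: "0 < l" and t: "exp (l * t) \<le> exp (l\<^sup>2 / 2) / 2"
  shows "measure (gauss I) {g \<in> space (gauss I). \<forall>x\<in>S. (\<Sum>i\<in>I. w x i * g i) \<le> t * sqrt (card I)}
    \<le> 4 * ((\<Sum>x\<in>S. \<Sum>y\<in>S. exp (l\<^sup>2 * ((\<Sum>i\<in>I. w x i * w y i) / card I))) / (real (card S))\<^sup>2 - 1)"
proof -
  interpret prob_space "gauss I" by (rule prob_space_gauss)
  define N where "N = real (card I)"
  define K where "K = real (card S)"
  have N: "0 < N" and K: "0 < K" using I S by (auto simp: N_def K_def card_gt_0_iff)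
  define X where "X x g = (\<Sum>i\<in>I. (l / sqrt N * w x i) * g i)" for x g
  \<comment> \<open>All terms have the same mean \<open>m1\<close>: weights of modulus one give
    every \<open>X x\<close> the variance l^2.\<close>
  define Z where "Z g = (\<Sum>x\<in>S. exp (X x g)) / K" for g
  define m1 where "m1 = exp (l\<^sup>2 / 2)"
  define D where "D = (\<Sum>x\<in>S. \<Sum>y\<in>S. exp (l\<^sup>2 * ((\<Sum>i\<in>I. w x i * w y i) / N))) / K\<^sup>2"
  have w2: "(w x i)\<^sup>2 = 1" if "x \<in> S" "i \<in> I" for x i
    using w[OF that] by (metis power2_abs power_one)
  have l2: "(l / sqrt N * a)\<^sup>2 = l\<^sup>2 / N * a\<^sup>2" for a
    using N by (simp add: power_mult_distrib power_divide)
  have E1: "has_bochner_integral (gauss I) (\<lambda>g. exp (X x g)) m1" if x: "x \<in> S" for x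
  proof -
    have "(\<Sum>i\<in>I. (l / sqrt N * w x i)\<^sup>2) = l\<^sup>2"
      unfolding l2 using N w2[OF x] by (simp add: N_def[symmetric])
    then show ?thesis using gauss_exp[OF I(1), of "\<lambda>i. l / sqrt N * w x i"] by (simp add: X_def m1_def)
  qed
  have E2: "has_bochner_integral (gauss I) (\<lambda>g. exp (X x g) * exp (X y g))
      (m1\<^sup>2 * exp (l\<^sup>2 * ((\<Sum>i\<in>I. w x i * w y i) / N)))" if x: "x \<in> S" and y: "y \<in> S" for x y
  proof -
    have "(\<Sum>i\<in>I. (l / sqrt N * (w x i + w y i))\<^sup>2) = (\<Sum>i\<in>I. l\<^sup>2 / N * (2 + 2 * (w x i * w y i)))"
      using w2[OF x] w2[OF y] unfolding l2 by (intro sum.cong) (simp_all add: power2_sum)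
    also have "\<dots> = 2 * l\<^sup>2 + 2 * (l\<^sup>2 * ((\<Sum>i\<in>I. w x i * w y i) / N))"
      unfolding sum_distrib_left[symmetric] sum.distrib using N by (simp add: N_def[symmetric] field_simps)
    finally have s: "(\<Sum>i\<in>I. (l / sqrt N * (w x i + w y i))\<^sup>2) / 2 = l\<^sup>2 + l\<^sup>2 * ((\<Sum>i\<in>I. w x i * w y i) / N)"
      by simp
    have X: "exp (X x g) * exp (X y g) = exp (\<Sum>i\<in>I. (l / sqrt N * (w x i + w y i)) * g i)" for g
      by (simp add: X_def exp_add[symmetric] sum.distrib[symmetric] algebra_simps)
    have "m1\<^sup>2 = exp (l\<^sup>2)" by (simp add: m1_def power2_eq_square exp_add[symmetric])
    then show ?thesis
      using gauss_exp[OF I(1), of "\<lambda>i. l / sqrt N * (w x i + w y i)"] by (simp only: X s exp_add)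
  qed
  have Zm[measurable]: "Z \<in> borel_measurable (gauss I)"
    unfolding Z_def[abs_def] X_def by measurable
  have EZ: "has_bochner_integral (gauss I) Z m1"
  proof -
    have "has_bochner_integral (gauss I) (\<lambda>g. (\<Sum>x\<in>S. exp (X x g)) / K) ((\<Sum>x\<in>S. m1) / K)"
      by (intro has_bochner_integral_divide_zero has_bochner_integral_sum E1)
    then show ?thesis using K by (simp add: Z_def[abs_def] K_def)
  qed
  have EZ2: "has_bochner_integral (gauss I) (\<lambda>g. (Z g)\<^sup>2) (m1\<^sup>2 * D)"
  proof -
    have "has_bochner_integral (gauss I) (\<lambda>g. (\<Sum>x\<in>S. \<Sum>y\<in>S. exp (X x g) * exp (X y g)) / K\<^sup>2)
       ((\<Sum>x\<in>S. \<Sum>y\<in>S. m1\<^sup>2 * exp (l\<^sup>2 * ((\<Sum>i\<in>I. w x i * w y i) / N))) / K\<^sup>2)"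
      by (intro has_bochner_integral_divide_zero has_bochner_integral_sum E2)
    moreover have "(Z g)\<^sup>2 = (\<Sum>x\<in>S. \<Sum>y\<in>S. exp (X x g) * exp (X y g)) / K\<^sup>2" for g
      unfolding Z_def power_divide by (simp only: power2_eq_square[of "sum _ _"] sum_product)
    moreover have "m1\<^sup>2 * D = (\<Sum>x\<in>S. \<Sum>y\<in>S. m1\<^sup>2 * exp (l\<^sup>2 * ((\<Sum>i\<in>I. w x i * w y i) / N))) / K\<^sup>2"
      unfolding D_def by (simp only: sum_distrib_left times_divide_eq_right)
    ultimately show ?thesis by simp
  qed
  have int: "expectation Z = m1" "expectation (\<lambda>g. (Z g)\<^sup>2) = m1\<^sup>2 * D" "integrable (gauss I) Z" "integrable (gauss I) (\<lambda>g. (Z g)\<^sup>2)"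
    using EZ EZ2 by (auto simp: has_bochner_integral_iff)
  have var: "variance Z = m1\<^sup>2 * (D - 1)"
    using variance_eq[OF int(3,4)] int(1,2) by (simp add: algebra_simps)
  \<comment> \<open>If no sum exceeds the level, every exponential is at most \<open>m1 / 2\<close>
    by hypothesis \<open>t\<close>. Then \<open>Z\<close> misses its mean by at least
    \<open>m1 / 2\<close>, which Chebyshev's inequality controls.\<close>
  have "prob {g \<in> space (gauss I). \<forall>x\<in>S. (\<Sum>i\<in>I. w x i * g i) \<le> t * sqrt N}
     \<le> prob {g \<in> space (gauss I). \<bar>Z g - expectation Z\<bar> \<ge> m1 / 2}"
  proof (intro finite_measure_mono subsetI)
    fix g assume "g \<in> {g \<in> space (gauss I). \<forall>x\<in>S. (\<Sum>i\<in>I. w x i * g i) \<le> t * sqrt N}"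
    then have g: "g \<in> space (gauss I)" "\<And>x. x \<in> S \<Longrightarrow> (\<Sum>i\<in>I. w x i * g i) \<le> t * sqrt N" by auto
    have "exp (X x g) \<le> m1 / 2" if "x \<in> S" for x
    proof -
      have "X x g = l / sqrt N * (\<Sum>i\<in>I. w x i * g i)" by (simp add: X_def sum_distrib_left mult_ac)
      also have "\<dots> \<le> l / sqrt N * (t * sqrt N)" using l N g(2)[OF that] by (intro mult_left_mono) auto
      also have "\<dots> = l * t" using N by simp
      finally have "exp (X x g) \<le> exp (l * t)" by simp
      also note t
      finally show ?thesis by (simp add: m1_def)
    qed
    then have "(\<Sum>x\<in>S. exp (X x g)) \<le> (\<Sum>x\<in>S. m1 / 2)" by (intro sum_mono)
    then have "Z g \<le> m1 / 2" using K by (simp add: Z_def K_def[symmetric] field_simps)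
    then show "g \<in> {g \<in> space (gauss I). \<bar>Z g - expectation Z\<bar> \<ge> m1 / 2}"
      using g(1) int(1) abs_ge_minus_self[of "Z g - m1"] by simp
  qed measurable
  also have "\<dots> \<le> variance Z / (m1 / 2)\<^sup>2"
    by (rule Chebyshev_inequality) (use int in \<open>auto simp: m1_def\<close>)
  also have "\<dots> = 4 * (D - 1)"
    unfolding var by (simp add: m1_def power_divide)
  finally show ?thesis by (simp add: N_def D_def K_def)
qed

subsection \<open>Coefficient norms and multi-indices\<close>

lemma lp_norm_nonneg [simp]: "0 \<le> lp_norm p I a"
  by (simp add: lp_norm_def)

lemma lp_norm_scale:
  assumes r: "0 \<le> r" and p: "p \<noteq> 0"
  shows "lp_norm p I (\<lambda>i\<in>I. r * a i) = r * lp_norm p I a"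
proof -
  have "(\<Sum>i\<in>I. \<bar>(\<lambda>i\<in>I. r * a i) i\<bar> powr p) = r powr p * (\<Sum>i\<in>I. \<bar>a i\<bar> powr p)"
    using r by (simp add: abs_mult powr_mult sum_distrib_left)
  then have "lp_norm p I (\<lambda>i\<in>I. r * a i) = (r powr p) powr (1 / p) * lp_norm p I a"
    using r by (simp add: lp_norm_def powr_mult sum_nonneg)
  also have "(r powr p) powr (1 / p) = r" using r p by (simp add: powr_powr)
  finally show ?thesis .
qed

text \<open>After division by the Euclidean norm all entries have modulus at most 1, where a smaller
  exponent gives a larger power.\<close>

lemma L2_le_lp_norm:
  assumes I: "finite I" and p: "0 < p" "p \<le> 2"
  shows "L2_set a I \<le> lp_norm p I a"
proof (cases "L2_set a I = 0")
  case False
  define s where "s = L2_set a I"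
  have s: "0 < s" using False L2_set_nonneg[of a I] by (simp add: s_def less_le)
  have s2: "s\<^sup>2 = (\<Sum>i\<in>I. (a i)\<^sup>2)" by (simp add: s_def L2_set_def sum_nonneg)
  have "1 = (\<Sum>i\<in>I. (a i)\<^sup>2) / s\<^sup>2" using s by (simp add: s2[symmetric])
  also have "\<dots> = (\<Sum>i\<in>I. (\<bar>a i\<bar> / s)\<^sup>2)" by (simp add: sum_divide_distrib power_divide)
  also have "\<dots> \<le> (\<Sum>i\<in>I. (\<bar>a i\<bar> / s) powr p)"
  proof (rule sum_mono)
    fix i assume i: "i \<in> I"
    have "\<bar>a i\<bar> \<le> L2_set (\<lambda>i. \<bar>a i\<bar>) I" using I i by (intro member_le_L2_set) auto
    then have "\<bar>a i\<bar> \<le> s" by (simp add: s_def L2_set_def)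
    then have "\<bar>a i\<bar> / s \<le> 1" using s by simp
    then have "(\<bar>a i\<bar> / s) powr 2 \<le> (\<bar>a i\<bar> / s) powr p"
      using p s by (intro powr_mono') auto
    moreover have "(\<bar>a i\<bar> / s)\<^sup>2 = (\<bar>a i\<bar> / s) powr 2"
      using s by (cases "a i = 0") auto
    ultimately show "(\<bar>a i\<bar> / s)\<^sup>2 \<le> (\<bar>a i\<bar> / s) powr p" by simp
  qed
  also have "\<dots> = (\<Sum>i\<in>I. \<bar>a i\<bar> powr p) / s powr p"
    using s by (simp add: powr_divide sum_divide_distrib)
  finally have "s powr p \<le> (\<Sum>i\<in>I. \<bar>a i\<bar> powr p)" using s by (simp add: field_simps)
  then have "(s powr p) powr (1 / p) \<le> (\<Sum>i\<in>I. \<bar>a i\<bar> powr p) powr (1 / p)"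
    using p by (intro powr_mono2) auto
  then show ?thesis using p s by (simp add: powr_powr lp_norm_def s_def)
qed simp

text \<open>Each term is compared with the mean of the squares through the weighted inequality
  of arithmetic and geometric means.\<close>

lemma lp_norm_le_L2:
  assumes I: "finite I" "I \<noteq> {}" and p: "0 < p" "p \<le> 2"
  shows "lp_norm p I a \<le> real (card I) powr (1 / p - 1 / 2) * L2_set a I"
proof -
  define N where "N = real (card I)"
  define S where "S = (\<Sum>i\<in>I. (a i)\<^sup>2)"
  define \<mu> where "\<mu> = S / N"
  have N: "0 < N" using I by (simp add: N_def card_gt_0_iff)
  show ?thesis
  proof (cases "S = 0")
    case True
    then have "\<forall>i\<in>I. a i = 0" using I by (simp add: S_def sum_nonneg_eq_0_iff)
    then show ?thesis using p by (simp add: lp_norm_def)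
  next
    case False
    then have S: "0 < S" by (simp add: S_def sum_nonneg less_le)
    then have \<mu>: "0 < \<mu>" using N by (simp add: \<mu>_def)
    have le: "\<bar>a i\<bar> powr p \<le> \<mu> powr (p / 2 - 1) * (p / 2 * (a i)\<^sup>2 + (1 - p / 2) * \<mu>)" for i
    proof (cases "a i = 0")
      case True then show ?thesis using p \<mu> by simp
    next
      case False
      have "((a i)\<^sup>2) powr (p / 2) * \<mu> powr (1 - p / 2) \<le> p / 2 * (a i)\<^sup>2 + (1 - p / 2) * \<mu>"
        using p \<mu> False by (intro Youngs_inequality_0) auto
      then have "\<mu> powr (p / 2 - 1) * (((a i)\<^sup>2) powr (p / 2) * \<mu> powr (1 - p / 2)) \<le> \<mu> powr (p / 2 - 1) * (p / 2 * (a i)\<^sup>2 + (1 - p / 2) * \<mu>)"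
        by (intro mult_left_mono) auto
      moreover have "((a i)\<^sup>2) powr (p / 2) = \<bar>a i\<bar> powr p"
      proof -
        have "((a i)\<^sup>2) = \<bar>a i\<bar> powr 2" using False by simp
        then show ?thesis by (simp only: powr_powr) simp
      qed
      moreover have "\<mu> powr (p / 2 - 1) * \<mu> powr (1 - p / 2) = 1"
        using \<mu> by (simp add: powr_add[symmetric])
      ultimately show ?thesis by (simp add: mult_ac)
    qed
    have "(\<Sum>i\<in>I. \<bar>a i\<bar> powr p) \<le> (\<Sum>i\<in>I. \<mu> powr (p / 2 - 1) * (p / 2 * (a i)\<^sup>2 + (1 - p / 2) * \<mu>))"
      by (intro sum_mono le)
    also have "\<dots> = \<mu> powr (p / 2 - 1) * (\<Sum>i\<in>I. p / 2 * (a i)\<^sup>2 + (1 - p / 2) * \<mu>)"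
      by (simp only: sum_distrib_left)
    also have "(\<Sum>i\<in>I. p / 2 * (a i)\<^sup>2 + (1 - p / 2) * \<mu>) = \<mu> * N"
    proof -
      have "(\<Sum>i\<in>I. p / 2 * (a i)\<^sup>2 + (1 - p / 2) * \<mu>) = p / 2 * S + (1 - p / 2) * (\<mu> * N)"
        by (simp only: sum.distrib sum_distrib_left S_def) (simp add: N_def)
      also have "\<mu> * N = S" using N by (simp add: \<mu>_def)
      finally show ?thesis using N by (simp add: \<mu>_def algebra_simps)
    qed
    also have "\<mu> powr (p / 2 - 1) * (\<mu> * N) = N * \<mu> powr (p / 2)"
    proof -
      have "\<mu> powr (p / 2) = \<mu> powr (p / 2 - 1) * \<mu> powr 1" unfolding powr_add[symmetric] by simp
      then show ?thesis using \<mu> by simp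
    qed
    finally have "lp_norm p I a \<le> (N * \<mu> powr (p / 2)) powr (1 / p)"
      unfolding lp_norm_def using p by (intro powr_mono2) (auto intro: sum_nonneg)
    also have "\<dots> = N powr (1 / p) * \<mu> powr (1 / 2)"
      using N \<mu> p by (simp add: powr_mult powr_powr)
    also have "\<mu> powr (1 / 2) = sqrt S / N powr (1 / 2)"
      using S N by (simp add: \<mu>_def powr_divide powr_half_sqrt)
    also have "N powr (1 / p) * (sqrt S / N powr (1 / 2)) = N powr (1 / p - 1 / 2) * sqrt S"
      unfolding powr_diff by simp
    finally show ?thesis unfolding N_def L2_set_def S_def .
  qed
qed

text \<open>The third value is the exponent of the number of coefficients in
  \<open>lp_norm_le_L2\<close>. Being 1 / (2 m), it turns a bound \<open>B ^ m\<close> for that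
  number into the factor \<open>sqrt B\<close>.\<close>

lemma BH_exponent_bounds:
  assumes "0 < m"
  shows "0 < BH_exponent m" "BH_exponent m \<le> 2" "1 / BH_exponent m - 1 / 2 = 1 / (2 * real m)"
proof -
  show "0 < BH_exponent m" "BH_exponent m \<le> 2" using assms by (auto simp: BH_exponent_def divide_simps)
  have "1 / BH_exponent m = (real m + 1) / (2 * real m)" by (simp add: BH_exponent_def)
  also have "\<dots> = 1 / 2 + 1 / (2 * real m)" using assms by (simp add: add_divide_distrib)
  finally show "1 / BH_exponent m - 1 / 2 = 1 / (2 * real m)" by simp
qed

text \<open>Lists serve twice: for the number of multi-indices, and for the coefficients of a
  product of power series in \<open>prod_geom_fps_nth\<close>.\<close>

lemma bij_betw_multi_indices_lists:
  "bij_betw (\<lambda>\<alpha>. map \<alpha> [0..<n]) (multi_indices m n) {l. length l = n \<and> sum_list l = m}"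
proof (rule bij_betw_byWitness[where f' = "\<lambda>l. \<lambda>j\<in>{..<n}. l ! j"])
  show "\<forall>\<alpha>\<in>multi_indices m n. (\<lambda>j\<in>{..<n}. map \<alpha> [0..<n] ! j) = \<alpha>"
  proof
    fix \<alpha> assume "\<alpha> \<in> multi_indices m n"
    then have "\<alpha> \<in> extensional {..<n}" by (simp add: multi_indices_def PiE_def)
    then show "(\<lambda>j\<in>{..<n}. map \<alpha> [0..<n] ! j) = \<alpha>"
      by (intro extensionalityI[of _ "{..<n}"]) auto
  qed
  show "\<forall>l\<in>{l. length l = n \<and> sum_list l = m}. map (\<lambda>j\<in>{..<n}. l ! j) [0..<n] = l"
  proof
    fix l assume "l \<in> {l. length l = n \<and> sum_list l = m}"
    then show "map (\<lambda>j\<in>{..<n}. l ! j) [0..<n] = l" by (intro nth_equalityI) auto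
  qed
  have "sum_list (map \<alpha> [0..<n]) = (\<Sum>j<n. \<alpha> j)" for \<alpha> :: "nat \<Rightarrow> nat"
    by (simp add: interv_sum_list_conv_sum_set_nat atLeast0LessThan)
  then show "(\<lambda>\<alpha>. map \<alpha> [0..<n]) ` multi_indices m n \<subseteq> {l. length l = n \<and> sum_list l = m}"
    by (intro image_subsetI) (simp add: multi_indices_def)
  show "(\<lambda>l. \<lambda>j\<in>{..<n}. l ! j) ` {l. length l = n \<and> sum_list l = m} \<subseteq> multi_indices m n"
  proof (intro image_subsetI)
    fix l assume "l \<in> {l. length l = n \<and> sum_list l = m}"
    then have "length l = n" "sum_list l = m" by auto
    then have "(\<Sum>j<n. l ! j) = m" by (auto simp: sum_list_sum_nth atLeast0LessThan)
    then show "(\<lambda>j\<in>{..<n}. l ! j) \<in> multi_indices m n"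
      by (simp add: multi_indices_def)
  qed
qed

lemma card_multi_indices: "card (multi_indices m n) = (m + n - 1) choose m"
  using bij_betw_same_card[OF bij_betw_multi_indices_lists, of m n] card_length_sum_list[of n m] by (simp only:)

text \<open>In this rising factorial each factor lies between n and n + m, which yields
  \<open>card_multi_indices_lower\<close> and \<open>card_multi_indices_upper\<close>.\<close>

lemma fact_mult_card_multi_indices:
  "fact m * real (card (multi_indices m n)) = (\<Prod>i<m. real n + real i)"
proof (cases "n = 0")
  case True
  show ?thesis
  proof (cases "m = 0")
    case False
    then have "(\<Prod>i<m. real n + real i) = 0"
      using True by (intro prod_zero) auto
    then show ?thesis using True False by (simp add: card_multi_indices binomial_eq_0)
  qed (simp add: card_multi_indices)
next
  case False
  then have "real ((m + n - 1) choose m) = pochhammer (real n) m / fact m"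
    by (simp add: binomial_gbinomial gbinomial_pochhammer' of_nat_diff)
  then show ?thesis by (simp add: card_multi_indices pochhammer_prod atLeast0LessThan)
qed

lemma card_multi_indices_lower: "real n ^ m \<le> fact m * real (card (multi_indices m n))"
proof -
  have "real n ^ m = (\<Prod>i<m. real n)" by simp
  also have "\<dots> \<le> (\<Prod>i<m. real n + real i)" by (intro prod_mono) auto
  finally show ?thesis by (simp add: fact_mult_card_multi_indices)
qed

text \<open>A single term of the exponential series is at most its sum.\<close>

lemma power_le_fact_exp: "real m ^ m \<le> fact m * exp (real m)"
proof -
  have "real m ^ m / fact m \<le> exp (real m)"
    using sum_le_suminf[OF summable_exp[of "real m"], of "{m}"]
    by (simp add: exp_def divide_inverse mult.commute)
  then show ?thesis by (simp add: field_simps)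
qed

lemma card_multi_indices_upper:
  assumes m: "0 < m"
  shows "real (card (multi_indices m n)) \<le> (exp 1 * (1 + real n / real m)) ^ m"
proof -
  have "fact m * real (card (multi_indices m n)) \<le> (\<Prod>i<m. real n + real m)"
    unfolding fact_mult_card_multi_indices by (intro prod_mono) auto
  also have "\<dots> = real m ^ m * (1 + real n / real m) ^ m"
    using m by (simp add: power_mult_distrib[symmetric] field_simps)
  also have "\<dots> \<le> fact m * exp (real m) * (1 + real n / real m) ^ m"
    by (intro mult_right_mono power_le_fact_exp) auto
  also have "\<dots> = fact m * (exp 1 * (1 + real n / real m)) ^ m"
    by (simp add: power_mult_distrib exp_of_nat_mult[symmetric])
  finally show ?thesis by simp
qed

lemma lp_norm_BH_le:
  assumes m: "0 < m" and n: "0 < n"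
  shows "lp_norm (BH_exponent m) (multi_indices m n) a
    \<le> sqrt (exp 1 * (1 + real n / real m)) * L2_set a (multi_indices m n)"
proof -
  define B where "B = exp 1 * (1 + real n / real m)"
  have B: "0 < B" by (auto simp: B_def intro!: mult_pos_pos add_pos_nonneg)
  have "lp_norm (BH_exponent m) (multi_indices m n) a
    \<le> real (card (multi_indices m n)) powr (1 / (2 * real m)) * L2_set a (multi_indices m n)"
    using lp_norm_le_L2[OF finite_multi_indices multi_indices_nonempty[OF n] BH_exponent_bounds(1,2)[OF m]]
    by (simp only: BH_exponent_bounds(3)[OF m])
  also have "\<dots> \<le> (B ^ m) powr (1 / (2 * real m)) * L2_set a (multi_indices m n)"
    unfolding B_def by (intro mult_right_mono powr_mono2 card_multi_indices_upper m) (auto simp: L2_set_nonneg)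
  also have "(B ^ m) powr (1 / (2 * real m)) = B powr (1 / 2)"
    using B m by (simp add: powr_realpow[symmetric] powr_powr)
  finally show ?thesis using B by (simp add: powr_half_sqrt B_def)
qed

subsection \<open>Sign vectors\<close>

definition sign_cube :: "nat \<Rightarrow> (nat \<Rightarrow> real) set" where
  "sign_cube n = ({..<n} \<rightarrow>\<^sub>E {-1, 1})"

abbreviation complete_hom :: "nat \<Rightarrow> nat \<Rightarrow> (nat \<Rightarrow> real) \<Rightarrow> real" where
  "complete_hom m n \<equiv> hom_poly m n (\<lambda>_. 1)"

lemma finite_sign_cube: "finite (sign_cube n)"
  by (simp add: sign_cube_def finite_PiE)

lemma card_sign_cube: "card (sign_cube n) = 2 ^ n"
  by (simp add: sign_cube_def card_PiE numeral_2_eq_2)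

lemma sign_cube_nonempty: "sign_cube n \<noteq> {}"
  by (simp add: sign_cube_def PiE_eq_empty_iff)

lemma sign_cubeD: "x \<in> sign_cube n \<Longrightarrow> j < n \<Longrightarrow> x j = -1 \<or> x j = 1"
  using PiE_mem[of x "{..<n}" "\<lambda>_. {-1, 1}" j] by (simp add: sign_cube_def)

lemma sum_prod_sign_cube: "(\<Sum>x\<in>sign_cube n. \<Prod>j<n. f j (x j)) = (\<Prod>j<n. f j (-1) + f j (1::real) :: real)"
proof -
  have "(\<Prod>j<n. f j (-1) + f j (1::real)) = (\<Prod>j<n. \<Sum>s\<in>{-1, 1}. f j s)"
    by (rule prod.cong) simp_all
  also have "\<dots> = (\<Sum>x\<in>sign_cube n. \<Prod>j<n. f j (x j))"
    unfolding sign_cube_def by (rule prod_sum_PiE) simp_all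
  finally show ?thesis by simp
qed

text \<open>The sign cube is a group under coordinatewise multiplication, and multiplication by
  \<open>y\<close> is an involution of it. Averages over pairs thus reduce to averages over single
  points.\<close>

lemma sum_sign_cube_mult:
  assumes y: "y \<in> sign_cube n"
  shows "(\<Sum>x\<in>sign_cube n. F (\<lambda>j\<in>{..<n}. x j * y j)) = (\<Sum>x\<in>sign_cube n. F x)"
proof (rule sum.reindex_bij_witness[where i = "\<lambda>x. \<lambda>j\<in>{..<n}. x j * y j" and j = "\<lambda>x. \<lambda>j\<in>{..<n}. x j * y j"])
  have yy: "y j * y j = 1" if "j < n" for j using sign_cubeD[OF y that] by auto
  fix x assume x: "x \<in> sign_cube n"
  show "(\<lambda>j\<in>{..<n}. (\<lambda>j\<in>{..<n}. x j * y j) j * y j) = x"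
    by (rule extensionalityI[of _ "{..<n}"]) (use x yy in \<open>auto simp: sign_cube_def PiE_def mult.assoc\<close>)
  then show "(\<lambda>j\<in>{..<n}. (\<lambda>j\<in>{..<n}. x j * y j) j * y j) = x" .
  have "x j * y j \<in> {-1, 1}" if "j < n" for j
    using sign_cubeD[OF x that] sign_cubeD[OF y that] by auto
  then show "(\<lambda>j\<in>{..<n}. x j * y j) \<in> sign_cube n" by (auto simp: sign_cube_def)
  then show "(\<lambda>j\<in>{..<n}. x j * y j) \<in> sign_cube n" .
qed simp

lemma abs_monomial_sign_cube:
  assumes "x \<in> sign_cube n"
  shows "\<bar>\<Prod>j<n. x j ^ \<alpha> j\<bar> = 1"
proof -
  have "\<bar>x j ^ \<alpha> j\<bar> = 1" if "j < n" for j using sign_cubeD[OF assms that] by (auto simp: power_abs)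
  then show ?thesis by (simp add: abs_prod)
qed

text \<open>The right-hand side is the covariance of P_g(x) and P_g(y) for a standard Gaussian
  \<open>g\<close>. For sign vectors, division by the number of monomials makes it their
  correlation.\<close>

lemma complete_hom_mult:
  "complete_hom m n (\<lambda>j\<in>{..<n}. x j * y j) = (\<Sum>\<alpha>\<in>multi_indices m n. (\<Prod>j<n. x j ^ \<alpha> j) * (\<Prod>j<n. y j ^ \<alpha> j))"
  unfolding hom_poly_def by (intro sum.cong) (auto simp: power_mult_distrib prod.distrib)

lemma complete_hom_le_card:
  assumes "x \<in> sign_cube n"
  shows "\<bar>complete_hom m n x\<bar> \<le> real (card (multi_indices m n))"
proof -
  have "\<bar>complete_hom m n x\<bar> \<le> (\<Sum>\<alpha>\<in>multi_indices m n. \<bar>\<Prod>j<n. x j ^ \<alpha> j\<bar>)"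
    unfolding hom_poly_def by simp
  also have "\<dots> = real (card (multi_indices m n))"
    by (simp add: abs_monomial_sign_cube[OF assms])
  finally show ?thesis .
qed

lemma hom_poly_minus: "hom_poly m n a (\<lambda>j. - x j) = (-1) ^ m * hom_poly m n a x"
proof -
  have "(\<Prod>j<n. (- x j) ^ \<alpha> j) = (-1) ^ m * (\<Prod>j<n. x j ^ \<alpha> j)" if "\<alpha> \<in> multi_indices m n" for \<alpha>
  proof -
    have "(\<Prod>j<n. (- x j) ^ \<alpha> j) = (\<Prod>j<n. (-1) ^ \<alpha> j) * (\<Prod>j<n. x j ^ \<alpha> j)"
      unfolding prod.distrib[symmetric] by (intro prod.cong refl) (metis power_minus)
    also have "(\<Prod>j<n. (-1 :: real) ^ \<alpha> j) = (-1) ^ m"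
      using that by (simp add: power_sum[symmetric] multi_indices_def)
    finally show ?thesis .
  qed
  then show ?thesis by (simp add: hom_poly_def sum_distrib_left mult_ac)
qed

subsection \<open>Generating functions\<close>

text \<open>Bounds the value at \<open>r\<close> of a series with nonnegative coefficients through
  its partial sums, so that convergence need not be discussed.\<close>

definition fps_dom :: "real \<Rightarrow> real fps \<Rightarrow> real \<Rightarrow> bool" where
  "fps_dom r f B \<longleftrightarrow> (\<forall>i. 0 \<le> fps_nth f i) \<and> (\<forall>M. (\<Sum>i\<le>M. fps_nth f i * r ^ i) \<le> B)"

lemma fps_dom_1: "fps_dom r 1 1"
proof -
  have "(\<Sum>i\<le>M. fps_nth (1 :: real fps) i * r ^ i) = (\<Sum>i\<in>{0}. fps_nth (1 :: real fps) i * r ^ i)" for M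
    by (rule sum.mono_neutral_right) auto
  then show ?thesis by (simp add: fps_dom_def)
qed

text \<open>The Cauchy product runs over a triangle of index pairs. Nonnegativity allows enlarging
  it to a square, over which the sum factors.\<close>

lemma fps_dom_mult:
  assumes r: "0 \<le> r" and f: "fps_dom r f A" and g: "fps_dom r g B"
  shows "fps_dom r (f * g) (A * B)"
  unfolding fps_dom_def
proof (intro conjI allI)
  show "0 \<le> fps_nth (f * g) i" for i
    using f g by (auto simp: fps_mult_nth fps_dom_def intro!: sum_nonneg)
  fix M
  let ?h = "\<lambda>i j. (fps_nth f i * r ^ i) * (fps_nth g j * r ^ j)"
  have "(\<Sum>i\<le>M. fps_nth (f * g) i * r ^ i) = (\<Sum>k\<le>M. \<Sum>i\<le>k. ?h i (k - i))"
    by (intro sum.cong refl) (auto simp: fps_mult_nth sum_distrib_right atLeast0AtMost power_add[symmetric] intro!: sum.cong)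
  also have "\<dots> = (\<Sum>(i, j)\<in>{(i, j). i + j \<le> M}. ?h i j)"
    by (rule sum.triangle_reindex_eq[symmetric])
  also have "\<dots> \<le> (\<Sum>(i, j)\<in>{..M} \<times> {..M}. ?h i j)"
    using f g r by (intro sum_mono2) (auto simp: fps_dom_def)
  also have "\<dots> = (\<Sum>i\<le>M. fps_nth f i * r ^ i) * (\<Sum>i\<le>M. fps_nth g i * r ^ i)"
    by (simp add: sum.cartesian_product[symmetric] sum_product)
  also have "\<dots> \<le> A * B"
  proof (rule mult_mono)
    show "(\<Sum>i\<le>M. fps_nth g i * r ^ i) \<ge> 0" using g r by (auto simp: fps_dom_def intro!: sum_nonneg)
    have "0 \<le> (\<Sum>i\<le>0. fps_nth f i * r ^ i)" using f r by (auto simp: fps_dom_def)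
    also have "\<dots> \<le> A" using f unfolding fps_dom_def by blast
    finally show "0 \<le> A" .
  qed (use f g in \<open>auto simp: fps_dom_def\<close>)
  finally show "(\<Sum>i\<le>M. fps_nth (f * g) i * r ^ i) \<le> A * B" .
qed

lemma fps_dom_power:
  assumes r: "0 \<le> r" and f: "fps_dom r f A"
  shows "fps_dom r (f ^ k) (A ^ k)"
  by (induction k) (auto intro: fps_dom_1 fps_dom_mult[OF r f])

text \<open>Cauchy's coefficient estimate: with nonnegative terms, one of them is at most a partial
  sum.\<close>

lemma fps_dom_nth:
  assumes r: "0 \<le> r" and f: "fps_dom r f A"
  shows "\<bar>fps_nth f i\<bar> * r ^ i \<le> A"
proof -
  have "fps_nth f i * r ^ i \<le> (\<Sum>j\<le>i. fps_nth f j * r ^ j)"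
    using f r by (intro member_le_sum) (auto simp: fps_dom_def)
  also have "\<dots> \<le> A" using f by (auto simp: fps_dom_def)
  finally show ?thesis using f by (auto simp: fps_dom_def)
qed

definition geom_fps :: "real \<Rightarrow> real fps" where
  "geom_fps c = Abs_fps (\<lambda>k. c ^ k)"

text \<open>Expanding the product of the series 1 / (1 - x_j X), one picks a power of x_j from each
  factor, and the degrees add up to m.\<close>

lemma prod_geom_fps_nth:
  assumes n: "0 < n"
  shows "fps_nth (\<Prod>j<n. geom_fps (x j)) m = complete_hom m n x"
proof -
  obtain k where k: "n = Suc k" using n by (cases n) auto
  have "fps_nth (\<Prod>j<n. geom_fps (x j)) m = (\<Sum>v\<in>natpermute m (k + 1). \<Prod>j\<in>{0..k}. fps_nth (geom_fps (x j)) (v ! j))"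
    using fps_prod_nth[of "\<lambda>j. geom_fps (x j)" k m] by (simp add: k lessThan_Suc_atMost atLeast0AtMost)
  also have "\<dots> = (\<Sum>v\<in>{l. length l = n \<and> sum_list l = m}. \<Prod>j<n. x j ^ (v ! j))"
    by (intro sum.cong prod.cong) (auto simp: natpermute_def k geom_fps_def)
  also have "\<dots> = (\<Sum>\<alpha>\<in>multi_indices m n. \<Prod>j<n. x j ^ (map \<alpha> [0..<n] ! j))"
    by (rule sum.reindex_bij_betw[OF bij_betw_multi_indices_lists, symmetric])
  also have "\<dots> = complete_hom m n x"
    unfolding hom_poly_def by (intro sum.cong) (auto intro!: prod.cong)
  finally show ?thesis .
qed

text \<open>The partial sums are below 1 / (1 - r), and - ln (1 - r) <= r + 2 r^2 on
  [0, 1/2].\<close>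

lemma fps_dom_geom:
  assumes r: "0 \<le> r" "r \<le> 1 / 2"
  shows "fps_dom r (geom_fps 1) (exp (r + 2 * r\<^sup>2))"
  unfolding fps_dom_def
proof (intro conjI allI)
  fix M
  have ln: "- ln (1 - r) \<le> r + 2 * r\<^sup>2" using ln_one_minus_pos_lower_bound[OF r] by simp
  have "(\<Sum>i\<le>M. fps_nth (geom_fps 1) i * r ^ i) = (1 - r ^ Suc M) / (1 - r)"
    using r sum_gp0[of r M] by (simp add: geom_fps_def)
  also have "\<dots> \<le> 1 / (1 - r)" using r by (intro divide_right_mono) auto
  also have "\<dots> = exp (- ln (1 - r))" using r by (simp add: exp_minus inverse_eq_divide)
  also have "\<dots> \<le> exp (r + 2 * r\<^sup>2)" using ln by simp
  finally show "(\<Sum>i\<le>M. fps_nth (geom_fps 1) i * r ^ i) \<le> exp (r + 2 * r\<^sup>2)" .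
qed (simp add: geom_fps_def)

lemma geom_fps_mult_minus: "geom_fps 1 * geom_fps (-1) = Abs_fps (\<lambda>k. if even k then 1 else 0)"
proof (rule fps_ext)
  fix k
  have "(\<Sum>i\<le>k. (-1 :: real) ^ (k - i)) = (\<Sum>i\<le>k. (-1) ^ i)"
    by (rule sum.reindex_bij_witness[where i = "\<lambda>i. k - i" and j = "\<lambda>i. k - i"]) auto
  also have "\<dots> = (if even k then 1 else 0)"
    by (induction k) auto
  finally show "fps_nth (geom_fps 1 * geom_fps (-1)) k = fps_nth (Abs_fps (\<lambda>k. if even k then 1 else 0)) k"
    by (simp add: fps_mult_nth geom_fps_def atLeast0AtMost)
qed

text \<open>Two opposite signs together give 1 / (1 - X^2), whose bound has no linear term in
  \<open>r\<close>. This is how cancellation between signs enters the estimate of h_m.\<close>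

lemma fps_dom_geom2:
  assumes r: "0 \<le> r" "r \<le> 1 / 2"
  shows "fps_dom r (geom_fps 1 * geom_fps (-1)) (exp (2 * r\<^sup>2))"
  unfolding fps_dom_def geom_fps_mult_minus
proof (intro conjI allI)
  fix M
  have r2: "0 \<le> r\<^sup>2" "r\<^sup>2 \<le> 1 / 4" using r power_mono[of r "1/2" 2] by (auto simp: power_divide)
  have ln: "- ln (1 - r\<^sup>2) \<le> 2 * r\<^sup>2"
  proof -
    have "- ln (1 - r\<^sup>2) \<le> r\<^sup>2 + 2 * (r\<^sup>2)\<^sup>2"
      using ln_one_minus_pos_lower_bound[of "r\<^sup>2"] r2 by (simp del: power2_less_eq_zero_iff)
    also have "(r\<^sup>2)\<^sup>2 \<le> r\<^sup>2 * (1 / 4)" unfolding power2_eq_square[of "r\<^sup>2"] using r2 by (intro mult_left_mono) auto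
    finally show ?thesis using r2 by linarith
  qed
  have "(\<Sum>i\<le>M. fps_nth (Abs_fps (\<lambda>k. if even k then 1 else 0 :: real)) i * r ^ i) = (\<Sum>i\<in>{i\<in>{..M}. even i}. r ^ i)"
    by (subst sum.inter_filter) (auto intro!: sum.cong)
  also have "\<dots> \<le> (\<Sum>i\<in>(\<lambda>i. 2 * i) ` {..M}. r ^ i)"
    using r by (intro sum_mono2) (auto elim!: evenE)
  also have "\<dots> = (\<Sum>i\<le>M. (r\<^sup>2) ^ i)"
    by (subst sum.reindex) (auto simp: inj_on_def power_mult)
  also have "\<dots> = (1 - (r\<^sup>2) ^ Suc M) / (1 - r\<^sup>2)"
    using r2 sum_gp0[of "r\<^sup>2" M] by auto
  also have "\<dots> \<le> 1 / (1 - r\<^sup>2)" using r2 by (intro divide_right_mono) auto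
  also have "\<dots> = exp (- ln (1 - r\<^sup>2))" using r2 by (simp add: exp_minus inverse_eq_divide)
  also have "\<dots> \<le> exp (2 * r\<^sup>2)" using ln by simp
  finally show "(\<Sum>i\<le>M. fps_nth (Abs_fps (\<lambda>k. if even k then 1 else 0 :: real)) i * r ^ i) \<le> exp (2 * r\<^sup>2)" .
qed simp

text \<open>Each of the \<open>q\<close> negative signs is paired with a positive one. Only the p -
  q unpaired factors, whose number is x_1 + ... + x_n, carry the linear exponent; the quadratic
  terms add up to at most 2 n r^2.\<close>

lemma complete_hom_bound_pos:
  assumes n: "0 < n" and x: "\<And>j. j < n \<Longrightarrow> x j = -1 \<or> x j = 1"
    and pos: "0 \<le> (\<Sum>j<n. x j)" and r: "0 \<le> r" "r \<le> 1 / 2"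
  shows "\<bar>complete_hom m n x\<bar> * r ^ m \<le> exp (r * (\<Sum>j<n. x j) + 2 * real n * r\<^sup>2)"
proof -
  define A where "A = {j\<in>{..<n}. x j = 1}"
  define B where "B = {j\<in>{..<n}. x j = -1}"
  have AB: "{..<n} = A \<union> B" "A \<inter> B = {}" "finite A" "finite B"
    using x by (auto simp: A_def B_def)
  define p q where "p = card A" and "q = card B"
  have pq: "p + q = n" using card_Un_disjoint[OF AB(3,4,2)] AB(1) by (metis p_def q_def card_lessThan)
  have sum: "(\<Sum>j<n. x j) = real p - real q"
    unfolding AB(1) by (subst sum.union_disjoint) (use AB in \<open>auto simp: A_def B_def p_def q_def\<close>)
  then have qp: "q \<le> p" using pos by simp
  have "(\<Prod>j<n. geom_fps (x j)) = geom_fps 1 ^ p * geom_fps (-1) ^ q"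
    unfolding AB(1) by (subst prod.union_disjoint) (use AB in \<open>auto simp: A_def B_def p_def q_def\<close>)
  also have "\<dots> = (geom_fps 1 * geom_fps (-1)) ^ q * geom_fps 1 ^ (p - q)"
  proof -
    have "geom_fps 1 ^ p = geom_fps 1 ^ q * geom_fps 1 ^ (p - q)" using qp by (simp add: power_add[symmetric])
    then show ?thesis by (simp add: power_mult_distrib mult_ac)
  qed
  finally have eq: "(\<Prod>j<n. geom_fps (x j)) = (geom_fps 1 * geom_fps (-1)) ^ q * geom_fps 1 ^ (p - q)" .
  have "fps_dom r (\<Prod>j<n. geom_fps (x j)) (exp (2 * r\<^sup>2) ^ q * exp (r + 2 * r\<^sup>2) ^ (p - q))"
    unfolding eq by (intro fps_dom_mult fps_dom_power fps_dom_geom2 fps_dom_geom r)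
  from fps_dom_nth[OF r(1) this, of m]
  have "\<bar>complete_hom m n x\<bar> * r ^ m \<le> exp (2 * r\<^sup>2) ^ q * exp (r + 2 * r\<^sup>2) ^ (p - q)"
    by (simp add: prod_geom_fps_nth[OF n])
  also have "\<dots> = exp (real q * (2 * r\<^sup>2) + real (p - q) * (r + 2 * r\<^sup>2))"
    unfolding exp_of_nat_mult[symmetric] exp_add[of "real q * _"] ..
  also have "real q * (2 * r\<^sup>2) + real (p - q) * (r + 2 * r\<^sup>2) = r * (real p - real q) + 2 * real p * r\<^sup>2"
    using qp by (simp add: of_nat_diff algebra_simps)
  also have "\<dots> \<le> r * (real p - real q) + 2 * real n * r\<^sup>2"
    using pq by (intro add_left_mono mult_right_mono) auto
  finally show ?thesis by (simp add: sum)
qed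

lemma complete_hom_bound:
  assumes n: "0 < n" and x: "x \<in> sign_cube n" and r: "0 \<le> r" "r \<le> 1 / 2"
  shows "\<bar>complete_hom m n x\<bar> * r ^ m \<le> exp (r * \<bar>\<Sum>j<n. x j\<bar> + 2 * real n * r\<^sup>2)"
proof (cases "0 \<le> (\<Sum>j<n. x j)")
  case True
  then show ?thesis using complete_hom_bound_pos[OF n _ True r] sign_cubeD[OF x] by simp
next
  case False
  then have "0 \<le> (\<Sum>j<n. - x j)" by (simp add: sum_negf)
  moreover have "- x j = -1 \<or> - x j = 1" if "j < n" for j using sign_cubeD[OF x that] by auto
  ultimately have "\<bar>complete_hom m n (\<lambda>j. - x j)\<bar> * r ^ m \<le> exp (r * (\<Sum>j<n. - x j) + 2 * real n * r\<^sup>2)"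
    by (intro complete_hom_bound_pos n r)
  then show ?thesis using False by (simp add: hom_poly_minus abs_mult power_abs sum_negf)
qed

subsection \<open>Exponential moments of the sum of signs\<close>

lemma tanh_le_self: "0 \<le> c \<Longrightarrow> tanh c \<le> (c::real)"
proof -
  assume c: "0 \<le> c"
  have "0 - tanh 0 \<le> c - tanh c"
  proof (rule DERIV_nonneg_imp_nondecreasing[of 0 c "\<lambda>x. x - tanh x"])
    fix x :: real
    have "((\<lambda>x. x - tanh x) has_real_derivative 1 - (1 - (tanh x)\<^sup>2) * 1) (at x)"
      by (intro DERIV_diff DERIV_ident has_field_derivative_tanh) simp
    moreover have "0 \<le> 1 - (1 - (tanh x)\<^sup>2) * 1" by simp
    ultimately show "\<exists>y. ((\<lambda>x. x - tanh x) has_real_derivative y) (at x) \<and> 0 \<le> y" by blast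
  qed (rule c)
  then show ?thesis by simp
qed

text \<open>The derivative of x^2 / 2 - ln (cosh x) is x - tanh x, nonnegative for x >= 0; negative
  arguments follow by evenness.\<close>

lemma cosh_le_exp: "cosh c \<le> exp (c\<^sup>2 / 2)" for c :: real
proof -
  have *: "cosh c \<le> exp (c\<^sup>2 / 2)" if c: "0 \<le> c" for c :: real
  proof -
    have "0\<^sup>2 / 2 - ln (cosh 0) \<le> c\<^sup>2 / 2 - ln (cosh c)"
    proof (rule DERIV_nonneg_imp_nondecreasing[of 0 c "\<lambda>x. x\<^sup>2 / 2 - ln (cosh x)"])
      fix x :: real assume "0 \<le> x"
      then have "0 \<le> x - tanh x" using tanh_le_self by simp
      moreover have "((\<lambda>x. x\<^sup>2 / 2 - ln (cosh x)) has_real_derivative (x - tanh x)) (at x)"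
        by (rule derivative_eq_intros refl | simp add: tanh_def)+
      ultimately show "\<exists>y. ((\<lambda>x. x\<^sup>2 / 2 - ln (cosh x)) has_real_derivative y) (at x) \<and> 0 \<le> y" by blast
    qed (rule c)
    then have "ln (cosh c) \<le> c\<^sup>2 / 2" by simp
    then have "exp (ln (cosh c)) \<le> exp (c\<^sup>2 / 2)" by (simp only: exp_le_cancel_iff)
    then show ?thesis by (simp add: cosh_real_pos)
  qed
  show ?thesis using *[of c] *[of "- c"] by (cases "0 \<le> c") simp_all
qed

lemma sum_sign_cube_exp_le:
  "(\<Sum>x\<in>sign_cube n. exp (c * (\<Sum>j<n. x j))) \<le> 2 ^ n * exp (real n * c\<^sup>2 / 2)"
proof -
  have "(\<Sum>x\<in>sign_cube n. exp (c * (\<Sum>j<n. x j))) = (\<Sum>x\<in>sign_cube n. \<Prod>j<n. exp (c * x j))"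
    by (simp add: exp_sum sum_distrib_left)
  also have "\<dots> = (\<Prod>j<n. exp (c * -1) + exp (c * 1))" by (rule sum_prod_sign_cube)
  also have "\<dots> = (\<Prod>j<n. 2 * cosh c)" by (intro prod.cong refl) (simp add: cosh_def)
  also have "\<dots> = (2 * cosh c) ^ n" by simp
  also have "\<dots> \<le> (2 * exp (c\<^sup>2 / 2)) ^ n"
    using cosh_le_exp[of c] cosh_real_pos[of c] by (intro power_mono) auto
  also have "\<dots> = 2 ^ n * exp (real n * c\<^sup>2 / 2)"
    by (simp add: power_mult_distrib exp_of_nat_mult[symmetric])
  finally show ?thesis .
qed

lemma nn_integral_std_normal_exp_square:
  "(\<integral>\<^sup>+y. ennreal (exp (y\<^sup>2 / 4)) \<partial>std_normal) = ennreal (sqrt 2)"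
proof -
  have "(\<integral>\<^sup>+y. ennreal (exp (y\<^sup>2 / 4)) \<partial>std_normal)
      = (\<integral>\<^sup>+y. ennreal (std_normal_density y) * ennreal (exp (y\<^sup>2 / 4)) \<partial>lborel)"
    unfolding std_normal_def by (rule nn_integral_density) auto
  also have "\<dots> = (\<integral>\<^sup>+y. ennreal (sqrt 2) * ennreal (normal_density 0 (sqrt 2) y) \<partial>lborel)"
  proof (intro nn_integral_cong)
    fix y :: real
    have "std_normal_density y * exp (y\<^sup>2 / 4) = 1 / sqrt (2 * pi) * exp (- y\<^sup>2 / 2 + y\<^sup>2 / 4)"
      unfolding exp_add by (simp add: std_normal_density_def)
    also have "- y\<^sup>2 / 2 + y\<^sup>2 / 4 = - y\<^sup>2 / 4" by simp
    also have "1 / sqrt (2 * pi) * exp (- y\<^sup>2 / 4) = sqrt 2 * normal_density 0 (sqrt 2) y"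
    proof -
      have "sqrt (2 * pi * (sqrt 2)\<^sup>2) = sqrt (2 * pi) * sqrt 2" unfolding real_sqrt_mult by simp
      then show ?thesis by (simp add: normal_density_def)
    qed
    finally show "ennreal (std_normal_density y) * ennreal (exp (y\<^sup>2 / 4)) = ennreal (sqrt 2) * ennreal (normal_density 0 (sqrt 2) y)"
      by (simp add: ennreal_mult[symmetric])
  qed
  also have "\<dots> = ennreal (sqrt 2) * (\<integral>\<^sup>+y. ennreal (normal_density 0 (sqrt 2) y) \<partial>lborel)"
    by (rule nn_integral_cmult) auto
  also have "(\<integral>\<^sup>+y. ennreal (normal_density 0 (sqrt 2) y) \<partial>lborel) = 1"
    by (subst nn_integral_eq_integral) auto
  finally show ?thesis by simp
qed

text \<open>The square in the exponent is linearised by an auxiliary Gaussian integration.\<close>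

lemma sum_sign_cube_exp_square_le:
  assumes n: "0 < n"
  shows "(\<Sum>x\<in>sign_cube n. exp ((\<Sum>j<n. x j)\<^sup>2 / (4 * real n))) \<le> 2 ^ n * sqrt 2"
proof -
  \<comment> \<open>With s^2 = 2 n the Gaussian average of exp (v y / s) is exp (v^2 / (4 n)).
    Summing over the signs first leaves exp (y^2 / 4), which is still integrable against the normal
    law, with integral sqrt 2.\<close>
  define s where "s = sqrt (2 * real n)"
  have s: "0 < s" "s\<^sup>2 = 2 * real n" using n by (auto simp: s_def)
  have e: "(\<integral>\<^sup>+y. ennreal (exp (v / s * y)) \<partial>std_normal) = ennreal (exp (v\<^sup>2 / (4 * real n)))" for v
    by (subst nn_integral_std_normal_exp) (simp add: power_divide s)
  have "ennreal (\<Sum>x\<in>sign_cube n. exp ((\<Sum>j<n. x j)\<^sup>2 / (4 * real n)))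
      = (\<Sum>x\<in>sign_cube n. \<integral>\<^sup>+y. ennreal (exp ((\<Sum>j<n. x j) / s * y)) \<partial>std_normal)"
    unfolding e by simp
  also have "\<dots> = (\<integral>\<^sup>+y. (\<Sum>x\<in>sign_cube n. ennreal (exp ((\<Sum>j<n. x j) / s * y))) \<partial>std_normal)"
    by (rule nn_integral_sum[symmetric]) measurable
  also have "\<dots> \<le> (\<integral>\<^sup>+y. ennreal (2 ^ n) * ennreal (exp (y\<^sup>2 / 4)) \<partial>std_normal)"
  proof (intro nn_integral_mono)
    fix y
    have "(\<Sum>x\<in>sign_cube n. exp ((\<Sum>j<n. x j) / s * y)) \<le> 2 ^ n * exp (real n * (y / s)\<^sup>2 / 2)"
      using sum_sign_cube_exp_le[where c = "y / s" and n = n] by (simp add: mult.commute)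
    also have "real n * (y / s)\<^sup>2 / 2 = y\<^sup>2 / 4" using s n by (simp add: power_divide)
    finally show "(\<Sum>x\<in>sign_cube n. ennreal (exp ((\<Sum>j<n. x j) / s * y))) \<le> ennreal (2 ^ n) * ennreal (exp (y\<^sup>2 / 4))"
      by (simp add: ennreal_mult[symmetric])
  qed
  also have "\<dots> = ennreal (2 ^ n) * ennreal (sqrt 2)"
    by (subst nn_integral_cmult) (auto simp: nn_integral_std_normal_exp_square)
  finally show ?thesis by (simp add: ennreal_mult[symmetric])
qed

subsection \<open>Decay of the correlations\<close>

text \<open>The number of monomials is at least (n / m)^m, by n^m <= m! N and m! <= m^m, and 27 =
  3^3 bounds e^3. The exponent 3 m suits radii r with r |x_1 + ... + x_n| <= m and n r^2 <= m, the
  two bounds secured by each later choice of r.\<close>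

lemma complete_hom_ratio_bound:
  assumes n: "0 < n" and r: "0 < r" and h: "\<bar>complete_hom m n x\<bar> * r ^ m \<le> exp (3 * real m)"
  shows "\<bar>complete_hom m n x\<bar> / real (card (multi_indices m n)) \<le> (27 * real m / (real n * r)) ^ m"
proof -
  define N where "N = real (card (multi_indices m n))"
  have N: "0 < N"
    using finite_multi_indices multi_indices_nonempty[OF n] by (auto simp: N_def card_gt_0_iff)
  have e3: "exp (3 * real m) \<le> 27 ^ m"
  proof -
    have "exp (3 * real m) = exp 1 ^ (3 * m)" by (simp add: exp_of_nat_mult[symmetric])
    also have "\<dots> \<le> 3 ^ (3 * m)" using exp_le by (intro power_mono) auto
    finally show ?thesis by (simp add: power_mult)
  qed
  have "\<bar>complete_hom m n x\<bar> * (real n * r) ^ m = (\<bar>complete_hom m n x\<bar> * r ^ m) * real n ^ m"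
    by (simp add: power_mult_distrib)
  also have "\<dots> \<le> 27 ^ m * (fact m * N)"
    using h e3 card_multi_indices_lower[of n m] unfolding N_def by (intro mult_mono) auto
  also have "\<dots> \<le> 27 ^ m * (real m ^ m * N)"
    using fact_le_power[of m, where 'a = real] N by (intro mult_left_mono mult_right_mono) auto
  finally have "\<bar>complete_hom m n x\<bar> * (real n * r) ^ m \<le> (27 * real m) ^ m * N"
    by (simp add: power_mult_distrib)
  then show ?thesis using N n r by (simp add: N_def[symmetric] power_divide field_simps)
qed

section \<open>Parity classes and the case of few variables\<close>

lemma even_parity_sum:
  "(\<Sum>x\<in>sign_cube n. \<Prod>j<n. x j ^ \<gamma> j) = (if \<forall>j<n. even (\<gamma> j) then 2 ^ n else 0)"
proof -
  have "(\<Sum>x\<in>sign_cube n. \<Prod>j<n. x j ^ \<gamma> j) = (\<Prod>j<n. (-1) ^ \<gamma> j + 1 ^ \<gamma> j :: real)"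
    by (rule sum_prod_sign_cube)
  also have "\<dots> = (\<Prod>j<n. if even (\<gamma> j) then 2 else 0)"
    by (rule prod.cong) auto
  also have "\<dots> = (if \<forall>j<n. even (\<gamma> j) then 2 ^ n else 0)"
  proof (cases "\<forall>j<n. even (\<gamma> j)")
    case True
    then have "(\<Prod>j<n. if even (\<gamma> j) then 2 else 0 :: real) = (\<Prod>j<n. 2)" by (intro prod.cong) auto
    then show ?thesis using True by simp
  next
    case False
    then have "(\<Prod>j<n. if even (\<gamma> j) then 2 else 0 :: real) = 0" by (intro prod_zero) auto
    then show ?thesis using False by simp
  qed
  finally show ?thesis .
qed

text \<open>With parities prescribed, a multi-index is determined by its halves, which form a
  multi-index of degree \<open>i\<close>, at most \<open>m div 2\<close>. The count is written with
  lower entry n - 1, where it is monotone in the degree.\<close>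

lemma card_parity_class:
  assumes n: "0 < n"
  shows "card {\<beta> \<in> multi_indices m n. \<forall>j<n. even (\<alpha> j + \<beta> j)} \<le> (m div 2 + (n - 1)) choose (n - 1)"
proof -
  define i where "i = (m - (\<Sum>j<n. \<alpha> j mod 2)) div 2"
  let ?P = "{\<beta> \<in> multi_indices m n. \<forall>j<n. even (\<alpha> j + \<beta> j)}"
  let ?f = "\<lambda>\<beta>. \<lambda>j\<in>{..<n}. \<beta> j div (2::nat)"
  have dec: "\<beta> j = 2 * (\<beta> j div 2) + \<alpha> j mod 2" if "\<beta> \<in> ?P" "j < n" for \<beta> j
  proof -
    have "even (\<alpha> j + \<beta> j)" using that by auto
    then have "\<alpha> j mod 2 = \<beta> j mod 2" by presburger
    then show ?thesis by simp
  qed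
  have "card ?P \<le> card (multi_indices i n)"
  proof (rule card_inj_on_le[where f = ?f])
    show "inj_on ?f ?P"
    proof (rule inj_onI)
      fix \<beta> \<gamma> assume P: "\<beta> \<in> ?P" "\<gamma> \<in> ?P" and eq: "?f \<beta> = ?f \<gamma>"
      have "\<beta> j = \<gamma> j" if j: "j < n" for j
      proof -
        have "\<beta> j div 2 = \<gamma> j div 2" using fun_cong[OF eq, of j] j by simp
        then show ?thesis using dec[OF P(1) j] dec[OF P(2) j] by simp
      qed
      then show "\<beta> = \<gamma>"
        using P by (intro extensionalityI[of \<beta> "{..<n}" \<gamma>]) (auto simp: multi_indices_def PiE_def)
    qed
    show "?f ` ?P \<subseteq> multi_indices i n"
    proof (rule image_subsetI)
      fix \<beta> assume P: "\<beta> \<in> ?P"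
      have "m = (\<Sum>j<n. \<beta> j)" using P by (simp add: multi_indices_def)
      also have "\<dots> = (\<Sum>j<n. 2 * (\<beta> j div 2) + \<alpha> j mod 2)"
        using dec[OF P] by (intro sum.cong) auto
      also have "\<dots> = 2 * (\<Sum>j<n. \<beta> j div 2) + (\<Sum>j<n. \<alpha> j mod 2)"
        by (simp only: sum.distrib sum_distrib_left)
      finally have "(\<Sum>j<n. \<beta> j div 2) = i" by (simp add: i_def)
      then show "?f \<beta> \<in> multi_indices i n" by (simp add: multi_indices_def)
    qed
  qed (rule finite_multi_indices)
  also have "\<dots> = (i + (n - 1)) choose (n - 1)"
    using n binomial_symmetric[of i "i + (n - 1)"] by (simp add: card_multi_indices)
  also have "\<dots> \<le> (m div 2 + (n - 1)) choose (n - 1)"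
    by (rule binomial_right_mono) (simp add: i_def div_le_mono)
  finally show ?thesis .
qed

text \<open>In the expanded square a monomial averages over the sign cube to one or zero, according
  to whether all its exponents are even. Each \<alpha> is therefore matched with its parity class
  only.\<close>

lemma sum_complete_hom_square_le:
  assumes n: "0 < n"
  shows "(\<Sum>x\<in>sign_cube n. (complete_hom m n x)\<^sup>2)
    \<le> 2 ^ n * (real (card (multi_indices m n)) * real ((m div 2 + (n - 1)) choose (n - 1)))"
proof -
  let ?M = "multi_indices m n"
  have "(\<Sum>x\<in>sign_cube n. (complete_hom m n x)\<^sup>2)
      = (\<Sum>x\<in>sign_cube n. \<Sum>\<alpha>\<in>?M. \<Sum>\<beta>\<in>?M. \<Prod>j<n. x j ^ (\<alpha> j + \<beta> j))"
    by (simp add: hom_poly_def power2_eq_square sum_product power_add prod.distrib)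
  also have "\<dots> = (\<Sum>\<alpha>\<in>?M. \<Sum>\<beta>\<in>?M. \<Sum>x\<in>sign_cube n. \<Prod>j<n. x j ^ (\<alpha> j + \<beta> j))"
    by (subst sum.swap, intro sum.cong refl, subst sum.swap) simp
  also have "\<dots> = (\<Sum>\<alpha>\<in>?M. 2 ^ n * real (card {\<beta> \<in> ?M. \<forall>j<n. even (\<alpha> j + \<beta> j)}))"
  proof (rule sum.cong[OF refl])
    fix \<alpha>
    have "(\<Sum>\<beta>\<in>?M. \<Sum>x\<in>sign_cube n. \<Prod>j<n. x j ^ (\<alpha> j + \<beta> j)) = (\<Sum>\<beta>\<in>?M. if \<forall>j<n. even (\<alpha> j + \<beta> j) then 2 ^ n else 0)"
      unfolding even_parity_sum ..
    also have "\<dots> = (\<Sum>\<beta>\<in>{\<beta> \<in> ?M. \<forall>j<n. even (\<alpha> j + \<beta> j)}. 2 ^ n)"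
      by (rule sum.inter_filter[symmetric]) (rule finite_multi_indices)
    finally show "(\<Sum>\<beta>\<in>?M. \<Sum>x\<in>sign_cube n. \<Prod>j<n. x j ^ (\<alpha> j + \<beta> j)) = 2 ^ n * real (card {\<beta> \<in> ?M. \<forall>j<n. even (\<alpha> j + \<beta> j)})"
      by simp
  qed
  also have "\<dots> \<le> (\<Sum>\<alpha>\<in>?M. 2 ^ n * real ((m div 2 + (n - 1)) choose (n - 1)))"
    by (intro sum_mono mult_left_mono of_nat_mono card_parity_class n) simp
  also have "\<dots> = 2 ^ n * (real (card ?M) * real ((m div 2 + (n - 1)) choose (n - 1)))" by simp
  finally show ?thesis .
qed

text \<open>The quotient of the binomials is a product of p factors (h + j) / (m + j). Each is at
  most (1/2 + A) / (1 + A), since h <= m / 2 and j <= A m.\<close>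

lemma binomial_ratio_le:
  assumes A: "0 < A" and h: "2 * h \<le> m"
  shows "real p \<le> A * real m \<Longrightarrow>
    real ((h + p) choose p) \<le> ((1 / 2 + A) / (1 + A)) ^ p * real ((m + p) choose p)"
proof (induction p)
  case (Suc p)
  define k where "k = (1 / 2 + A) / (1 + A)"
  have k: "k * (1 + A) = 1 / 2 + A" "0 < k" using A by (auto simp: k_def)
  have k1: "(1 - k) * (1 + A) = 1 / 2" using k(1) by (simp add: algebra_simps)
  then have k1': "0 \<le> 1 - k" using A by (metis add_pos_pos less_eq_real_def zero_less_divide_1_iff zero_less_mult_pos2 zero_less_numeral zero_less_one)
  have step: "real (Suc p) * real ((a + Suc p) choose Suc p) = real (a + Suc p) * real ((a + p) choose p)" for a
  proof -
    have "Suc p * ((a + Suc p) choose Suc p) = (a + Suc p) * ((a + p) choose p)"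
      using Suc_times_binomial_eq[of "a + p" p] by (simp only: add_Suc_right mult.commute)
    then show ?thesis by (simp only: of_nat_mult[symmetric])
  qed
  have "real (h + Suc p) \<le> k * real (m + Suc p)"
  proof -
    have "(1 - k) * real (Suc p) \<le> (1 - k) * (A * real m)"
      using Suc.prems k1' by (intro mult_left_mono) auto
    also have "\<dots> = ((1 - k) * A) * real m" by simp
    also have "(1 - k) * A = 1 / 2 - (1 - k)" using k1 by (simp add: algebra_simps)
    finally have "real m / 2 + real (Suc p) \<le> k * (real m + real (Suc p))" by (simp add: algebra_simps)
    moreover have "real h \<le> real m / 2" using h by linarith
    ultimately show ?thesis unfolding of_nat_add by linarith
  qed
  then have "real (h + Suc p) * real ((h + p) choose p) \<le> (k * real (m + Suc p)) * (k ^ p * real ((m + p) choose p))"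
    using Suc k(2) unfolding k_def[symmetric] by (intro mult_mono) auto
  also have "\<dots> = k ^ Suc p * (real (Suc p) * real ((m + Suc p) choose Suc p))"
    by (simp only: step[of m]) (simp add: mult_ac)
  finally have "real (Suc p) * real ((h + Suc p) choose Suc p) \<le> real (Suc p) * (k ^ Suc p * real ((m + Suc p) choose Suc p))"
    by (simp only: step[of h]) (simp add: mult_ac)
  then show ?case unfolding k_def[symmetric] by (rule mult_left_le_imp_le) simp
qed simp

text \<open>Cauchy-Schwarz on the second moment. The base is below 1, so the bound decays
  geometrically in \<open>n\<close>, uniformly over n <= A m.\<close>

lemma mean_abs_complete_hom_le:
  assumes n: "0 < n" and A: "0 < A" "real n \<le> A * real m"
  shows "(\<Sum>x\<in>sign_cube n. \<bar>complete_hom m n x\<bar> / real (card (multi_indices m n))) / 2 ^ n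
     \<le> sqrt (((1 / 2 + A) / (1 + A)) ^ (n - 1))"
proof (rule real_le_rsqrt)
  define N where "N = real (card (multi_indices m n))"
  define k where "k = (1 / 2 + A) / (1 + A)"
  have N: "0 < N"
    using finite_multi_indices multi_indices_nonempty[OF n] by (auto simp: N_def card_gt_0_iff)
  have Nb: "N = real ((m + (n - 1)) choose (n - 1))"
    using n binomial_symmetric[of m "m + (n - 1)"] by (simp add: N_def card_multi_indices)
  have "(\<Sum>x\<in>sign_cube n. \<bar>complete_hom m n x\<bar> * 1)\<^sup>2 \<le> (\<Sum>x\<in>sign_cube n. \<bar>complete_hom m n x\<bar>\<^sup>2) * (\<Sum>x\<in>sign_cube n. 1\<^sup>2)"
    by (rule Cauchy_Schwarz_ineq_sum)
  also have "\<dots> = (\<Sum>x\<in>sign_cube n. (complete_hom m n x)\<^sup>2) * 2 ^ n" by (simp add: card_sign_cube)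
  also have "\<dots> \<le> 2 ^ n * (N * real ((m div 2 + (n - 1)) choose (n - 1))) * 2 ^ n"
    unfolding N_def by (intro mult_right_mono sum_complete_hom_square_le n) simp
  also have "\<dots> \<le> 2 ^ n * (N * (k ^ (n - 1) * N)) * 2 ^ n"
    unfolding k_def using A N n
    by (intro mult_right_mono mult_left_mono, unfold Nb, intro binomial_ratio_le) auto
  finally have *: "(\<Sum>x\<in>sign_cube n. \<bar>complete_hom m n x\<bar>)\<^sup>2 \<le> k ^ (n - 1) * (2 ^ n * N)\<^sup>2"
    by (simp add: power2_eq_square mult_ac)
  have "((\<Sum>x\<in>sign_cube n. \<bar>complete_hom m n x\<bar> / N) / 2 ^ n)\<^sup>2 = (\<Sum>x\<in>sign_cube n. \<bar>complete_hom m n x\<bar>)\<^sup>2 / (2 ^ n * N)\<^sup>2"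
    by (simp add: sum_divide_distrib[symmetric] power_divide power_mult_distrib mult.commute)
  also have "\<dots> \<le> k ^ (n - 1)" using * N by (simp add: divide_le_eq)
  finally show "((\<Sum>x\<in>sign_cube n. \<bar>complete_hom m n x\<bar> / real (card (multi_indices m n))) / 2 ^ n)\<^sup>2
     \<le> ((1 / 2 + A) / (1 + A)) ^ (n - 1)" by (simp add: N_def k_def)
qed

lemma exp_le_linear:
  assumes "\<bar>u\<bar> \<le> B"
  shows "exp u \<le> 1 + \<bar>u\<bar> * exp (B::real)"
proof (cases "0 \<le> u")
  case True
  have "1 - u \<le> exp (- u)" using exp_ge_add_one_self[of "- u"] by simp
  then have "(1 - u) * exp u \<le> exp (- u) * exp u" by (intro mult_right_mono) auto
  then have "exp u - 1 \<le> u * exp u" by (simp add: exp_minus algebra_simps)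
  also have "\<dots> \<le> u * exp B" using True assms by (intro mult_left_mono) auto
  finally show ?thesis using True by simp
next
  case False
  then have "exp u \<le> 1" by simp
  also have "1 \<le> 1 + \<bar>u\<bar> * exp B" by simp
  finally show ?thesis .
qed

text \<open>For n <= A m the coefficient in the exponent is at most B = C (1 + A). As |h_m| <= N on
  sign vectors, the exponential can be linearised at the fixed cost exp B.\<close>

lemma mean_exp_correlation_few_variables:
  assumes n: "0 < n" and A: "0 < A" "real n \<le> A * real m" and C: "0 < C"
  shows "(\<Sum>x\<in>sign_cube n. exp (C * (1 + real n / real m) * (complete_hom m n x / real (card (multi_indices m n))))) / 2 ^ n
    \<le> 1 + C * (1 + A) * exp (C * (1 + A)) * sqrt (((1 / 2 + A) / (1 + A)) ^ (n - 1))"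
proof -
  define N where "N = real (card (multi_indices m n))"
  define B where "B = C * (1 + A)"
  have N: "0 < N"
    using finite_multi_indices multi_indices_nonempty[OF n] by (auto simp: N_def card_gt_0_iff)
  have m: "0 < m" using A n by (cases "m = 0") auto
  have B: "0 < B" using A C by (simp add: B_def)
  have lB: "C * (1 + real n / real m) \<le> B"
    unfolding B_def using A C m by (intro mult_left_mono add_left_mono) (auto simp: divide_le_eq)
  have "exp (C * (1 + real n / real m) * (complete_hom m n x / N)) \<le> 1 + B * exp B * (\<bar>complete_hom m n x\<bar> / N)"
    if x: "x \<in> sign_cube n" for x
  proof -
    define u where "u = C * (1 + real n / real m) * (complete_hom m n x / N)"
    have au: "\<bar>u\<bar> = C * (1 + real n / real m) * (\<bar>complete_hom m n x\<bar> / N)"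
      using C N by (simp add: u_def abs_mult)
    also have "\<dots> \<le> B * (\<bar>complete_hom m n x\<bar> / N)"
      using lB N by (intro mult_right_mono) auto
    finally have u1: "\<bar>u\<bar> \<le> B * (\<bar>complete_hom m n x\<bar> / N)" .
    also have "\<dots> \<le> B * 1"
      using complete_hom_le_card[OF x, of m] N B unfolding N_def by (intro mult_left_mono) auto
    finally have "exp u \<le> 1 + \<bar>u\<bar> * exp B" by (intro exp_le_linear) simp
    also have "\<bar>u\<bar> * exp B \<le> B * (\<bar>complete_hom m n x\<bar> / N) * exp B" using u1 by (intro mult_right_mono) auto
    finally show ?thesis by (simp add: u_def mult_ac)
  qed
  then have "(\<Sum>x\<in>sign_cube n. exp (C * (1 + real n / real m) * (complete_hom m n x / N)))
      \<le> (\<Sum>x\<in>sign_cube n. 1 + B * exp B * (\<bar>complete_hom m n x\<bar> / N))" by (rule sum_mono)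
  also have "\<dots> = 2 ^ n + B * exp B * (\<Sum>x\<in>sign_cube n. \<bar>complete_hom m n x\<bar> / N)"
    unfolding sum.distrib sum_distrib_left by (simp add: card_sign_cube)
  finally have "(\<Sum>x\<in>sign_cube n. exp (C * (1 + real n / real m) * (complete_hom m n x / N))) / 2 ^ n
    \<le> (2 ^ n + B * exp B * (\<Sum>x\<in>sign_cube n. \<bar>complete_hom m n x\<bar> / N)) / 2 ^ n"
    by (intro divide_right_mono) auto
  also have "\<dots> = 1 + B * exp B * ((\<Sum>x\<in>sign_cube n. \<bar>complete_hom m n x\<bar> / N) / 2 ^ n)"
    by (simp add: add_divide_distrib)
  also have "\<dots> \<le> 1 + B * exp B * sqrt (((1 / 2 + A) / (1 + A)) ^ (n - 1))"
    unfolding N_def using B by (intro add_left_mono mult_left_mono mean_abs_complete_hom_le n A) auto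
  finally show ?thesis unfolding N_def B_def .
qed

text \<open>A sum of signs of modulus at least \<open>sqrt (m n)\<close> is so rare that the exponential is absorbed
  by its sub-Gaussian tail; for the remaining points the correlation itself is tiny.\<close>

lemma mean_exp_correlation_many_variables:
  assumes m: "2 \<le> m" "11664 * C \<le> real m" and n: "2916 * real m \<le> real n" and C: "0 < C"
  shows "(\<Sum>x\<in>sign_cube n. exp (C * (1 + real n / real m) * (complete_hom m n x / real (card (multi_indices m n))))) / 2 ^ n
    \<le> exp (5832 * C * (1 / 2) ^ m) + sqrt 2 * exp (- real m / 8)"
proof -
  define N where "N = real (card (multi_indices m n))"
  have m0: "0 < real m" using m by simp
  have n0: "0 < n" using m0 n by (cases "n = 0") auto
  have N: "0 < N"
    using finite_multi_indices multi_indices_nonempty[OF n0] by (auto simp: N_def card_gt_0_iff)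
  have lC: "C * (1 + real n / real m) \<le> 2 * C * (real n / real m)"
  proof -
    have "1 \<le> real n / real m" using m0 n by simp
    then have "C * (1 + real n / real m) \<le> C * (2 * (real n / real m))" using C by (intro mult_left_mono) auto
    then show ?thesis by simp
  qed
  have "exp (C * (1 + real n / real m) * (complete_hom m n x / N))
      \<le> exp (5832 * C * (1 / 2) ^ m) + exp (- real m / 8) * exp ((\<Sum>j<n. x j)\<^sup>2 / (4 * real n))"
    (is "exp ?u \<le> _") if x: "x \<in> sign_cube n" for x
  proof -
    define d where "d = \<bar>\<Sum>j<n. x j\<bar>"
    have d2: "(\<Sum>j<n. x j)\<^sup>2 = d\<^sup>2" by (simp add: d_def)
    define \<rho> where "\<rho> = \<bar>complete_hom m n x\<bar> / N"
    have \<rho>1: "\<rho> \<le> 1" using complete_hom_le_card[OF x, of m] N by (simp add: \<rho>_def N_def)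
    have \<rho>0: "0 \<le> \<rho>" using N by (simp add: \<rho>_def)
    have "?u \<le> C * (1 + real n / real m) * \<rho>"
      using C N by (intro mult_left_mono) (auto simp: \<rho>_def divide_right_mono)
    also have "\<dots> \<le> 2 * C * (real n / real m) * \<rho>" using lC \<rho>0 by (intro mult_right_mono)
    finally have u: "?u \<le> 2 * C * (real n / real m) * \<rho>" .
    show ?thesis
    proof (cases "real m * real n \<le> d\<^sup>2")
      case True
      have "(2 * real m)\<^sup>2 \<le> real m * real n"
      proof -
        have "real m * (4 * real m) \<le> real m * real n" using n m0 by (intro mult_left_mono) auto
        then show ?thesis by (simp add: power2_eq_square)
      qed
      also note True
      finally have d2m: "2 * real m \<le> d" using abs_le_square_iff[of "2 * real m" d] by (simp add: d_def)
      then have d0: "0 < d" using m0 by simp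
      \<comment> \<open>This radius balances the estimate: r d = m, while n r^2 <= m by the case
        assumption. It is at most 1/2 because 2 m <= d.\<close>
      define r where "r = real m / d"
      have r: "0 < r" "r \<le> 1 / 2" using d0 d2m m0 by (auto simp: r_def field_simps)
      have "real n * r\<^sup>2 \<le> real m"
      proof -
        have "real n * r\<^sup>2 = real m * (real m * real n) / d\<^sup>2" by (simp add: r_def power_divide power2_eq_square)
        also have "\<dots> \<le> real m * d\<^sup>2 / d\<^sup>2" using True m0 by (intro divide_right_mono mult_left_mono) auto
        finally show ?thesis using d0 by simp
      qed
      moreover have "r * d = real m" using d0 by (simp add: r_def)
      ultimately have "r * d + 2 * real n * r\<^sup>2 \<le> 3 * real m" by simp
      then have "\<bar>complete_hom m n x\<bar> * r ^ m \<le> exp (3 * real m)"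
        using complete_hom_bound[OF n0 x less_imp_le[OF r(1)] r(2), of m]
        unfolding d_def[symmetric] by (meson exp_le_cancel_iff order_trans)
      from complete_hom_ratio_bound[OF n0 r(1) this]
      have "\<rho> \<le> (27 * real m / (real n * r)) ^ m" by (simp add: \<rho>_def N_def)
      also have "27 * real m / (real n * r) = 27 * d / real n" using m0 d0 by (simp add: r_def)
      finally have \<rho>m: "\<rho> \<le> (27 * d / real n) ^ m" .
      \<comment> \<open>Only a square is kept: m >= 2 permits it if the base is at most 1, and
        otherwise \<rho> <= 1 suffices. A bound quadratic in \<open>d\<close> is what the
        sub-Gaussian tail can absorb.\<close>
      have "\<rho> \<le> (27 * d / real n)\<^sup>2"
      proof (cases "27 * d / real n \<le> 1")
        case True
        then have "(27 * d / real n) ^ m \<le> (27 * d / real n)\<^sup>2" using m d0 by (intro power_decreasing) auto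
        with \<rho>m show ?thesis by simp
      next
        case False
        then have "1 \<le> (27 * d / real n)\<^sup>2" by (intro one_le_power) auto
        with \<rho>1 show ?thesis by simp
      qed
      then have "2 * C * (real n / real m) * \<rho> \<le> 2 * C * (real n / real m) * (27 * d / real n)\<^sup>2"
        using C by (intro mult_left_mono) auto
      \<comment> \<open>11664 = 8 * 2 * 27^2. With m >= 11664 C there remains d^2 / (8 n), half of
        the exponent handled by \<open>sum_sign_cube_exp_square_le\<close>; the other half is at
        least m / 8 and pays for the factor exp (- m / 8).\<close>
      also have "\<dots> = (11664 * C) * (d\<^sup>2 / (8 * real n * real m))"
        using n0 m0 by (simp add: power2_eq_square field_simps)
      also have "\<dots> \<le> real m * (d\<^sup>2 / (8 * real n * real m))"
        using m by (intro mult_right_mono) auto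
      also have "\<dots> = d\<^sup>2 / (8 * real n)" using m0 by simp
      also have "\<dots> \<le> - real m / 8 + d\<^sup>2 / (4 * real n)"
      proof -
        have "real m \<le> d\<^sup>2 / real n" using True n0 by (simp add: field_simps)
        then show ?thesis by simp
      qed
      finally have "?u \<le> - real m / 8 + d\<^sup>2 / (4 * real n)" using u by simp
      then have "exp ?u \<le> exp (- real m / 8) * exp (d\<^sup>2 / (4 * real n))"
        unfolding exp_add[symmetric] by (simp only: exp_le_cancel_iff)
      then show ?thesis unfolding d2 by (meson add_increasing exp_ge_zero)
    next
      case False
      \<comment> \<open>The radius m / d would be too large for small \<open>d\<close>. This one
        gives n r^2 = m and still r d <= m; the threshold 2916 = 54^2 makes 27 r <= 1/2.\<close>
      define r where "r = sqrt (real m / real n)"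
      have r2: "r\<^sup>2 = real m / real n" by (simp add: r_def)
      have r0: "0 < r" using m0 n0 by (simp add: r_def)
      have r54: "r \<le> 1 / 54"
      proof -
        have "r\<^sup>2 \<le> (1 / 54)\<^sup>2" unfolding r2 using n n0 by (simp add: power2_eq_square field_simps)
        then show ?thesis using power2_le_imp_le[of r "1 / 54"] by simp
      qed
      have "r * d \<le> real m"
      proof (rule power2_le_imp_le)
        have "(r * d)\<^sup>2 = real m / real n * d\<^sup>2" by (simp add: power_mult_distrib r2)
        also have "\<dots> \<le> real m / real n * (real m * real n)" using False by (intro mult_left_mono) auto
        also have "\<dots> = (real m)\<^sup>2" using n0 by (simp add: power2_eq_square)
        finally show "(r * d)\<^sup>2 \<le> (real m)\<^sup>2" .
      qed simp
      moreover have "real n * r\<^sup>2 = real m" using n0 by (simp add: r2)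
      ultimately have "r * d + 2 * real n * r\<^sup>2 \<le> 3 * real m" by simp
      then have "\<bar>complete_hom m n x\<bar> * r ^ m \<le> exp (3 * real m)"
        using complete_hom_bound[OF n0 x less_imp_le[OF r0], of m] r54
        unfolding d_def[symmetric] by (simp, meson exp_le_cancel_iff order_trans)
      from complete_hom_ratio_bound[OF n0 r0 this]
      have "\<rho> \<le> (27 * real m / (real n * r)) ^ m" by (simp add: \<rho>_def N_def)
      also have "27 * real m / (real n * r) = 27 * r"
      proof -
        have "real m = r * (real n * r)" using n0 r2 by (simp add: power2_eq_square field_simps)
        then show ?thesis using n0 r0 by simp
      qed
      finally have \<rho>m: "\<rho> \<le> (27 * r) ^ m" .
      have "2 * C * (real n / real m) * \<rho> \<le> 2 * C * (real n / real m) * (27 * r) ^ m"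
        using \<rho>m C by (intro mult_left_mono) auto
      \<comment> \<open>Two factors are split off to cancel n / m; the other m - 2 give geometric
        decay. The constant becomes 5832 = 2 * 729 * 4.\<close>
      also have "(27 * r) ^ m = (27 * r) ^ (2 + (m - 2))"
        by (subst le_add_diff_inverse) (use m in simp_all)
      also have "\<dots> = (27 * r)\<^sup>2 * (27 * r) ^ (m - 2)" by (rule power_add)
      also have "(27 * r)\<^sup>2 = 729 * (real m / real n)" by (simp add: power_mult_distrib r2)
      also have "2 * C * (real n / real m) * (729 * (real m / real n) * (27 * r) ^ (m - 2)) = 1458 * C * (27 * r) ^ (m - 2)"
        using m0 n0 by simp
      also have "\<dots> \<le> 1458 * C * (1 / 2) ^ (m - 2)"
        using C r0 r54 by (intro mult_left_mono power_mono) auto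
      also have "(1 / 2 :: real) ^ (m - 2) = 4 * (1 / 2) ^ m"
        using m by (simp add: power_diff power2_eq_square)
      finally have "?u \<le> 5832 * C * (1 / 2) ^ m" using u by simp
      then have "exp ?u \<le> exp (5832 * C * (1 / 2) ^ m)" by (simp only: exp_le_cancel_iff)
      then show ?thesis by (simp add: add_increasing2)
    qed
  qed
  then have "(\<Sum>x\<in>sign_cube n. exp (C * (1 + real n / real m) * (complete_hom m n x / N)))
     \<le> (\<Sum>x\<in>sign_cube n. exp (5832 * C * (1 / 2) ^ m) + exp (- real m / 8) * exp ((\<Sum>j<n. x j)\<^sup>2 / (4 * real n)))"
    by (rule sum_mono)
  also have "\<dots> = 2 ^ n * exp (5832 * C * (1 / 2) ^ m) + exp (- real m / 8) * (\<Sum>x\<in>sign_cube n. exp ((\<Sum>j<n. x j)\<^sup>2 / (4 * real n)))"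
    unfolding sum.distrib sum_distrib_left by (simp add: card_sign_cube)
  also have "\<dots> \<le> 2 ^ n * exp (5832 * C * (1 / 2) ^ m) + exp (- real m / 8) * (2 ^ n * sqrt 2)"
    by (intro add_left_mono mult_left_mono sum_sign_cube_exp_square_le n0) simp
  also have "\<dots> = (exp (5832 * C * (1 / 2) ^ m) + sqrt 2 * exp (- real m / 8)) * 2 ^ n"
    by (simp add: algebra_simps)
  finally show ?thesis unfolding N_def by (simp add: divide_le_eq)
qed

lemma mean_exp_correlation:
  assumes C: "0 < C" and \<eta>: "0 < \<eta>"
  obtains M where "\<And>m n. M \<le> m \<Longrightarrow> M \<le> n \<Longrightarrow>
    (\<Sum>x\<in>sign_cube n. exp (C * (1 + real n / real m) * (complete_hom m n x / real (card (multi_indices m n))))) / 2 ^ n \<le> 1 + \<eta>"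
proof -
  \<comment> \<open>The estimate for few variables holds for any positive \<open>A\<close>; this
    value is where the one for many variables takes over.\<close>
  define A :: real where "A = 2916"
  define k where "k = (1 / 2 + A) / (1 + A)"
  have "(\<lambda>n. 1 + C * (1 + A) * exp (C * (1 + A)) * sqrt (k ^ (n - 1))) \<longlonglongrightarrow> 1 + C * (1 + A) * exp (C * (1 + A)) * sqrt 0"
  proof (intro tendsto_intros)
    have "(\<lambda>n. k ^ n) \<longlonglongrightarrow> 0" by (rule LIMSEQ_power_zero) (simp add: k_def A_def)
    then show "(\<lambda>n. k ^ (n - 1)) \<longlonglongrightarrow> 0"
      by (rule filterlim_compose) real_asymp
  qed
  then have "\<forall>\<^sub>F n in sequentially. 1 + C * (1 + A) * exp (C * (1 + A)) * sqrt (k ^ (n - 1)) < 1 + \<eta>"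
    by (rule order_tendstoD) (use \<eta> in simp)
  then obtain M1 where M1: "\<And>n. M1 \<le> n \<Longrightarrow> 1 + C * (1 + A) * exp (C * (1 + A)) * sqrt (k ^ (n - 1)) < 1 + \<eta>"
    by (auto simp: eventually_sequentially)
  have "(\<lambda>m::nat. exp (5832 * C * (1 / 2) ^ m) + sqrt 2 * exp (- real m / 8)) \<longlonglongrightarrow> 1"
    by real_asymp
  then have "\<forall>\<^sub>F m in sequentially. exp (5832 * C * (1 / 2) ^ m) + sqrt 2 * exp (- real m / 8) < 1 + \<eta>"
    by (rule order_tendstoD) (use \<eta> in simp)
  then obtain M2 where M2: "\<And>m. M2 \<le> m \<Longrightarrow> exp (5832 * C * (1 / 2) ^ m) + sqrt 2 * exp (- real m / 8) < 1 + \<eta>"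
    by (auto simp: eventually_sequentially)
  define M where "M = Max {M1, M2, 2, nat \<lceil>11664 * C\<rceil>}"
  have M: "M1 \<le> M" "M2 \<le> M" "2 \<le> M" "nat \<lceil>11664 * C\<rceil> \<le> M"
    unfolding M_def by (rule Max_ge; simp)+
  show thesis
  proof (rule that)
    fix m n assume mn: "M \<le> m" "M \<le> n"
    show "(\<Sum>x\<in>sign_cube n. exp (C * (1 + real n / real m) * (complete_hom m n x / real (card (multi_indices m n))))) / 2 ^ n \<le> 1 + \<eta>"
    proof (cases "real n \<le> A * real m")
      case True
      have "(\<Sum>x\<in>sign_cube n. exp (C * (1 + real n / real m) * (complete_hom m n x / real (card (multi_indices m n))))) / 2 ^ n
        \<le> 1 + C * (1 + A) * exp (C * (1 + A)) * sqrt (k ^ (n - 1))"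
        unfolding k_def using True mn M by (intro mean_exp_correlation_few_variables C) (auto simp: A_def)
      also have "\<dots> \<le> 1 + \<eta>" using M1[of n] mn M by simp
      finally show ?thesis .
    next
      case False
      have "11664 * C \<le> real m" using M(4) mn by linarith
      then have "(\<Sum>x\<in>sign_cube n. exp (C * (1 + real n / real m) * (complete_hom m n x / real (card (multi_indices m n))))) / 2 ^ n
        \<le> exp (5832 * C * (1 / 2) ^ m) + sqrt 2 * exp (- real m / 8)"
        using False mn M by (intro mean_exp_correlation_many_variables C) (auto simp: A_def)
      also have "\<dots> \<le> 1 + \<eta>" using M2[of m] mn M by simp
      finally show ?thesis .
    qed
  qed
qed

subsection \<open>A multi-parameter maximal inequality\<close>

text \<open>Quasiconvexity is enough for the midpoint step of the reflection and for summation by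
  parts, and it passes to maxima. The first clause frees the argument from being extensional, as
  truncations and combinations need not be.\<close>

definition convex_stat :: "'i set \<Rightarrow> (('i \<Rightarrow> real) \<Rightarrow> real) \<Rightarrow> bool" where
  "convex_stat I V \<longleftrightarrow>
     (\<forall>g h. (\<forall>i\<in>I. g i = h i) \<longrightarrow> V g = V h) \<and>
     (\<forall>(K :: nat set) w f c. finite K \<longrightarrow> (\<forall>k\<in>K. 0 \<le> w k \<and> V (f k) \<le> c) \<longrightarrow> sum w K = 1 \<longrightarrow>
        V (\<lambda>i. \<Sum>k\<in>K. w k * f k i) \<le> c) \<and>
     V \<in> borel_measurable (gauss I)"

lemma convex_stat_cong: "convex_stat I V \<Longrightarrow> (\<And>i. i \<in> I \<Longrightarrow> g i = h i) \<Longrightarrow> V g = V h"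
  by (auto simp: convex_stat_def)

lemma convex_stat_convex:
  fixes K :: "nat set"
  assumes V: "convex_stat I V" and K: "finite K" and w: "\<And>k. k \<in> K \<Longrightarrow> 0 \<le> w k"
    and f: "\<And>k. k \<in> K \<Longrightarrow> V (f k) \<le> c" and sum: "sum w K = 1"
  shows "V (\<lambda>i. \<Sum>k\<in>K. w k * f k i) \<le> c"
proof -
  from V have "\<forall>(K :: nat set) w f c. finite K \<longrightarrow> (\<forall>k\<in>K. 0 \<le> w k \<and> V (f k) \<le> c) \<longrightarrow> sum w K = 1 \<longrightarrow>
        V (\<lambda>i. \<Sum>k\<in>K. w k * f k i) \<le> c"
    unfolding convex_stat_def by (elim conjE)
  from this[rule_format, OF K _ sum, of f c] w f show ?thesis by simp
qed

lemma convex_stat_measurable: "convex_stat I V \<Longrightarrow> V \<in> borel_measurable (gauss I)"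
  by (simp add: convex_stat_def)

lemma convex_stat_measurable_mult:
  assumes V: "convex_stat I V"
  shows "(\<lambda>g. V (\<lambda>i. \<phi> i * g i)) \<in> borel_measurable (gauss I)"
proof -
  have "(\<lambda>g. V (\<lambda>i\<in>I. \<phi> i * g i)) \<in> borel_measurable (gauss I)"
    by (rule measurable_compose[OF flip_measurable convex_stat_measurable[OF V]])
  also have "(\<lambda>g. V (\<lambda>i\<in>I. \<phi> i * g i)) = (\<lambda>g. V (\<lambda>i. \<phi> i * g i))"
    by (intro ext convex_stat_cong[OF V]) simp
  finally show ?thesis .
qed

definition trunc_at :: "('i \<Rightarrow> nat) \<Rightarrow> nat \<Rightarrow> ('i \<Rightarrow> real) \<Rightarrow> 'i \<Rightarrow> real" where
  "trunc_at c k g = (\<lambda>i. of_bool (c i \<le> k) * g i)"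

text \<open>For one variable y, \<open>c i\<close> is its exponent in the monomial \<open>i\<close>
  and \<open>s\<close> its sign, as y^c = s^c |y|^c; \<open>k\<close> is the cutoff of a partial sum
  in that exponent.\<close>

definition sup_stat :: "('i \<Rightarrow> nat) \<Rightarrow> nat \<Rightarrow> (('i \<Rightarrow> real) \<Rightarrow> real) \<Rightarrow> ('i \<Rightarrow> real) \<Rightarrow> real" where
  "sup_stat c m V g = Max ((\<lambda>(s, k). V (trunc_at c k (\<lambda>i. s ^ c i * g i))) ` ({-1, 1} \<times> {..m}))"

lemma sup_stat_ge: "s \<in> {-1, 1} \<Longrightarrow> k \<le> m \<Longrightarrow> V (trunc_at c k (\<lambda>i. s ^ c i * g i)) \<le> sup_stat c m V g"
  unfolding sup_stat_def by (intro Max_ge) auto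

lemma sup_stat_le_iff: "sup_stat c m V g \<le> t \<longleftrightarrow> (\<forall>s\<in>{-1, 1}. \<forall>k\<le>m. V (trunc_at c k (\<lambda>i. s ^ c i * g i)) \<le> t)"
  unfolding sup_stat_def by (subst Max_le_iff) auto

text \<open>Truncations and sign changes are linear, and a sublevel set of a maximum is an
  intersection of sublevel sets. Hence the construction can be iterated.\<close>

lemma convex_stat_sup_stat:
  assumes V: "convex_stat I V"
  shows "convex_stat I (sup_stat c m V)"
  unfolding convex_stat_def
proof (intro conjI allI impI)
  fix g h :: "'a \<Rightarrow> real" assume "\<forall>i\<in>I. g i = h i"
  then have "V (trunc_at c k (\<lambda>i. s ^ c i * g i)) = V (trunc_at c k (\<lambda>i. s ^ c i * h i))" for s k
    by (intro convex_stat_cong[OF V]) (simp add: trunc_at_def)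
  then show "sup_stat c m V g = sup_stat c m V h" by (simp add: sup_stat_def)
next
  fix K :: "nat set" and w :: "nat \<Rightarrow> real" and f t
  assume K: "finite K" "sum w K = 1" and f: "\<forall>k\<in>K. 0 \<le> w k \<and> sup_stat c m V (f k) \<le> t"
  show "sup_stat c m V (\<lambda>i. \<Sum>k\<in>K. w k * f k i) \<le> t"
    unfolding sup_stat_le_iff
  proof (intro ballI allI impI)
    fix s k assume s: "s \<in> {-1, 1 :: real}" and k: "k \<le> m"
    have "V (trunc_at c k (\<lambda>i. s ^ c i * (\<Sum>l\<in>K. w l * f l i))) = V (\<lambda>i. \<Sum>l\<in>K. w l * trunc_at c k (\<lambda>i. s ^ c i * f l i) i)"
      by (intro convex_stat_cong[OF V]) (simp add: trunc_at_def sum_distrib_left mult_ac)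
    also have "\<dots> \<le> t"
      using f s k by (intro convex_stat_convex[OF V] K) (auto simp: sup_stat_le_iff)
    finally show "V (trunc_at c k (\<lambda>i. s ^ c i * (\<Sum>l\<in>K. w l * f l i))) \<le> t" .
  qed
next
  have "(\<lambda>g. V (trunc_at c k (\<lambda>i. s ^ c i * g i))) \<in> borel_measurable (gauss I)" for s k
    using convex_stat_measurable_mult[OF V, of "\<lambda>i. of_bool (c i \<le> k) * s ^ c i"]
    by (simp add: trunc_at_def mult.assoc)
  then show "sup_stat c m V \<in> borel_measurable (gauss I)"
    unfolding sup_stat_def[abs_def] by (intro borel_measurable_Max) auto
qed

text \<open>Levy's inequality: conditionally on the first index where the truncation exceeds the level,
  reflecting the remaining coordinates preserves the Gaussian measure, and the truncation is the
  midpoint of the vector and its reflection.\<close>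

lemma levy_cut:
  fixes I :: "'i set"
  assumes I: "finite I" and V: "convex_stat I V" and c: "\<And>i. i \<in> I \<Longrightarrow> c i \<le> m"
  shows "measure (gauss I) {g \<in> space (gauss I). \<exists>k\<le>m. t < V (trunc_at c k g)} \<le> 2 * measure (gauss I) {g \<in> space (gauss I). t < V g}"
proof -
  interpret prob_space "gauss I" by (rule prob_space_gauss)
  let ?S = "space (gauss I)"
  define A where "A k g \<longleftrightarrow> t < V (trunc_at c k g) \<and> (\<forall>j<k. V (trunc_at c j g) \<le> t)" for k g
  have Vm[measurable]: "V \<in> borel_measurable (gauss I)" by (rule convex_stat_measurable[OF V])
  have cm[measurable]: "(\<lambda>g. V (trunc_at c k g)) \<in> borel_measurable (gauss I)" for k
    unfolding trunc_at_def by (rule convex_stat_measurable_mult[OF V])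
  have Am: "{g \<in> ?S. A k g} \<in> events" "{g \<in> ?S. A k g \<and> t < V g} \<in> events" for k
    unfolding A_def by measurable
  have step: "prob {g \<in> ?S. A k g} \<le> 2 * prob {g \<in> ?S. A k g \<and> t < V g}" for k
  proof -
    define s where "s i = (if c i \<le> k then 1 else -1 :: real)" for i
    let ?T = "\<lambda>g. \<lambda>i\<in>I. s i * g i"
    have s: "\<bar>s i\<bar> = 1" for i by (simp add: s_def)
    \<comment> \<open>\<open>A k\<close> looks only at coordinates with \<open>c i \<le> k\<close>,
      which the flip leaves alone. The event is therefore invariant under the reflection.\<close>
    have cutT: "V (trunc_at c j (?T g)) = V (trunc_at c j g)" if "j \<le> k" for j g
      using that by (intro convex_stat_cong[OF V]) (auto simp: trunc_at_def s_def)
    have AT: "A k (?T g) \<longleftrightarrow> A k g" for g by (simp add: A_def cutT)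
    have "t < V g \<or> t < V (?T g)" if "A k g" for g
    proof (rule ccontr)
      assume n: "\<not> ?thesis"
      define f where "f l = (if l = (0::nat) then g else ?T g)" for l
      have "V (\<lambda>i. \<Sum>l\<in>{0, 1}. 1 / 2 * f l i) \<le> t"
        using n by (intro convex_stat_convex[OF V]) (auto simp: f_def)
      moreover have "V (\<lambda>i. \<Sum>l\<in>{0, 1}. 1 / 2 * f l i) = V (trunc_at c k g)"
        by (intro convex_stat_cong[OF V]) (simp add: f_def s_def trunc_at_def)
      ultimately show False using that by (simp add: A_def)
    qed
    then have "{g \<in> ?S. A k g} \<subseteq> {g \<in> ?S. A k g \<and> t < V g} \<union> {g \<in> ?S. A k (?T g) \<and> t < V (?T g)}"
      by (auto simp: AT)
    then have "prob {g \<in> ?S. A k g} \<le> prob ({g \<in> ?S. A k g \<and> t < V g} \<union> {g \<in> ?S. A k (?T g) \<and> t < V (?T g)})"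
      by (rule finite_measure_mono) (intro sets.Un Am measure_gauss_flip(1)[OF I s])
    also have "\<dots> \<le> prob {g \<in> ?S. A k g \<and> t < V g} + prob {g \<in> ?S. A k (?T g) \<and> t < V (?T g)}"
      by (intro measure_Un_le Am measure_gauss_flip(1)[OF I s])
    also have "prob {g \<in> ?S. A k (?T g) \<and> t < V (?T g)} = prob {g \<in> ?S. A k g \<and> t < V g}"
      by (rule measure_gauss_flip(2)[OF I s Am(2)])
    finally show ?thesis by simp
  qed
  have disj: "disjoint_family_on (\<lambda>k. {g \<in> ?S. A k g \<and> Q g}) {..m}" for Q
  proof (unfold disjoint_family_on_def, intro ballI impI)
    fix j k :: nat assume "j \<noteq> k"
    then have "j < k \<or> k < j" by auto
    then have "\<not> (A j g \<and> A k g)" for g by (auto simp: A_def not_le)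
    then show "{g \<in> ?S. A j g \<and> Q g} \<inter> {g \<in> ?S. A k g \<and> Q g} = {}" by auto
  qed
  have "{g \<in> ?S. \<exists>k\<le>m. t < V (trunc_at c k g)} \<subseteq> (\<Union>k\<le>m. {g \<in> ?S. A k g})"
  proof
    fix g assume "g \<in> {g \<in> ?S. \<exists>k\<le>m. t < V (trunc_at c k g)}"
    then have g: "g \<in> ?S" "\<exists>k. k \<le> m \<and> t < V (trunc_at c k g)" by auto
    define k where "k = (LEAST k. k \<le> m \<and> t < V (trunc_at c k g))"
    have k: "k \<le> m" "t < V (trunc_at c k g)" using LeastI_ex[OF g(2)] by (auto simp: k_def)
    moreover have "V (trunc_at c j g) \<le> t" if "j < k" for j
      using not_less_Least[of j "\<lambda>k. k \<le> m \<and> t < V (trunc_at c k g)"] that k(1) by (auto simp: k_def[symmetric] not_less)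
    ultimately show "g \<in> (\<Union>k\<le>m. {g \<in> ?S. A k g})" using g by (auto simp: A_def)
  qed
  then have "prob {g \<in> ?S. \<exists>k\<le>m. t < V (trunc_at c k g)} \<le> prob (\<Union>k\<le>m. {g \<in> ?S. A k g})"
    by (rule finite_measure_mono) (use Am in auto)
  also have "\<dots> = (\<Sum>k\<le>m. prob {g \<in> ?S. A k g})"
    using disj[of "\<lambda>_. True"] Am by (intro finite_measure_finite_Union) auto
  also have "\<dots> \<le> (\<Sum>k\<le>m. 2 * prob {g \<in> ?S. A k g \<and> t < V g})" by (intro sum_mono step)
  also have "\<dots> = 2 * prob (\<Union>k\<le>m. {g \<in> ?S. A k g \<and> t < V g})"
    using disj[of "\<lambda>g. t < V g"] Am unfolding sum_distrib_left[symmetric]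
    by (subst finite_measure_finite_Union) auto
  also have "\<dots> \<le> 2 * prob {g \<in> ?S. t < V g}"
    by (intro mult_left_mono finite_measure_mono) auto
  finally show ?thesis .
qed

text \<open>A factor 2 for the two signs, which preserve the Gaussian measure, times the factor 2 of
  \<open>levy_cut\<close>.\<close>

lemma prob_sup_stat_le:
  fixes I :: "'i set"
  assumes I: "finite I" and V: "convex_stat I V" and c: "\<And>i. i \<in> I \<Longrightarrow> c i \<le> m"
  shows "measure (gauss I) {g \<in> space (gauss I). t < sup_stat c m V g} \<le> 4 * measure (gauss I) {g \<in> space (gauss I). t < V g}"
proof -
  interpret prob_space "gauss I" by (rule prob_space_gauss)
  let ?S = "space (gauss I)"
  let ?T = "\<lambda>s g. \<lambda>i\<in>I. s ^ c i * g i"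
  let ?Q = "\<lambda>g. \<exists>k\<le>m. t < V (trunc_at c k g)"
  have cm[measurable]: "(\<lambda>g. V (trunc_at c k g)) \<in> borel_measurable (gauss I)" for k
    unfolding trunc_at_def by (rule convex_stat_measurable_mult[OF V])
  have Q: "{g \<in> ?S. ?Q g} \<in> events" by measurable
  have s: "\<bar>s ^ c i\<bar> = 1" if "s \<in> {-1, 1}" for s :: real and i
    using that by (auto simp: power_abs)
  have eq: "V (trunc_at c k (?T s g)) = V (trunc_at c k (\<lambda>i. s ^ c i * g i))" for s k g
    by (intro convex_stat_cong[OF V]) (simp add: trunc_at_def)
  have "{g \<in> ?S. t < sup_stat c m V g} = {g \<in> ?S. ?Q (?T (-1) g)} \<union> {g \<in> ?S. ?Q (?T 1 g)}"
    unfolding eq using sup_stat_le_iff[of c m V _ t] by (auto simp: not_le[symmetric] simp del: not_le)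
  then have "prob {g \<in> ?S. t < sup_stat c m V g} \<le> prob {g \<in> ?S. ?Q (?T (-1) g)} + prob {g \<in> ?S. ?Q (?T 1 g)}"
    using measure_gauss_flip(1)[OF I s Q] by (auto intro!: measure_Un_le)
  also have "\<dots> = prob {g \<in> ?S. ?Q g} + prob {g \<in> ?S. ?Q g}"
    by (intro arg_cong2[where f = "(+)"] measure_gauss_flip(2)[OF I s Q]) auto
  also have "\<dots> \<le> 4 * prob {g \<in> ?S. t < V g}"
    using levy_cut[OF I V c, where t = t] by simp
  finally show ?thesis .
qed

text \<open>Summation by parts writes \<open>y ^ c i\<close> as a convex combination of signed truncations.\<close>

lemma stat_power_le_sup_stat:
  assumes V: "convex_stat I V" and c: "\<And>i. i \<in> I \<Longrightarrow> c i \<le> m" and y: "\<bar>y\<bar> \<le> 1"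
  shows "V (\<lambda>i. y ^ c i * g i) \<le> sup_stat c m V g"
proof -
  define s where "s = (if 0 \<le> y then 1 else -1 :: real)"
  \<comment> \<open>The last weight keeps the whole power |y|^m, so that the weights from
    \<open>j\<close> to \<open>m\<close> telescope to exactly |y|^j; for j = 0 they sum to
    1.\<close>
  define w where "w k = (if k < m then \<bar>y\<bar> ^ k - \<bar>y\<bar> ^ Suc k else \<bar>y\<bar> ^ k)" for k
  have w0: "0 \<le> w k" for k
    using y power_decreasing[of k "Suc k" "\<bar>y\<bar>"] by (auto simp: w_def)
  have tail: "(\<Sum>k\<in>{j..m}. w k) = \<bar>y\<bar> ^ j" if j: "j \<le> m" for j
    using j
  proof (induction rule: inc_induct)
    case (step j)
    then have "{j..m} = insert j {Suc j..m}" by auto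
    then show ?case using step by (simp add: w_def)
  qed (simp add: w_def)
  have yp: "y ^ c i = (\<Sum>k\<le>m. w k * (of_bool (c i \<le> k) * s ^ c i))" if i: "i \<in> I" for i
  proof -
    have "(\<Sum>k\<le>m. w k * (of_bool (c i \<le> k) * s ^ c i)) = s ^ c i * (\<Sum>k\<le>m. if c i \<le> k then w k else 0)"
      unfolding sum_distrib_left by (intro sum.cong) auto
    also have "(\<Sum>k\<le>m. if c i \<le> k then w k else 0) = (\<Sum>k\<in>{k \<in> {..m}. c i \<le> k}. w k)"
      by (rule sum.inter_filter[symmetric]) simp
    also have "{k \<in> {..m}. c i \<le> k} = {c i..m}" by auto
    also have "(\<Sum>k\<in>{c i..m}. w k) = \<bar>y\<bar> ^ c i" by (rule tail[OF c[OF i]])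
    also have "s ^ c i * \<bar>y\<bar> ^ c i = y ^ c i" unfolding power_mult_distrib[symmetric] by (simp add: s_def)
    finally show ?thesis by simp
  qed
  have "V (\<lambda>i. y ^ c i * g i) = V (\<lambda>i. \<Sum>k\<le>m. w k * trunc_at c k (\<lambda>i. s ^ c i * g i) i)"
    by (intro convex_stat_cong[OF V]) (simp add: yp trunc_at_def sum_distrib_right mult.assoc)
  also have "\<dots> \<le> sup_stat c m V g"
    using tail[of 0] w0 by (intro convex_stat_convex[OF V] sup_stat_ge) (auto simp: s_def atLeast0AtMost)
  finally show ?thesis .
qed

text \<open>Unfolded: the maximum, over signs s_j and cutoffs k_j <= m for j < l, of the modulus of
  the sum of g_\<alpha> times the product of the s_j^(\<alpha>_j), taken over the \<alpha> in
  \<open>I\<close> with \<alpha>_j <= k_j for all j < l.\<close>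

primrec iterated_stat :: "nat \<Rightarrow> (nat \<Rightarrow> nat) set \<Rightarrow> nat \<Rightarrow> ((nat \<Rightarrow> nat) \<Rightarrow> real) \<Rightarrow> real" where
  "iterated_stat m I 0 = (\<lambda>g. \<bar>\<Sum>\<alpha>\<in>I. g \<alpha>\<bar>)"
| "iterated_stat m I (Suc l) = sup_stat (\<lambda>\<alpha>. \<alpha> l) m (iterated_stat m I l)"

lemma convex_stat_iterated:
  shows "convex_stat I (iterated_stat m I l)"
proof (induction l)
  case 0
  show ?case
    unfolding convex_stat_def iterated_stat.simps
  proof (intro conjI allI impI)
    fix K :: "nat set" and w :: "nat \<Rightarrow> real" and f :: "nat \<Rightarrow> (nat \<Rightarrow> nat) \<Rightarrow> real" and c
    assume K: "finite K" "sum w K = 1" and f: "\<forall>k\<in>K. 0 \<le> w k \<and> \<bar>\<Sum>i\<in>I. f k i\<bar> \<le> c"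
    have "\<bar>\<Sum>i\<in>I. \<Sum>k\<in>K. w k * f k i\<bar> = \<bar>\<Sum>k\<in>K. w k * (\<Sum>i\<in>I. f k i)\<bar>"
      by (subst sum.swap) (simp add: sum_distrib_left)
    also have "\<dots> \<le> (\<Sum>k\<in>K. \<bar>w k * (\<Sum>i\<in>I. f k i)\<bar>)" by (rule sum_abs)
    also have "\<dots> \<le> (\<Sum>k\<in>K. w k * c)" using f by (intro sum_mono) (auto simp: abs_mult intro!: mult_left_mono)
    also have "\<dots> = c" using K by (simp add: sum_distrib_right[symmetric])
    finally show "\<bar>\<Sum>i\<in>I. \<Sum>k\<in>K. w k * f k i\<bar> \<le> c" .
  next
    show "(\<lambda>g. \<bar>\<Sum>\<alpha>\<in>I. g \<alpha>\<bar>) \<in> borel_measurable (gauss I)" by measurable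
  qed (auto intro!: arg_cong[where f = abs] sum.cong)
qed (simp add: convex_stat_sup_stat)

lemma multi_indices_le: "\<alpha> \<in> multi_indices m n \<Longrightarrow> j < n \<Longrightarrow> \<alpha> j \<le> m"
  using member_le_sum[of j "{..<n}" \<alpha>] by (auto simp: multi_indices_def)

lemma prob_iterated_stat_le:
  "l \<le> n \<Longrightarrow> measure (gauss (multi_indices m n)) {g \<in> space (gauss (multi_indices m n)). t < iterated_stat m (multi_indices m n) l g}
    \<le> 4 ^ l * measure (gauss (multi_indices m n)) {g \<in> space (gauss (multi_indices m n)). t < \<bar>\<Sum>\<alpha>\<in>multi_indices m n. g \<alpha>\<bar>}"
proof (induction l)
  case (Suc l)
  have "measure (gauss (multi_indices m n)) {g \<in> space (gauss (multi_indices m n)). t < iterated_stat m (multi_indices m n) (Suc l) g}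
    \<le> 4 * measure (gauss (multi_indices m n)) {g \<in> space (gauss (multi_indices m n)). t < iterated_stat m (multi_indices m n) l g}"
    unfolding iterated_stat.simps using Suc.prems
    by (intro prob_sup_stat_le finite_multi_indices convex_stat_iterated multi_indices_le) auto
  also have "\<dots> \<le> 4 * (4 ^ l * measure (gauss (multi_indices m n)) {g \<in> space (gauss (multi_indices m n)). t < \<bar>\<Sum>\<alpha>\<in>multi_indices m n. g \<alpha>\<bar>})"
    using Suc by simp
  finally show ?case by simp
qed simp

text \<open>One variable at a time, the power of x_l is moved into the coefficient vector and paid
  for by one more maximum; hence the induction over arbitrary \<open>g\<close>.\<close>

lemma hom_poly_le_iterated_stat:
  assumes x: "\<And>j. j < n \<Longrightarrow> \<bar>x j\<bar> \<le> 1"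
  shows "\<bar>hom_poly m n g x\<bar> \<le> iterated_stat m (multi_indices m n) n g"
proof -
  have "\<bar>\<Sum>\<alpha>\<in>multi_indices m n. (\<Prod>j<l. x j ^ \<alpha> j) * g \<alpha>\<bar> \<le> iterated_stat m (multi_indices m n) l g"
    if "l \<le> n" for l
    using that
  proof (induction l arbitrary: g)
    case (Suc l)
    have "\<bar>\<Sum>\<alpha>\<in>multi_indices m n. (\<Prod>j<Suc l. x j ^ \<alpha> j) * g \<alpha>\<bar>
        = \<bar>\<Sum>\<alpha>\<in>multi_indices m n. (\<Prod>j<l. x j ^ \<alpha> j) * (x l ^ \<alpha> l * g \<alpha>)\<bar>"
      by (simp add: mult_ac)
    also have "\<dots> \<le> iterated_stat m (multi_indices m n) l (\<lambda>\<alpha>. x l ^ \<alpha> l * g \<alpha>)"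
      using Suc by simp
    also have "\<dots> \<le> iterated_stat m (multi_indices m n) (Suc l) g"
      unfolding iterated_stat.simps using Suc.prems x
      by (intro stat_power_le_sup_stat[OF convex_stat_iterated] multi_indices_le) auto
    finally show ?case .
  qed simp
  from this[of n] show ?thesis by (simp add: hom_poly_def mult.commute)
qed

section \<open>The sup norm on the cube\<close>

lemma abs_hom_poly_le:
  assumes "\<And>j. j < n \<Longrightarrow> \<bar>x j\<bar> \<le> 1"
  shows "\<bar>hom_poly m n a x\<bar> \<le> (\<Sum>\<alpha>\<in>multi_indices m n. \<bar>a \<alpha>\<bar>)"
proof -
  have "\<bar>a \<alpha> * (\<Prod>j<n. x j ^ \<alpha> j)\<bar> \<le> \<bar>a \<alpha>\<bar>" for \<alpha>
  proof -
    have "\<bar>\<Prod>j<n. x j ^ \<alpha> j\<bar> \<le> 1"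
      unfolding abs_prod using assms by (intro prod_le_1) (auto simp: power_abs intro!: power_le_one)
    then show ?thesis by (simp add: abs_mult mult_left_le)
  qed
  then show ?thesis
    unfolding hom_poly_def by (intro order_trans[OF sum_abs] sum_mono)
qed

lemma cube_bdd_above:
  assumes "S \<subseteq> ({..<n} \<rightarrow>\<^sub>E {-1..1})"
  shows "bdd_above ((\<lambda>x. \<bar>hom_poly m n a x\<bar>) ` S)"
proof (rule bdd_aboveI2)
  fix x assume "x \<in> S"
  then have x: "x \<in> {..<n} \<rightarrow>\<^sub>E {-1..1}" using assms by blast
  have "\<bar>x j\<bar> \<le> 1" if "j < n" for j using PiE_mem[OF x, of j] that by (simp add: abs_le_iff)
  then show "\<bar>hom_poly m n a x\<bar> \<le> (\<Sum>\<alpha>\<in>multi_indices m n. \<bar>a \<alpha>\<bar>)" by (rule abs_hom_poly_le)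
qed

lemma hom_poly_le_cube_norm: "x \<in> {..<n} \<rightarrow>\<^sub>E {-1..1} \<Longrightarrow> \<bar>hom_poly m n a x\<bar> \<le> cube_norm m n a"
  unfolding cube_norm_def by (intro cSUP_upper cube_bdd_above) auto

lemma cube_nonempty: "({..<n} \<rightarrow>\<^sub>E {-1..1::real}) \<noteq> {}"
  by (auto simp: PiE_eq_empty_iff)

lemma cube_norm_le_iterated_stat: "cube_norm m n g \<le> iterated_stat m (multi_indices m n) n g"
  unfolding cube_norm_def
proof (intro cSUP_least cube_nonempty hom_poly_le_iterated_stat)
  fix x j assume x: "x \<in> {..<n} \<rightarrow>\<^sub>E {-1..1::real}" and j: "j < n"
  show "\<bar>x j\<bar> \<le> 1" using PiE_mem[OF x, of j] j by (simp add: abs_le_iff)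
qed

text \<open>The maximal inequality costs a factor 4 per variable, independent of \<open>m\<close>,
  over the Gaussian tail of the single sum P_g(1, ..., 1).\<close>

lemma prob_cube_norm_large:
  assumes n: "0 < n" and t: "0 \<le> t"
  shows "measure (gauss (multi_indices m n)) {g \<in> space (gauss (multi_indices m n)). t * sqrt (card (multi_indices m n)) < cube_norm m n g}
    \<le> 4 ^ n * (2 * exp (- t\<^sup>2 / 2))"
proof -
  let ?I = "multi_indices m n"
  interpret prob_space "gauss ?I" by (rule prob_space_gauss)
  let ?t = "t * sqrt (card ?I)"
  have [measurable]: "iterated_stat m ?I n \<in> borel_measurable (gauss ?I)"
    by (rule convex_stat_measurable[OF convex_stat_iterated])
  have "prob {g \<in> space (gauss ?I). ?t < cube_norm m n g} \<le> prob {g \<in> space (gauss ?I). ?t < iterated_stat m ?I n g}"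
    using cube_norm_le_iterated_stat[of m n] by (intro finite_measure_mono) (auto intro: less_le_trans)
  also have "\<dots> \<le> 4 ^ n * prob {g \<in> space (gauss ?I). ?t < \<bar>\<Sum>\<alpha>\<in>?I. g \<alpha>\<bar>}"
    by (rule prob_iterated_stat_le) simp
  also have "\<dots> \<le> 4 ^ n * (2 * exp (- t\<^sup>2 / 2))"
    using t by (intro mult_left_mono gauss_sum_tail finite_multi_indices multi_indices_nonempty n) auto
  finally show ?thesis .
qed

subsection \<open>Measurability of the ratio\<close>

lemma hom_poly_measurable [measurable]:
  "(\<lambda>a. hom_poly m n a x) \<in> borel_measurable (\<Pi>\<^sub>M i\<in>multi_indices m n. borel)"
  unfolding hom_poly_def by measurable

text \<open>A countable supremum is measurable. Rational points suffice because they are dense in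
  the cube and polynomials are continuous.\<close>

lemma cube_norm_rational:
  "cube_norm m n a = (SUP x \<in> {..<n} \<rightarrow>\<^sub>E ({-1..1} \<inter> \<rat>). \<bar>hom_poly m n a x\<bar>)"
proof (rule antisym)
  let ?Q = "{..<n} \<rightarrow>\<^sub>E ({-1..1} \<inter> \<rat> :: real set)"
  have sub: "?Q \<subseteq> ({..<n} \<rightarrow>\<^sub>E {-1..1})" by (intro PiE_mono) auto
  have "(\<lambda>j\<in>{..<n}. 0) \<in> ?Q" by simp
  then have ne: "?Q \<noteq> {}" by blast
  show "(SUP x \<in> ?Q. \<bar>hom_poly m n a x\<bar>) \<le> cube_norm m n a"
    unfolding cube_norm_def by (intro cSUP_subset_mono ne sub cube_bdd_above) auto
  show "cube_norm m n a \<le> (SUP x \<in> ?Q. \<bar>hom_poly m n a x\<bar>)"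
    unfolding cube_norm_def
  proof (intro cSUP_least cube_nonempty)
    fix x assume x: "x \<in> {..<n} \<rightarrow>\<^sub>E {-1..1::real}"
    \<comment> \<open>Rounding down to multiples of 1 / Suc k does not leave [-1, 1], because -1 is
      itself such a multiple.\<close>
    define q where "q k = (\<lambda>j\<in>{..<n}. of_int \<lfloor>real (Suc k) * x j\<rfloor> / real (Suc k))" for k
    have qQ: "q k \<in> ?Q" for k
    proof -
      have "of_int \<lfloor>real (Suc k) * x j\<rfloor> / real (Suc k) \<in> {-1..1}" if "j < n" for j
      proof -
        have xj: "-1 \<le> x j" "x j \<le> 1" using PiE_mem[OF x, of j] that by simp_all
        have "- real (Suc k) \<le> real (Suc k) * x j" using mult_left_mono[OF xj(1), of "real (Suc k)"] by simp
        then have "- int (Suc k) \<le> \<lfloor>real (Suc k) * x j\<rfloor>" by (simp add: le_floor_iff)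
        then have 1: "- real (Suc k) \<le> of_int \<lfloor>real (Suc k) * x j\<rfloor>" by linarith
        have "of_int \<lfloor>real (Suc k) * x j\<rfloor> \<le> real (Suc k) * x j" by simp
        also have "\<dots> \<le> real (Suc k)" using mult_left_mono[OF xj(2), of "real (Suc k)"] by simp
        finally show ?thesis using 1 by (simp add: field_simps del: of_nat_Suc)
      qed
      then show ?thesis by (auto simp: q_def)
    qed
    have lim: "(\<lambda>k. q k j) \<longlonglongrightarrow> x j" if "j < n" for j
    proof (rule LIMSEQ_I)
      fix e :: real assume "0 < e"
      then obtain k0 where k0: "1 / real (Suc k0) < e" using nat_approx_posE by blast
      have "norm (q k j - x j) < e" if "k0 \<le> k" for k
      proof -
        have "\<bar>of_int \<lfloor>real (Suc k) * x j\<rfloor> - real (Suc k) * x j\<bar> \<le> 1" by linarith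
        then have "\<bar>of_int \<lfloor>real (Suc k) * x j\<rfloor> - real (Suc k) * x j\<bar> / real (Suc k) \<le> 1 / real (Suc k)"
          by (intro divide_right_mono) auto
        also have "\<dots> \<le> 1 / real (Suc k0)" using that by (intro divide_left_mono) auto
        also note k0
        also have "\<bar>of_int \<lfloor>real (Suc k) * x j\<rfloor> - real (Suc k) * x j\<bar> / real (Suc k) = \<bar>q k j - x j\<bar>"
        proof -
          have "q k j - x j = (of_int \<lfloor>real (Suc k) * x j\<rfloor> - real (Suc k) * x j) / real (Suc k)"
            using \<open>j < n\<close> by (simp add: q_def diff_divide_distrib del: of_nat_Suc)
          then show ?thesis by (simp add: abs_divide del: of_nat_Suc)
        qed
        finally show ?thesis by simp
      qed
      then show "\<exists>no. \<forall>k\<ge>no. norm (q k j - x j) < e" by blast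
    qed
    have "(\<lambda>k. \<bar>hom_poly m n a (q k)\<bar>) \<longlonglongrightarrow> \<bar>hom_poly m n a x\<bar>"
      unfolding hom_poly_def by (intro tendsto_intros lim) auto
    moreover have "\<bar>hom_poly m n a (q k)\<bar> \<le> (SUP x \<in> ?Q. \<bar>hom_poly m n a x\<bar>)" for k
      by (intro cSUP_upper qQ cube_bdd_above sub)
    ultimately show "\<bar>hom_poly m n a x\<bar> \<le> (SUP x \<in> ?Q. \<bar>hom_poly m n a x\<bar>)"
      by (intro LIMSEQ_le_const2) auto
  qed
qed

lemma cube_norm_measurable [measurable]:
  "cube_norm m n \<in> borel_measurable (\<Pi>\<^sub>M i\<in>multi_indices m n. borel)"
proof -
  have "countable ({..<n} \<rightarrow>\<^sub>E ({-1..1} \<inter> \<rat> :: real set))"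
    by (intro countable_PiE countable_Int2 countable_rat) auto
  then show ?thesis
    unfolding cube_norm_rational[abs_def]
    by (rule borel_measurable_cSUP) (auto intro!: cube_bdd_above PiE_mono)
qed

lemma BH_ratio_measurable [measurable]:
  "BH_ratio m n \<in> borel_measurable (\<Pi>\<^sub>M i\<in>multi_indices m n. borel)"
proof -
  have [measurable]: "(\<lambda>a. a i) \<in> borel_measurable (\<Pi>\<^sub>M i\<in>multi_indices m n. (borel :: real measure))" if "i \<in> multi_indices m n" for i
    using that by measurable
  have "Measurable.pred (\<Pi>\<^sub>M i\<in>multi_indices m n. borel) (\<lambda>a. \<forall>\<alpha>\<in>multi_indices m n. a \<alpha> = (0::real))"
    by (intro pred_intros_finite finite_multi_indices) measurable
  moreover have "lp_norm p (multi_indices m n) \<in> borel_measurable (\<Pi>\<^sub>M i\<in>multi_indices m n. borel)" for p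
    unfolding lp_norm_def[abs_def] by measurable
  ultimately show ?thesis unfolding BH_ratio_def[abs_def] by measurable
qed

subsection \<open>Transfer to the sphere\<close>

lemma cube_norm_cong:
  "(\<And>\<alpha>. \<alpha> \<in> multi_indices m n \<Longrightarrow> a \<alpha> = b \<alpha>) \<Longrightarrow> cube_norm m n a = cube_norm m n b"
  unfolding cube_norm_def hom_poly_def by (simp cong: sum.cong)

lemma cube_norm_scale_le:
  assumes "0 \<le> r"
  shows "cube_norm m n (\<lambda>\<alpha>\<in>multi_indices m n. r * a \<alpha>) \<le> r * cube_norm m n a"
  unfolding cube_norm_def[of m n "\<lambda>\<alpha>\<in>multi_indices m n. r * a \<alpha>"]
proof (intro cSUP_least cube_nonempty)
  fix x assume x: "x \<in> {..<n} \<rightarrow>\<^sub>E {-1..1::real}"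
  have "\<bar>hom_poly m n (\<lambda>\<alpha>\<in>multi_indices m n. r * a \<alpha>) x\<bar> = r * \<bar>hom_poly m n a x\<bar>"
    using assms by (simp add: hom_poly_def mult.assoc sum_distrib_left[symmetric] abs_mult)
  also have "\<dots> \<le> r * cube_norm m n a"
    using assms by (intro mult_left_mono hom_poly_le_cube_norm x)
  finally show "\<bar>hom_poly m n (\<lambda>\<alpha>\<in>multi_indices m n. r * a \<alpha>) x\<bar> \<le> r * cube_norm m n a" .
qed

text \<open>The reverse inequality is \<open>cube_norm_scale_le\<close> for the scaled vector with
  factor 1 / r.\<close>

lemma cube_norm_scale:
  assumes r: "0 < r"
  shows "cube_norm m n (\<lambda>\<alpha>\<in>multi_indices m n. r * a \<alpha>) = r * cube_norm m n a"
proof (rule antisym)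
  let ?b = "\<lambda>\<alpha>\<in>multi_indices m n. r * a \<alpha>"
  show "cube_norm m n ?b \<le> r * cube_norm m n a" using r by (intro cube_norm_scale_le) simp
  have "cube_norm m n a = cube_norm m n (\<lambda>\<alpha>\<in>multi_indices m n. (1 / r) * ?b \<alpha>)"
    using r by (intro cube_norm_cong) simp
  also have "\<dots> \<le> (1 / r) * cube_norm m n ?b" using r by (intro cube_norm_scale_le) simp
  finally show "r * cube_norm m n a \<le> cube_norm m n ?b" using r by (simp add: field_simps)
qed

lemma BH_ratio_scale:
  assumes m: "0 < m" and r: "0 < r"
  shows "BH_ratio m n (\<lambda>\<alpha>\<in>multi_indices m n. r * a \<alpha>) = BH_ratio m n a"
proof -
  have p: "BH_exponent m \<noteq> 0" using BH_exponent_bounds(1)[OF m] by simp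
  have "(\<forall>\<alpha>\<in>multi_indices m n. (\<lambda>\<alpha>\<in>multi_indices m n. r * a \<alpha>) \<alpha> = 0) \<longleftrightarrow> (\<forall>\<alpha>\<in>multi_indices m n. a \<alpha> = 0)"
    using r by simp
  then show ?thesis
    using r unfolding BH_ratio_def lp_norm_scale[OF less_imp_le[OF r] p] cube_norm_scale[OF r] by simp
qed

lemma BH_ratio_sets:
  assumes "{y. P y} \<in> sets borel"
  shows "{a \<in> space (gauss (multi_indices m n)). P (BH_ratio m n a)} \<in> sets (gauss (multi_indices m n))"
proof -
  have "BH_ratio m n -` {y. P y} \<inter> space (\<Pi>\<^sub>M i\<in>multi_indices m n. borel) \<in> sets (\<Pi>\<^sub>M i\<in>multi_indices m n. borel)"
    by (rule measurable_sets[OF BH_ratio_measurable assms])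
  moreover have "BH_ratio m n -` {y. P y} \<inter> space (\<Pi>\<^sub>M i\<in>multi_indices m n. borel) = {a \<in> space (gauss (multi_indices m n)). P (BH_ratio m n a)}"
    by (auto simp: space_gauss space_PiM PiE_def)
  ultimately show ?thesis by (simp add: sets_gauss)
qed

lemma coeff_measure_eq_gauss:
  assumes m: "0 < m" and n: "0 < n" and P: "{y. P y} \<in> sets borel"
  shows "measure (coeff_measure m n) {a \<in> space (coeff_measure m n). P (BH_ratio m n a)}
    = measure (gauss (multi_indices m n)) {a \<in> space (gauss (multi_indices m n)). P (BH_ratio m n a)}"
  unfolding coeff_measure_def
proof (rule sphere_prob_eq_gauss)
  show "{x \<in> extensional (multi_indices m n). P (BH_ratio m n x)} \<in> sets (\<Pi>\<^sub>M i\<in>multi_indices m n. borel)"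
    using BH_ratio_sets[OF P, of m n] by (simp add: sets_gauss space_gauss)
qed (use m n in \<open>simp_all add: finite_multi_indices multi_indices_nonempty BH_ratio_scale\<close>)

subsection \<open>Many variables\<close>

lemma sign_cube_subset_cube: "sign_cube n \<subseteq> ({..<n} \<rightarrow>\<^sub>E {-1..1})"
  unfolding sign_cube_def by (intro PiE_mono) auto

lemma prob_cube_norm_small:
  assumes n: "0 < n" and l: "2 \<le> l"
  shows "measure (gauss (multi_indices m n))
     {g \<in> space (gauss (multi_indices m n)). cube_norm m n g \<le> l / 4 * sqrt (card (multi_indices m n))}
   \<le> 4 * ((\<Sum>x\<in>sign_cube n. exp (l\<^sup>2 * (complete_hom m n x / card (multi_indices m n)))) / 2 ^ n - 1)"
proof -
  let ?I = "multi_indices m n" and ?S = "sign_cube n"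
  interpret prob_space "gauss ?I" by (rule prob_space_gauss)
  define N where "N = real (card ?I)"
  define w where "w x \<alpha> = (\<Prod>j<n. x j ^ \<alpha> j)" for x :: "nat \<Rightarrow> real" and \<alpha> :: "nat \<Rightarrow> nat"
  define F where "F x = exp (l\<^sup>2 * (complete_hom m n x / N))" for x
  \<comment> \<open>For the level t = l / 4, \<open>gauss_max_lower\<close> requires exp (l^2 / 4)
    >= 2; l >= 2 ensures it through 1 + l^2 / 4.\<close>
  have exp2: "exp (l * (l / 4)) \<le> exp (l\<^sup>2 / 2) / 2"
  proof -
    have "4 \<le> l\<^sup>2" using power_mono[of 2 l 2] l by simp
    then have "2 \<le> exp (l\<^sup>2 / 4)" using exp_ge_add_one_self[of "l\<^sup>2 / 4"] by linarith
    then have "exp (l\<^sup>2 / 4) * 2 \<le> exp (l\<^sup>2 / 4) * exp (l\<^sup>2 / 4)" by (intro mult_left_mono) auto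
    also have "\<dots> = exp (l\<^sup>2 / 2)" by (simp add: exp_add[symmetric])
    finally show ?thesis by (simp add: power2_eq_square)
  qed
  have "(\<Sum>x\<in>?S. \<Sum>y\<in>?S. exp (l\<^sup>2 * ((\<Sum>\<alpha>\<in>?I. w x \<alpha> * w y \<alpha>) / N))) = (\<Sum>x\<in>?S. \<Sum>y\<in>?S. F (\<lambda>j\<in>{..<n}. x j * y j))"
    unfolding F_def w_def complete_hom_mult ..
  also have "\<dots> = (\<Sum>y\<in>?S. \<Sum>x\<in>?S. F (\<lambda>j\<in>{..<n}. x j * y j))" by (rule sum.swap)
  also have "\<dots> = (\<Sum>y\<in>?S. \<Sum>x\<in>?S. F x)" by (intro sum.cong refl sum_sign_cube_mult)
  also have "\<dots> = 2 ^ n * (\<Sum>x\<in>?S. F x)" by (simp add: card_sign_cube)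
  finally have avg: "(\<Sum>x\<in>?S. \<Sum>y\<in>?S. exp (l\<^sup>2 * ((\<Sum>\<alpha>\<in>?I. w x \<alpha> * w y \<alpha>) / N))) / (real (card ?S))\<^sup>2 = (\<Sum>x\<in>?S. F x) / 2 ^ n"
    by (simp add: card_sign_cube power2_eq_square)
  have "prob {g \<in> space (gauss ?I). cube_norm m n g \<le> l / 4 * sqrt N}
     \<le> prob {g \<in> space (gauss ?I). \<forall>x\<in>?S. (\<Sum>\<alpha>\<in>?I. w x \<alpha> * g \<alpha>) \<le> l / 4 * sqrt N}"
  proof (intro finite_measure_mono subsetI)
    fix g assume g: "g \<in> {g \<in> space (gauss ?I). cube_norm m n g \<le> l / 4 * sqrt N}"
    have "(\<Sum>\<alpha>\<in>?I. w x \<alpha> * g \<alpha>) \<le> l / 4 * sqrt N" if "x \<in> ?S" for x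
    proof -
      have "(\<Sum>\<alpha>\<in>?I. w x \<alpha> * g \<alpha>) = hom_poly m n g x" by (simp add: w_def hom_poly_def mult.commute)
      also have "\<dots> \<le> cube_norm m n g"
        using hom_poly_le_cube_norm[of x n m g] that sign_cube_subset_cube by fastforce
      finally show ?thesis using g by simp
    qed
    with g show "g \<in> {g \<in> space (gauss ?I). \<forall>x\<in>?S. (\<Sum>\<alpha>\<in>?I. w x \<alpha> * g \<alpha>) \<le> l / 4 * sqrt N}" by simp
  next
    have "Measurable.pred (gauss ?I) (\<lambda>g. \<forall>x\<in>?S. (\<Sum>\<alpha>\<in>?I. w x \<alpha> * g \<alpha>) \<le> l / 4 * sqrt N)"
      by (intro pred_intros_finite finite_sign_cube) measurable
    then show "{g \<in> space (gauss ?I). \<forall>x\<in>?S. (\<Sum>\<alpha>\<in>?I. w x \<alpha> * g \<alpha>) \<le> l / 4 * sqrt N} \<in> events"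
      by measurable
  qed
  also have "\<dots> \<le> 4 * ((\<Sum>x\<in>?S. \<Sum>y\<in>?S. exp (l\<^sup>2 * ((\<Sum>\<alpha>\<in>?I. w x \<alpha> * w y \<alpha>) / N))) / (real (card ?S))\<^sup>2 - 1)"
    unfolding N_def using l exp2
    by (intro gauss_max_lower finite_multi_indices multi_indices_nonempty n finite_sign_cube sign_cube_nonempty)
       (auto simp: w_def abs_monomial_sign_cube)
  finally show ?thesis unfolding avg unfolding F_def N_def .
qed

lemma BH_ratio_small_many_variables:
  assumes \<epsilon>: "0 < \<epsilon>" and \<eta>: "0 < \<eta>"
  obtains M where "\<And>m n. M \<le> m \<Longrightarrow> M \<le> n \<Longrightarrow>
    measure (coeff_measure m n) {a \<in> space (coeff_measure m n). BH_ratio m n a > \<epsilon>} \<le> \<eta>"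
proof -
  \<comment> \<open>Each exceptional event gets probability \<eta> / 2: here 1 / K for the Euclidean
    norm, and 4 * (\<eta> / 8) for the sup norm.\<close>
  define K where "K = 2 / \<eta>"
  \<comment> \<open>48 = 3 * 16, where 3 bounds e and 16 comes from the level l / 4, makes the final
    quotient sqrt (48 K / C) at most \<epsilon>. The maximum with 4 gives l >= 2.\<close>
  define C where "C = max 4 (48 * K / \<epsilon>\<^sup>2)"
  have K: "0 < K" using \<eta> by (simp add: K_def)
  have C: "4 \<le> C" "48 * K / \<epsilon>\<^sup>2 \<le> C" by (auto simp: C_def)
  have "0 < C" using C by simp
  moreover have "0 < \<eta> / 8" using \<eta> by simp
  ultimately obtain M where M: "\<And>m n. M \<le> m \<Longrightarrow> M \<le> n \<Longrightarrow>
    (\<Sum>x\<in>sign_cube n. exp (C * (1 + real n / real m) * (complete_hom m n x / real (card (multi_indices m n))))) / 2 ^ n \<le> 1 + \<eta> / 8"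
    by (rule mean_exp_correlation) blast
  show thesis
  proof (rule that)
    fix m n assume mn: "max M 1 \<le> m" "max M 1 \<le> n"
    then have m: "0 < m" and n: "0 < n" by auto
    let ?I = "multi_indices m n"
    interpret prob_space "gauss ?I" by (rule prob_space_gauss)
    define N where "N = real (card ?I)"
    have N: "0 < N"
      using finite_multi_indices multi_indices_nonempty[OF n] by (auto simp: N_def card_gt_0_iff)
    define D where "D = 1 + real n / real m"
    have D: "1 \<le> D" by (simp add: D_def)
    define l where "l = sqrt (C * D)"
    have CD: "4 \<le> C * D" using mult_mono[of 4 C 1 D] C D by simp
    have l2: "l\<^sup>2 = C * D" using CD by (simp add: l_def)
    have l: "2 \<le> l" using CD real_le_rsqrt[of 2 "C * D"] by (simp add: l_def)
    let ?A = "{g \<in> space (gauss ?I). cube_norm m n g \<le> l / 4 * sqrt N}"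
    let ?B = "{g \<in> space (gauss ?I). K * N \<le> (\<Sum>\<alpha>\<in>?I. (g \<alpha>)\<^sup>2)}"
    have A: "prob ?A \<le> \<eta> / 2"
      using prob_cube_norm_small[OF n l, of m] M[of m n] mn unfolding l2 N_def D_def by simp
    have B: "prob ?B \<le> \<eta> / 2"
      using gauss_norm_upper[OF finite_multi_indices multi_indices_nonempty[OF n] K, of m]
      by (simp add: N_def K_def)
    have "measure (coeff_measure m n) {a \<in> space (coeff_measure m n). BH_ratio m n a > \<epsilon>}
        = prob {a \<in> space (gauss ?I). BH_ratio m n a > \<epsilon>}"
      using m n by (intro coeff_measure_eq_gauss[where P = "\<lambda>y. y > \<epsilon>"]) auto
    also have "\<dots> \<le> prob (?A \<union> ?B)"
    proof (intro finite_measure_mono subsetI)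
      fix g assume g: "g \<in> {a \<in> space (gauss ?I). BH_ratio m n a > \<epsilon>}"
      show "g \<in> ?A \<union> ?B"
      proof (rule ccontr)
        assume "g \<notin> ?A \<union> ?B"
        with g have *: "l / 4 * sqrt N < cube_norm m n g" "(\<Sum>\<alpha>\<in>?I. (g \<alpha>)\<^sup>2) < K * N" by auto
        have pos: "0 < l / 4 * sqrt N" using l N by simp
        have "lp_norm (BH_exponent m) ?I g \<le> sqrt (exp 1 * D) * L2_set g ?I"
          unfolding D_def by (rule lp_norm_BH_le[OF m n])
        also have "\<dots> \<le> sqrt (3 * D) * sqrt (K * N)"
          using *(2) exp_le D unfolding L2_set_def by (intro mult_mono real_sqrt_le_mono mult_right_mono) (auto simp: sum_nonneg)
        finally have "lp_norm (BH_exponent m) ?I g / cube_norm m n g \<le> sqrt (3 * D) * sqrt (K * N) / (l / 4 * sqrt N)"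
          using *(1) pos K D N by (intro frac_le) auto
        also have "\<dots> = sqrt (48 * K / C)"
        proof -
          have "sqrt 48 = 4 * sqrt (3::real)" using real_sqrt_mult[of 16 "3::real"] by simp
          then show ?thesis
            using N D C by (simp add: l_def real_sqrt_mult real_sqrt_divide)
        qed
        also have "\<dots> \<le> \<epsilon>"
        proof (rule real_le_lsqrt)
          have "48 * K \<le> C * \<epsilon>\<^sup>2" using C(2) \<epsilon> by (simp add: divide_le_eq)
          then show "48 * K / C \<le> \<epsilon>\<^sup>2" using C by (simp add: divide_le_eq mult.commute)
        qed (use \<epsilon> K C in auto)
        finally have "BH_ratio m n g \<le> \<epsilon>" using \<epsilon> by (simp add: BH_ratio_def)
        with g show False by simp
      qed
    next
      have [measurable]: "cube_norm m n \<in> borel_measurable (gauss ?I)"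
        using cube_norm_measurable by (simp add: measurable_cong_sets[OF sets_gauss refl])
      show "?A \<union> ?B \<in> events" by measurable
    qed
    also have "\<dots> \<le> prob ?A + prob ?B"
    proof (rule measure_Un_le)
      have [measurable]: "cube_norm m n \<in> borel_measurable (gauss ?I)"
        using cube_norm_measurable by (simp add: measurable_cong_sets[OF sets_gauss refl])
      show "?A \<in> events" "?B \<in> events" by measurable
    qed
    also have "\<dots> \<le> \<eta>" using A B by simp
    finally show "measure (coeff_measure m n) {a \<in> space (coeff_measure m n). BH_ratio m n a > \<epsilon>} \<le> \<eta>" .
  qed
qed

subsection \<open>Fixed number of variables\<close>

text \<open>Outside four exceptional events, numerator and denominator both lie between positive
  multiples of sqrt N. The multiples do not depend on m > 0, because n / m <= n.\<close>

lemma BH_ratio_bounded_fixed_variables: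
  assumes n: "0 < n" and \<epsilon>: "0 < \<epsilon>"
  obtains c C where "0 < c" "c < C"
    "\<And>m. 0 < m \<Longrightarrow> 1 - \<epsilon> \<le> measure (coeff_measure m n)
        {a \<in> space (coeff_measure m n). c \<le> BH_ratio m n a \<and> BH_ratio m n a \<le> C}"
proof -
  \<comment> \<open>The exceptional events have probabilities at most \<open>d\<close>,
    \<open>2 * d\<close>, 1 / K = \<epsilon> / 4 and \<epsilon> / 4, in total 7 \<epsilon> /
    8.\<close>
  define d where "d = \<epsilon> / 8"
  have d: "0 < d" using \<epsilon> by (simp add: d_def)
  define K where "K = 4 / \<epsilon>"
  have K: "0 < K" using \<epsilon> by (simp add: K_def)
  have "((\<lambda>t::real. exp (- t\<^sup>2 / 2)) \<longlongrightarrow> 0) at_top" by real_asymp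
  then have "((\<lambda>t::real. 4 ^ n * (2 * exp (- t\<^sup>2 / 2))) \<longlongrightarrow> 0) at_top"
    by (intro tendsto_mult_right_zero)
  then have "\<forall>\<^sub>F t in at_top. 4 ^ n * (2 * exp (- t\<^sup>2 / 2)) < \<epsilon> / 4"
    by (rule order_tendstoD) (use \<epsilon> in simp)
  then have "\<forall>\<^sub>F t::real in at_top. 0 < t \<and> 4 ^ n * (2 * exp (- t\<^sup>2 / 2)) < \<epsilon> / 4"
    using eventually_gt_at_top[of 0] by eventually_elim simp
  then obtain t :: real where t: "0 < t" "4 ^ n * (2 * exp (- t\<^sup>2 / 2)) < \<epsilon> / 4"
    using eventually_happens trivial_limit_at_top_linorder by blast
  define c where "c = sqrt (d\<^sup>2 / 2) / t"
  define C where "C = sqrt (3 * (1 + real n)) * sqrt K / d"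
  have c: "0 < c" using d t by (simp add: c_def)
  have C: "0 < C" using d K by (simp add: C_def)
  show thesis
  \<comment> \<open>Adding \<open>c\<close> makes the upper constant strictly larger than the lower
    one without comparing \<open>c\<close> and \<open>C\<close>.\<close>
  proof (rule that[of c "c + C"])
    fix m :: nat assume m: "0 < m"
    let ?I = "multi_indices m n"
    interpret prob_space "gauss ?I" by (rule prob_space_gauss)
    define N where "N = real (card ?I)"
    have N: "0 < N"
      using finite_multi_indices multi_indices_nonempty[OF n] by (auto simp: N_def card_gt_0_iff)
    note I = finite_multi_indices[of m n] multi_indices_nonempty[OF n, of m]
    have [measurable]: "cube_norm m n \<in> borel_measurable (gauss ?I)"
      using cube_norm_measurable by (simp add: measurable_cong_sets[OF sets_gauss refl])
    let ?G = "{a \<in> space (gauss ?I). c \<le> BH_ratio m n a \<and> BH_ratio m n a \<le> c + C}"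
    let ?B1 = "{g \<in> space (gauss ?I). \<bar>\<Sum>\<alpha>\<in>?I. g \<alpha>\<bar> < d * sqrt N}"
    let ?B2 = "{g \<in> space (gauss ?I). K * N \<le> (\<Sum>\<alpha>\<in>?I. (g \<alpha>)\<^sup>2)}"
    let ?B3 = "{g \<in> space (gauss ?I). (\<Sum>\<alpha>\<in>?I. (g \<alpha>)\<^sup>2) < d\<^sup>2 * N / 2}"
    let ?B4 = "{g \<in> space (gauss ?I). t * sqrt N < cube_norm m n g}"
    have B1: "prob ?B1 \<le> d" unfolding N_def using d by (intro gauss_sum_small I) simp
    have B2: "prob ?B2 \<le> 1 / K" unfolding N_def by (rule gauss_norm_upper[OF I K])
    have B3: "prob ?B3 \<le> 2 * d" unfolding N_def by (rule gauss_norm_lower[OF I d])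
    have B4: "prob ?B4 \<le> 4 ^ n * (2 * exp (- t\<^sup>2 / 2))"
      unfolding N_def using t by (intro prob_cube_norm_large n) simp
    have BE: "?B1 \<in> events" "?B2 \<in> events" "?B3 \<in> events" "?B4 \<in> events" by measurable
    have G: "?G \<in> events" by (rule BH_ratio_sets) auto
    have "space (gauss ?I) \<subseteq> ?G \<union> (?B1 \<union> (?B2 \<union> (?B3 \<union> ?B4)))"
    proof
      fix g assume g: "g \<in> space (gauss ?I)"
      show "g \<in> ?G \<union> (?B1 \<union> (?B2 \<union> (?B3 \<union> ?B4)))"
      proof (rule ccontr)
        assume n': "g \<notin> ?G \<union> (?B1 \<union> (?B2 \<union> (?B3 \<union> ?B4)))"
        with g have b: "d * sqrt N \<le> \<bar>\<Sum>\<alpha>\<in>?I. g \<alpha>\<bar>" "(\<Sum>\<alpha>\<in>?I. (g \<alpha>)\<^sup>2) < K * N"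
          "d\<^sup>2 * N / 2 \<le> (\<Sum>\<alpha>\<in>?I. (g \<alpha>)\<^sup>2)" "cube_norm m n g \<le> t * sqrt N" by auto
        have dN: "0 < d * sqrt N" using d N by simp
        have "hom_poly m n g (\<lambda>j\<in>{..<n}. 1) = (\<Sum>\<alpha>\<in>?I. g \<alpha>)" by (simp add: hom_poly_def)
        then have low: "d * sqrt N \<le> cube_norm m n g"
          using hom_poly_le_cube_norm[of "\<lambda>j\<in>{..<n}. 1" n m g] b(1) by simp
        have cpos: "0 < cube_norm m n g" using dN low by (rule less_le_trans)
        have nz: "\<not> (\<forall>\<alpha>\<in>?I. g \<alpha> = 0)"
        proof
          assume "\<forall>\<alpha>\<in>?I. g \<alpha> = 0"
          then have "(\<Sum>\<alpha>\<in>?I. g \<alpha>) = 0" by (rule sum.neutral)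
          with b(1) dN show False by simp
        qed
        have q: "BH_ratio m n g = lp_norm (BH_exponent m) ?I g / cube_norm m n g"
          unfolding BH_ratio_def by (rule if_not_P[OF nz])
        have "sqrt (d\<^sup>2 * N / 2) \<le> L2_set g ?I" unfolding L2_set_def using b(3) by (rule real_sqrt_le_mono)
        also have "\<dots> \<le> lp_norm (BH_exponent m) ?I g"
          by (rule L2_le_lp_norm[OF I(1) BH_exponent_bounds(1,2)[OF m]])
        finally have "sqrt (d\<^sup>2 * N / 2) / (t * sqrt N) \<le> BH_ratio m n g"
          unfolding q using b(4) cpos by (intro frac_le) auto
        moreover have "sqrt (d\<^sup>2 * N / 2) / (t * sqrt N) = c"
          using N by (simp add: c_def real_sqrt_mult real_sqrt_divide)
        ultimately have lo: "c \<le> BH_ratio m n g" by simp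
        have "lp_norm (BH_exponent m) ?I g \<le> sqrt (exp 1 * (1 + real n / real m)) * L2_set g ?I"
          by (rule lp_norm_BH_le[OF m n])
        also have "\<dots> \<le> sqrt (3 * (1 + real n)) * sqrt (K * N)"
        proof (intro mult_mono real_sqrt_le_mono)
          have "real n / real m \<le> real n" using m divide_left_mono[of 1 "real m" "real n"] by simp
          then show "1 + real n / real m \<le> 1 + real n" by simp
          show "L2_set g ?I \<le> sqrt (K * N)" unfolding L2_set_def using b(2) by (intro real_sqrt_le_mono) simp
        qed (use exp_le in \<open>auto simp: L2_set_nonneg\<close>)
        finally have "BH_ratio m n g \<le> sqrt (3 * (1 + real n)) * sqrt (K * N) / (d * sqrt N)"
          unfolding q using low dN K N by (intro frac_le) auto
        also have "\<dots> = C" using N by (simp add: C_def real_sqrt_mult)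
        finally have "BH_ratio m n g \<le> c + C" using c by simp
        with lo g n' show False by simp
      qed
    qed
    then have "prob (space (gauss ?I)) \<le> prob (?G \<union> (?B1 \<union> (?B2 \<union> (?B3 \<union> ?B4))))"
      by (rule finite_measure_mono) (intro sets.Un G BE)
    then have "1 \<le> prob (?G \<union> (?B1 \<union> (?B2 \<union> (?B3 \<union> ?B4))))" by (simp only: prob_space)
    also have "\<dots> \<le> prob ?G + (prob ?B1 + (prob ?B2 + (prob ?B3 + prob ?B4)))"
      by (intro order_trans[OF measure_Un_le] add_left_mono order_refl sets.Un G BE)
    also have "\<dots> \<le> prob ?G + (d + (1 / K + (2 * d + \<epsilon> / 4)))"
      using t(2) by (intro add_left_mono add_mono B1 B2 B3 order_trans[OF B4 less_imp_le])
    also have "\<dots> \<le> prob ?G + \<epsilon>" using \<epsilon> by (simp add: d_def K_def)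
    finally have "1 - \<epsilon> \<le> prob ?G" by simp
    also have "prob ?G = measure (coeff_measure m n) {a \<in> space (coeff_measure m n). c \<le> BH_ratio m n a \<and> BH_ratio m n a \<le> c + C}"
      using m n by (intro coeff_measure_eq_gauss[where P = "\<lambda>y. c \<le> y \<and> y \<le> c + C", symmetric]) auto
    finally show "1 - \<epsilon> \<le> measure (coeff_measure m n) {a \<in> space (coeff_measure m n). c \<le> BH_ratio m n a \<and> BH_ratio m n a \<le> c + C}" .
  qed (use c C in auto)
qed

text \<open>Along the m with n m = v the ratio exceeds some \<open>c v\<close> with probability at
  least 1/2, so the hypothesis for \<epsilon> = \<open>c v\<close> excludes v eventually. Only
  finitely many positive values lie below a given bound.\<close>

lemma BH_ratio_tendsto_imp_many_variables:
  assumes n: "\<And>m. 1 \<le> m \<Longrightarrow> 0 < n m"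
    and lim: "\<And>\<epsilon>. 0 < \<epsilon> \<Longrightarrow> (\<lambda>m. measure (coeff_measure m (n m)) {a \<in> space (coeff_measure m (n m)). BH_ratio m (n m) a > \<epsilon>}) \<longlonglongrightarrow> 0"
  shows "filterlim n at_top sequentially"
  unfolding filterlim_at_top
proof
  fix Z :: nat
  have "\<exists>c>0. \<forall>m>0. 1 / 2 \<le> measure (coeff_measure m v) {a \<in> space (coeff_measure m v). c < BH_ratio m v a}"
    if v: "0 < v" for v
  proof -
    obtain c C where c: "0 < c" and *: "\<And>m. 0 < m \<Longrightarrow> 1 - 1 / 2 \<le> measure (coeff_measure m v)
        {a \<in> space (coeff_measure m v). c \<le> BH_ratio m v a \<and> BH_ratio m v a \<le> C}"
      by (rule BH_ratio_bounded_fixed_variables[OF v half_gt_zero[OF zero_less_one]]) blast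
    \<comment> \<open>Halving \<open>c\<close> turns the closed lower bound into the strict
      inequality of the hypothesis. The detour through the Gaussian measure makes
      \<open>BH_ratio_sets\<close> available for monotonicity.\<close>
    have "1 / 2 \<le> measure (coeff_measure m v) {a \<in> space (coeff_measure m v). c / 2 < BH_ratio m v a}" if m: "0 < m" for m
    proof -
      let ?I = "multi_indices m v"
      interpret prob_space "gauss ?I" by (rule prob_space_gauss)
      have "1 / 2 \<le> measure (coeff_measure m v) {a \<in> space (coeff_measure m v). c \<le> BH_ratio m v a \<and> BH_ratio m v a \<le> C}"
        using *[OF m] by linarith
      also have "\<dots> = prob {a \<in> space (gauss ?I). c \<le> BH_ratio m v a \<and> BH_ratio m v a \<le> C}"
        using m v by (intro coeff_measure_eq_gauss[where P = "\<lambda>y. c \<le> y \<and> y \<le> C"]) auto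
      also have "\<dots> \<le> prob {a \<in> space (gauss ?I). c / 2 < BH_ratio m v a}"
        using c by (intro finite_measure_mono BH_ratio_sets) auto
      also have "\<dots> = measure (coeff_measure m v) {a \<in> space (coeff_measure m v). c / 2 < BH_ratio m v a}"
        using m v by (intro coeff_measure_eq_gauss[where P = "\<lambda>y. c / 2 < y", symmetric]) auto
      finally show ?thesis .
    qed
    then show ?thesis using c by (intro exI[of _ "c / 2"]) auto
  qed
  then have "\<forall>v. \<exists>c. 0 < v \<longrightarrow> 0 < c \<and>
      (\<forall>m>0. 1 / 2 \<le> measure (coeff_measure m v) {a \<in> space (coeff_measure m v). c < BH_ratio m v a})"
    by blast
  from choice[OF this] obtain c where c: "\<And>v. 0 < v \<Longrightarrow> 0 < c v"
    and half: "\<And>v m. 0 < v \<Longrightarrow> 0 < m \<Longrightarrow> 1 / 2 \<le> measure (coeff_measure m v) {a \<in> space (coeff_measure m v). c v < BH_ratio m v a}"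
    by blast
  have "\<forall>v\<in>{1..<Z}. \<forall>\<^sub>F m in sequentially. n m \<noteq> v"
  proof
    fix v assume "v \<in> {1..<Z}"
    then have v: "0 < v" by simp
    have "\<forall>\<^sub>F m in sequentially. measure (coeff_measure m (n m)) {a \<in> space (coeff_measure m (n m)). BH_ratio m (n m) a > c v} < 1 / 2"
      by (rule order_tendstoD[OF lim[OF c[OF v]]]) simp
    then show "\<forall>\<^sub>F m in sequentially. n m \<noteq> v"
      using eventually_gt_at_top[of 0]
    proof eventually_elim
      case (elim m)
      then show ?case using half[OF v, of m] by auto
    qed
  qed
  then have "\<forall>\<^sub>F m in sequentially. \<forall>v\<in>{1..<Z}. n m \<noteq> v"
    by (intro eventually_ball_finite) auto
  then show "\<forall>\<^sub>F m in sequentially. Z \<le> n m"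
    using eventually_ge_at_top[of 1]
  proof eventually_elim
    case (elim m)
    then show ?case using n[of m] by (metis One_nat_def Suc_leI atLeastLessThan_iff not_le)
  qed
qed

theorem theoremD:
  shows "(\<forall>n :: nat \<Rightarrow> nat. (\<forall>m\<ge>1. 0 < n m) \<longrightarrow>
            ((\<forall>\<epsilon>>0. (\<lambda>m. measure (coeff_measure m (n m))
                            {a \<in> space (coeff_measure m (n m)). BH_ratio m (n m) a > \<epsilon>})
                      \<longlonglongrightarrow> 0)
             \<longleftrightarrow> filterlim n at_top sequentially))
       \<and> (\<forall>n\<ge>1. \<forall>\<epsilon>>0. \<exists>c C. 0 < c \<and> c < C \<and>
            (\<forall>\<^sub>F m in sequentially.
               measure (coeff_measure m n)
                 {a \<in> space (coeff_measure m n). c \<le> BH_ratio m n a \<and> BH_ratio m n a \<le> C}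
               \<ge> 1 - \<epsilon>))"
proof (intro conjI allI impI iffI)
  fix n :: "nat \<Rightarrow> nat" and \<epsilon> :: real
  assume lim: "filterlim n at_top sequentially" and \<epsilon>: "0 < \<epsilon>"
  let ?p = "\<lambda>m. measure (coeff_measure m (n m)) {a \<in> space (coeff_measure m (n m)). BH_ratio m (n m) a > \<epsilon>}"
  show "?p \<longlonglongrightarrow> 0"
  proof (rule order_tendstoI)
    fix y :: real assume "y < 0"
    then show "\<forall>\<^sub>F m in sequentially. y < ?p m"
      by (intro always_eventually allI less_le_trans[OF _ measure_nonneg])
  next
    fix y :: real assume y: "0 < y"
    then have "0 < y / 2" by simp
    with \<epsilon> obtain M where M: "\<And>m n. M \<le> m \<Longrightarrow> M \<le> n \<Longrightarrow>
      measure (coeff_measure m n) {a \<in> space (coeff_measure m n). BH_ratio m n a > \<epsilon>} \<le> y / 2"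
      by (rule BH_ratio_small_many_variables) blast
    have "\<forall>\<^sub>F m in sequentially. M \<le> n m" using lim by (simp add: filterlim_at_top)
    then show "\<forall>\<^sub>F m in sequentially. ?p m < y"
      using eventually_ge_at_top[of M]
    proof eventually_elim
      case (elim m)
      then show ?case using M[of m "n m"] y by simp
    qed
  qed
next
  fix n :: "nat \<Rightarrow> nat"
  assume "\<forall>m\<ge>1. 0 < n m" and "\<forall>\<epsilon>>0. (\<lambda>m. measure (coeff_measure m (n m))
     {a \<in> space (coeff_measure m (n m)). BH_ratio m (n m) a > \<epsilon>}) \<longlonglongrightarrow> 0"
  then show "filterlim n at_top sequentially"
    by (intro BH_ratio_tendsto_imp_many_variables) auto
next
  fix n :: nat and \<epsilon> :: real assume n: "1 \<le> n" and \<epsilon>: "0 < \<epsilon>"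
  from n have "0 < n" by simp
  then obtain c C where c: "0 < c" "c < C"
    "\<And>m. 0 < m \<Longrightarrow> 1 - \<epsilon> \<le> measure (coeff_measure m n)
        {a \<in> space (coeff_measure m n). c \<le> BH_ratio m n a \<and> BH_ratio m n a \<le> C}"
    by (rule BH_ratio_bounded_fixed_variables[OF _ \<epsilon>]) blast
  have "\<forall>\<^sub>F m in sequentially. 1 - \<epsilon> \<le> measure (coeff_measure m n)
        {a \<in> space (coeff_measure m n). c \<le> BH_ratio m n a \<and> BH_ratio m n a \<le> C}"
    using eventually_gt_at_top[of 0] by eventually_elim (rule c(3))
  with c show "\<exists>c C. 0 < c \<and> c < C \<and> (\<forall>\<^sub>F m in sequentially. 1 - \<epsilon> \<le> measure (coeff_measure m n)
        {a \<in> space (coeff_measure m n). c \<le> BH_ratio m n a \<and> BH_ratio m n a \<le> C})"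
    by blast
qed

end
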